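(* There exists an absolute constant $c>0$ such that for all sufficiently large primes $p$, uniformly over positive integers $d$, integers $\lambda$ coprime to $p$ and real numbers $L$, $$T_p(d,\lambda,L,p/d)<p^{\frac13-c}.$$
   Context: For a prime $p$, $d\in\mathbb N$, an integer $\lambda$ coprime to $p$, and real numbers $L$ and $N\ge1$, $T_p(d,\lambda,L,N)$ denotes the number of integers $x\in\mathbb N$ with $L+1\le x\le L+N$ and $x^d\equiv\lambda\pmod p$. *)

theory Defs
  imports Complex_Main "HOL-Number_Theory.Cong" "HOL-Computational_Algebra.Primes"
begin

text \<open>
  Whether \<open>0\<close> counts as a natural number is immaterial: for \<open>d > 0\<close> and \<open>l\<close> coprime to \<open>p\<close>,
  \<open>x = 0\<close> never solves the congruence.
\<close>

definition T_count :: "nat \<Rightarrow> nat \<Rightarrow> int \<Rightarrow> real \<Rightarrow> real \<Rightarrow> nat" where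
  "T_count p d l L N =
     card {x :: nat. L + 1 \<le> real x \<and> real x \<le> L + N \<and> [int x ^ d = l] (mod int p)}"

end

theory Submission
  imports "HOL-Real_Asymp.Real_Asymp" "HOL-Number_Theory.Number_Theory" Defs
begin

text \<open>
  The solutions of \<open>x\<^sup>d \<equiv> \<lambda>\<close> form a coset of the group \<open>H\<close> of \<open>d\<close>-th roots of unity modulo \<open>p\<close>. Let
  \<open>A\<close> be the part of it in an interval of length \<open>N = p / d\<close>. Pairs \<open>(x, y)\<close> in \<open>A\<close> with a given ratio
  \<open>r \<in> H\<close> are points of a translate of the lattice \<open>x \<equiv> r y\<close>, so \<open>|A|\<^sup>2\<close> is at most about
  \<open>d + N + N S\<close>, where \<open>S\<close> is the sum over \<open>r \<in> H\<close> of the inverse lengths of the shortest lattice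
  vectors. Coordinatewise products of shortest vectors and the divisor bound give
  \<open>S \<le> p\<^sup>\<epsilon> (1 + (d\<^sup>3 / p)\<^sup>1\<^sup>/\<^sup>4)\<close>. This settles all \<open>d\<close> except those near \<open>p\<^sup>1\<^sup>/\<^sup>3\<close> and \<open>p\<^sup>2\<^sup>/\<^sup>3\<close>.

  If \<open>d\<close> is near \<open>p\<^sup>2\<^sup>/\<^sup>3\<close> and \<open>|A|\<close> is near \<open>p\<^sup>1\<^sup>/\<^sup>3\<close>, then \<open>A\<close> is dense in its interval and contains many
  triples from short arithmetic progressions of all possible differences. The ratios \<open>(s, t) \<in> H\<^sup>2\<close>
  of such a triple satisfy one of a few linear equations, each with at most \<open>d\<^sup>2 / p + p\<^sup>1\<^sup>/\<^sup>2\<close> solutions.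

  If \<open>d\<close> is near \<open>p\<^sup>1\<^sup>/\<^sup>3\<close> and \<open>|A|\<close> is near \<open>d\<close>, then for a suitable \<open>r \<in> H\<close> the set \<open>B = A \<inter> r\<^sup>-\<^sup>1A\<close> is dense in a
  two-dimensional progression, hence has small doubling, and it is almost invariant under many
  \<open>h \<in> H\<close>. The multipliers \<open>s\<close> for which \<open>s (B - B)\<close> is covered by few translates of \<open>B - B\<close> are closed under
  ring operations of bounded complexity. Two such steps produce \<open>p / 2\<close> multipliers from \<open>H\<close>,
  whereas counting additive energies allows only about \<open>p\<^sup>2\<^sup>/\<^sup>3\<close>.
\<close>

section \<open>The divisor bound\<close>

text \<open>Multiplication maps pairs of divisors of the two factors onto the divisors of the
  product (\<open>division_decomp\<close>).\<close>

lemma card_divisors_mult_le: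
  fixes a b :: nat
  assumes "a > 0" "b > 0"
  shows "card {k. k dvd a * b} \<le> card {k. k dvd a} * card {k. k dvd b}"
proof -
  have "{k. k dvd a * b} \<subseteq> (\<lambda>(i, j). i * j) ` ({k. k dvd a} \<times> {k. k dvd b})"
    by (force dest: division_decomp)
  moreover have fin: "finite ({k. k dvd a} \<times> {k. k dvd b})"
    using assms by simp
  ultimately have "card {k. k dvd a * b} \<le> card ({k. k dvd a} \<times> {k. k dvd b})"
    by (meson card_image_le card_mono finite_imageI le_trans)
  thus ?thesis by (simp add: card_cartesian_product)
qed

text \<open>The cost of a prime below \<open>2 ^ k\<close> in the divisor bound. With
  \<open>t = e / k\<close> one has \<open>2 powr t >= 1 + t * ln 2 >= 1 + t / 2\<close>; multiplying
  by \<open>2 * k\<close> gives \<open>2 * k + e\<close>.\<close>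

lemma Suc_le_powr_bound:
  assumes "k > 0" "(q::nat) \<ge> 2"
  shows "real e + 1 \<le> real (2 * k) * real q powr (real e / real k)"
proof -
  have "2 powr (real e / real k) \<ge> 1 + (real e / real k) * ln 2"
    unfolding powr_def using exp_ge_add_one_self[of "real e / real k * ln 2"] by simp
  moreover have "ln 2 \<ge> (1/2::real)" using exp_half_le2 ln_ge_iff[of 2 "1/2"] by linarith
  hence "(real e / real k) * ln 2 \<ge> (real e / real k) * (1/2)" by (intro mult_left_mono) auto
  ultimately have "2 powr (real e / real k) \<ge> 1 + real e / real k / 2" by simp
  hence "real (2*k) * 2 powr (real e / real k) \<ge> real (2*k) * (1 + real e / real k / 2)"
    by (intro mult_left_mono) auto
  also have "real (2*k) * (1 + real e / real k / 2) = 2 * real k + real e"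
    using assms by (simp add: field_simps)
  finally have "real e + 1 \<le> real (2*k) * 2 powr (real e / real k)" using assms by linarith
  also have "\<dots> \<le> real (2*k) * real q powr (real e / real k)"
    using assms by (intro mult_left_mono powr_mono2) auto
  finally show ?thesis .
qed

text \<open>Induction that strips off one full prime power \<open>q ^ e\<close>, which has
  \<open>e + 1\<close> divisors. A prime below \<open>2 ^ k\<close> costs a factor
  \<open>2 * k\<close>; a larger prime costs nothing, because then
  \<open>e + 1 <= 2 ^ e <= q powr (e / k)\<close>.\<close>

lemma card_divisors_bound_aux:
  assumes "k > 0" "n > 0"
  shows "real (card {i. i dvd n}) \<le>
           real (2 * k) ^ card {q. prime q \<and> q dvd n \<and> q < 2 ^ k} * real n powr (1 / real k)"
  using assms(2)
proof (induction n rule: less_induct)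
  case (less n)
  show ?case
  proof (cases "n = 1")
    case True
    have *: "{q::nat. prime q \<and> q dvd 1 \<and> q < 2 ^ k} = {}" by auto
    show ?thesis unfolding True * by simp
  next
    case False
    then obtain q where q: "prime q" "q dvd n"
      using prime_factor_nat by blast
    define e where "e = multiplicity q n"
    obtain m where m: "n = q ^ e * m" "\<not> q dvd m"
      using multiplicity_decompose'[of n q] less.prems q unfolding e_def
      by (metis less_not_refl not_prime_unit)
    have e: "e > 0"
      using q less.prems unfolding e_def by (simp add: prime_multiplicity_gt_zero_iff)
    have m0: "m > 0" using m less.prems by (cases m) auto
    have qe: "q ^ e > 1" using q e one_less_power[of q e] prime_gt_1_nat by blast
    have mn: "m < n" using m0 qe m(1) by simp
    let ?P = "\<lambda>n. {r::nat. prime r \<and> r dvd n \<and> r < 2 ^ k}"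
    have finP: "finite (?P x)" for x by (rule finite_subset[of _ "{..<2^k}"]) auto
    have pe: "{i. i dvd q ^ e} = (\<lambda>j. q ^ j) ` {..e}"
      using q by (auto simp: divides_primepow_nat)
    have "card {i. i dvd q ^ e} \<le> e + 1" unfolding pe using card_image_le[of "{..e}"] by fastforce
    moreover have "card {i. i dvd n} \<le> card {i. i dvd q ^ e} * card {i. i dvd m}"
      unfolding m(1) using q m0 by (intro card_divisors_mult_le) (auto simp: prime_gt_0_nat)
    ultimately have "card {i. i dvd n} \<le> (e + 1) * card {i. i dvd m}"
      by (meson le_trans mult_le_mono1)
    hence "real (card {i. i dvd n}) \<le> real ((e + 1) * card {i. i dvd m})"
      by (simp only: of_nat_le_iff)
    hence 1: "real (card {i. i dvd n}) \<le> (real e + 1) * real (card {i. i dvd m})"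
      by (simp add: algebra_simps)
    have nm: "real n powr (1 / real k) = real q powr (real e / real k) * real m powr (1 / real k)"
    proof -
      have "real n = real q powr real e * real m" using q unfolding m(1)
        by (simp add: powr_realpow prime_gt_0_nat)
      thus ?thesis by (simp add: powr_mult powr_powr)
    qed
    note IH = less.IH[OF mn m0]
    show ?thesis
    proof (cases "q < 2 ^ k")
      case True
      have "x = q" if "prime x" "x dvd q ^ e" for x
        using that q(1) prime_dvd_power primes_dvd_imp_eq by blast
      hence "?P n = insert q (?P m)"
        using q True m e by (auto simp: prime_dvd_mult_iff)
      moreover have "q \<notin> ?P m" using m(2) by simp
      ultimately have c: "card (?P n) = Suc (card (?P m))" using finP by simp
      have "(real e + 1) * real (card {i. i dvd m}) \<le>
         (real (2 * k) * real q powr (real e / real k)) *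
         (real (2 * k) ^ card (?P m) * real m powr (1 / real k))"
        using IH Suc_le_powr_bound[OF assms(1), of q e] q
        by (intro mult_mono) (auto simp: prime_ge_2_nat)
      also have "\<dots> = real (2 * k) ^ card (?P n) * real n powr (1 / real k)"
        unfolding nm c by simp
      finally show ?thesis using 1 by linarith
    next
      case False
      have "?P m \<subseteq> ?P n" using m by auto
      hence "card (?P m) \<le> card (?P n)" using finP by (intro card_mono) auto
      hence pw: "real (2 * k) ^ card (?P m) \<le> real (2 * k) ^ card (?P n)"
        using assms by (intro power_increasing) auto
      have "real e + 1 \<le> 2 ^ e"
        using Suc_leI[OF less_exp[of e]] by (metis Suc_eq_plus1 of_nat_1 of_nat_add of_nat_le_iff of_nat_numeral of_nat_power)
      also have "\<dots> = (2 ^ k) powr (real e / real k)"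
        using assms by (simp add: powr_powr flip: powr_realpow)
      also have "\<dots> \<le> real q powr (real e / real k)"
        using False by (intro powr_mono2) (auto simp: not_less numeral_power_le_of_nat_cancel_iff)
      finally have "(real e + 1) * real (card {i. i dvd m}) \<le>
         real q powr (real e / real k) * (real (2 * k) ^ card (?P n) * real m powr (1 / real k))"
        using IH pw by (intro mult_mono order_trans[OF IH] mult_right_mono) auto
      also have "\<dots> = real (2 * k) ^ card (?P n) * real n powr (1 / real k)"
        unfolding nm by simp
      finally show ?thesis using 1 by linarith
    qed
  qed
qed

lemma card_divisors_powr_bound:
  assumes "\<epsilon> > 0"
  obtains C :: real where "C \<ge> 1" "\<And>n. n > 0 \<Longrightarrow> real (card {i::nat. i dvd n}) \<le> C * real n powr \<epsilon>"
proof -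
  obtain k0 where k0: "1 / \<epsilon> < real k0" using reals_Archimedean2 by blast
  have k: "k0 > 0" "1 / real k0 \<le> \<epsilon>"
    proof -
    show "k0 > 0" using k0 assms by (intro Nat.gr0I) (auto simp: field_simps)
    thus "1 / real k0 \<le> \<epsilon>" using k0 assms by (simp add: field_simps)
  qed
  \<comment> \<open>Fewer than \<open>2 ^ k0\<close> primes can carry a factor
    \<open>2 * k0\<close>, so the constant does not depend on \<open>n\<close>.\<close>
  show ?thesis
  proof (rule that[of "real (2 * k0) ^ (2 ^ k0)"])
    show "1 \<le> real (2 * k0) ^ 2 ^ k0" using k by (intro one_le_power) auto
    fix n :: nat assume n: "n > 0"
    have "card {q. prime q \<and> q dvd n \<and> q < 2 ^ k0} \<le> card {..<(2::nat) ^ k0}"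
      by (intro card_mono) auto
    hence "real (2 * k0) ^ card {q. prime q \<and> q dvd n \<and> q < 2 ^ k0} \<le> real (2 * k0) ^ (2 ^ k0)"
      using k by (intro power_increasing) auto
    moreover have "real n powr (1 / real k0) \<le> real n powr \<epsilon>"
      using k n by (intro powr_mono) auto
    ultimately show "real (card {i. i dvd n}) \<le> real (2 * k0) ^ 2 ^ k0 * real n powr \<epsilon>"
      by (intro order_trans[OF card_divisors_bound_aux[OF k(1) n]] mult_mono) auto
  qed
qed

section \<open>Points of two-dimensional lattices in boxes\<close>

text \<open>The vector \<open>(a, b)\<close> is a shortest one in the maximum norm. A lattice point
  in the box is determined by its determinant with \<open>(a, b)\<close>, a multiple of
  \<open>p\<close>, and by the block of length \<open>l\<close> that contains its first coordinate.
  Indeed, two points sharing both data differ by a vector parallel to \<open>(a, b)\<close> with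
  first coordinate below \<open>l\<close>; as \<open>b\<close> is no larger than \<open>a\<close> in
  absolute value, this difference is shorter than \<open>l\<close> and hence zero.\<close>

lemma card_lattice_box_aux:
  fixes \<Gamma> :: "(int \<times> int) set" and p l X a b :: int
  assumes diff: "\<And>x y x' y'. (x, y) \<in> \<Gamma> \<Longrightarrow> (x', y') \<in> \<Gamma> \<Longrightarrow> (x - x', y - y') \<in> \<Gamma>"
    and cross: "\<And>x y x' y'. (x, y) \<in> \<Gamma> \<Longrightarrow> (x', y') \<in> \<Gamma> \<Longrightarrow> p dvd x * y' - y * x'"
    and min: "\<And>x y. (x, y) \<in> \<Gamma> \<Longrightarrow> (x, y) \<noteq> (0, 0) \<Longrightarrow> max \<bar>x\<bar> \<bar>y\<bar> \<ge> l"
    and v: "(a, b) \<in> \<Gamma>" "\<bar>a\<bar> = l" "\<bar>b\<bar> \<le> l" and l: "l > 0" "l \<le> X" and p: "p > 0"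
  shows "finite {(x, y) \<in> \<Gamma>. \<bar>x\<bar> \<le> X \<and> \<bar>y\<bar> \<le> X}"
    and "real (card {(x, y) \<in> \<Gamma>. \<bar>x\<bar> \<le> X \<and> \<bar>y\<bar> \<le> X}) \<le> 12 * real_of_int X ^ 2 / p + 3 * X / l"
proof -
  let ?B = "{(x, y) \<in> \<Gamma>. \<bar>x\<bar> \<le> X \<and> \<bar>y\<bar> \<le> X}"
  have "?B \<subseteq> {-X..X} \<times> {-X..X}" by auto
  thus fin: "finite ?B" by (rule finite_subset) auto
  define m where "m = (2 * X * l) div p"
  define k where "k = (2 * X) div l"
  define f where "f = (\<lambda>(x, y). ((x * b - y * a) div p, (x + X) div l))"
  have inj: "inj_on f ?B"
  proof (rule inj_onI, clarsimp simp: f_def)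
    fix x y x' y'
    assume A: "(x, y) \<in> \<Gamma>" "(x', y') \<in> \<Gamma>"
      and eq: "(x * b - y * a) div p = (x' * b - y' * a) div p" "(x + X) div l = (x' + X) div l"
    have "x * b - y * a = x' * b - y' * a"
      using cross[OF A(1) v(1)] cross[OF A(2) v(1)] eq(1) by (metis dvd_div_mult_self)
    hence c: "(x - x') * b = (y - y') * a" by (simp add: algebra_simps)
    have dx: "\<bar>x - x'\<bar> < l"
    proof -
      have "(x + X) - (x' + X) = (x + X) mod l - (x' + X) mod l"
        using eq(2) by (metis add_diff_cancel_left div_mult_mod_eq)
      moreover have "0 \<le> (x + X) mod l" "(x + X) mod l < l" "0 \<le> (x' + X) mod l" "(x' + X) mod l < l"
        using l by auto
      ultimately show ?thesis by linarith
    qed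
    have "\<bar>y - y'\<bar> * l = \<bar>x - x'\<bar> * \<bar>b\<bar>" using c v(2) by (metis abs_mult)
    also have "\<dots> \<le> \<bar>x - x'\<bar> * l" using v(3) by (intro mult_left_mono) auto
    finally have "\<bar>y - y'\<bar> \<le> \<bar>x - x'\<bar>" using l by simp
    with dx have "max \<bar>x - x'\<bar> \<bar>y - y'\<bar> < l" by simp
    with min[OF diff[OF A]] show "x = x' \<and> y = y'" by fastforce
  qed
  have img: "f ` ?B \<subseteq> {-m..m} \<times> {0..k}"
  proof (clarsimp simp: f_def, intro conjI)
    fix x y assume A: "(x, y) \<in> \<Gamma>" "\<bar>x\<bar> \<le> X" "\<bar>y\<bar> \<le> X"
    have "\<bar>x * b - y * a\<bar> \<le> \<bar>x\<bar> * \<bar>b\<bar> + \<bar>y\<bar> * \<bar>a\<bar>"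
      by (metis abs_mult abs_triangle_ineq4)
    also have "\<dots> \<le> X * l + X * l" using A v l by (intro add_mono mult_mono) auto
    finally have *: "\<bar>x * b - y * a\<bar> \<le> 2 * X * l" by simp
    obtain c where c: "x * b - y * a = p * c" using cross[OF A(1) v(1)] by auto
    have "\<bar>c\<bar> \<le> m"
    proof -
      have "p * \<bar>c\<bar> \<le> 2 * X * l" using * c p by (simp add: abs_mult)
      hence "(p * \<bar>c\<bar>) div p \<le> m" unfolding m_def using p by (intro zdiv_mono1) auto
      thus ?thesis using p by simp
    qed
    thus "- m \<le> (x * b - y * a) div p" "(x * b - y * a) div p \<le> m" using c p by auto
    show "0 \<le> (x + X) div l" using A l by (simp add: pos_imp_zdiv_nonneg_iff)
    show "(x + X) div l \<le> k" unfolding k_def using A l by (intro zdiv_mono1) auto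
  qed
  have "card ?B \<le> card ({-m..m} \<times> {0..k})"
    by (rule card_inj_on_le[OF inj img]) auto
  hence "card ?B \<le> nat (2 * m + 1) * nat (k + 1)" by (simp add: card_cartesian_product)
  hence "int (card ?B) \<le> int (nat (2 * m + 1) * nat (k + 1))" by (simp only: of_nat_le_iff)
  moreover have m0: "m \<ge> 0" "k \<ge> 0" unfolding m_def k_def using l p
    by (auto simp: pos_imp_zdiv_nonneg_iff)
  ultimately have "int (card ?B) \<le> (2 * m + 1) * (k + 1)" by simp
  hence "real_of_int (int (card ?B)) \<le> real_of_int ((2 * m + 1) * (k + 1))"
    by (simp only: of_int_le_iff)
  hence 1: "real (card ?B) \<le> (2 * real_of_int m + 1) * (real_of_int k + 1)" by simp
  have mr: "real_of_int m \<le> 2 * X * l / p"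
    using real_of_int_div4[of "2 * X * l" p] unfolding m_def by simp
  have kr: "real_of_int k \<le> 2 * X / l"
    using real_of_int_div4[of "2 * X" l] unfolding k_def by simp
  have "(2 * real_of_int m + 1) * (real_of_int k + 1)
      \<le> (4 * real_of_int X * real_of_int l / real_of_int p + 1) * (2 * real_of_int X / real_of_int l + 1)"
    using mr kr m0 by (intro mult_mono) auto
  moreover have "(4 * real_of_int X * real_of_int l / real_of_int p + 1) * (2 * real_of_int X / real_of_int l + 1) =
      8 * (real_of_int X)^2 / p + 4 * real_of_int X * real_of_int l / p + 2 * real_of_int X / l + 1"
    using l p by (simp add: field_simps power2_eq_square)
  \<comment> \<open>The lower order terms are absorbed through \<open>l <= X\<close>: the term in
    \<open>X * l / p\<close> by \<open>X ^ 2 / p\<close>, and the 1 by \<open>X / l\<close>.\<close>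
  moreover have "4 * real_of_int X * real_of_int l / p \<le> 4 * (real_of_int X)^2 / p"
    using l p by (intro divide_right_mono) (auto simp: power2_eq_square)
  moreover have "(1::real) \<le> real_of_int X / real_of_int l" using l by simp
  ultimately have "(2 * real_of_int m + 1) * (real_of_int k + 1) \<le> 12 * real_of_int X ^ 2 / p + 3 * X / l"
    by simp
  with 1 show "real (card ?B) \<le> 12 * real_of_int X ^ 2 / p + 3 * X / l" by linarith
qed

section \<open>The lattice of pairs with a given ratio modulo p, and its shortest vector\<close>

definition lat :: "int \<Rightarrow> int \<Rightarrow> int \<Rightarrow> (int \<times> int) set" where
  "lat p r X = {(x, y). \<bar>x\<bar> \<le> X \<and> \<bar>y\<bar> \<le> X \<and> [x = r * y] (mod p)}"

text \<open>The first successive minimum of the lattice of pairs with ratio \<open>r\<close> modulo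
  \<open>p\<close>, taken in the maximum norm.\<close>

definition lam :: "int \<Rightarrow> int \<Rightarrow> nat" where
  "lam p r = (LEAST n. n > 0 \<and> (\<exists>x y. max \<bar>x\<bar> \<bar>y\<bar> = int n \<and> [x = r * y] (mod p)))"

lemma finite_lat: "finite (lat p r X)"
  by (rule finite_subset[of _ "{-X..X} \<times> {-X..X}"]) (auto simp: lat_def)

lemma zero_in_lat: "X \<ge> 0 \<Longrightarrow> (0, 0) \<in> lat p r X"
  by (simp add: lat_def)

lemma lam_props:
  assumes "p > 1"
  shows "lam p r > 0" "lam p r \<le> nat p"
    "\<exists>x y. max \<bar>x\<bar> \<bar>y\<bar> = int (lam p r) \<and> [x = r * y] (mod p)"
proof -
  let ?P = "\<lambda>n. n > 0 \<and> (\<exists>x y. max \<bar>x\<bar> \<bar>y\<bar> = int n \<and> [x = r * y] (mod p))"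
  \<comment> \<open>The vector \<open>(p, 0)\<close> lies in the lattice for every \<open>r\<close>,
    so the minimum exists.\<close>
  have P: "?P (nat p)"
    using assms by (intro conjI exI[of _ p] exI[of _ "0::int"]) (auto simp: cong_def)
  from LeastI[of ?P, OF P] show "lam p r > 0"
    "\<exists>x y. max \<bar>x\<bar> \<bar>y\<bar> = int (lam p r) \<and> [x = r * y] (mod p)" unfolding lam_def by auto
  from Least_le[of ?P, OF P] show "lam p r \<le> nat p" unfolding lam_def .
qed

lemma lam_le:
  assumes "[x = r * y] (mod p)" "(x, y) \<noteq> (0, 0)"
  shows "int (lam p r) \<le> max \<bar>x\<bar> \<bar>y\<bar>"
proof -
  have "lam p r \<le> nat (max \<bar>x\<bar> \<bar>y\<bar>)" unfolding lam_def using assms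
    by (intro Least_le conjI exI[of _ x] exI[of _ y]) auto
  thus ?thesis by linarith
qed

text \<open>The vector \<open>(r, 1)\<close> lies in the lattice.\<close>

lemma lam_less:
  assumes "0 < r" "r < p"
  shows "int (lam p r) < p"
  using lam_le[of r r 1 p] assms by simp

text \<open>Two vectors with the same ratio modulo \<open>p\<close> have determinant divisible by
  \<open>p\<close>, so the box count applies. It expects the first coordinate of the shortest vector
  to be the larger one; otherwise the two coordinates are exchanged.\<close>

lemma card_lat_le:
  assumes p: "p > 1" and X: "X \<ge> int (lam p r)"
  shows "real (card (lat p r X)) \<le> 12 * real_of_int X ^ 2 / p + 3 * X / lam p r"
proof -
  define \<Gamma> where "\<Gamma> = {(x, y). [x = r * y] (mod p)}"
  obtain a b where ab: "max \<bar>a\<bar> \<bar>b\<bar> = int (lam p r)" "[a = r * b] (mod p)"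
    using lam_props(3)[OF p] by blast
  have diff: "(x - x', y - y') \<in> \<Gamma>" if "(x, y) \<in> \<Gamma>" "(x', y') \<in> \<Gamma>" for x y x' y'
    using that cong_diff[of x "r * y" p x' "r * y'"] by (auto simp: \<Gamma>_def algebra_simps)
  have cross: "p dvd x * y' - y * x'" if "(x, y) \<in> \<Gamma>" "(x', y') \<in> \<Gamma>" for x y x' y'
  proof -
    have "[x * y' = (r * y) * y'] (mod p)" "[y * x' = y * (r * y')] (mod p)"
      using that by (auto simp: \<Gamma>_def intro!: cong_mult)
    hence "[x * y' = y * x'] (mod p)" by (smt (verit) cong_sym cong_trans mult.assoc mult.commute)
    thus ?thesis by (simp add: cong_iff_dvd_diff)
  qed
  have min: "max \<bar>x\<bar> \<bar>y\<bar> \<ge> int (lam p r)" if "(x, y) \<in> \<Gamma>" "(x, y) \<noteq> (0, 0)" for x y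
    using lam_le that by (auto simp: \<Gamma>_def)
  have l: "int (lam p r) > 0" using lam_props(1)[OF p] by simp
  show ?thesis
  proof (cases "\<bar>b\<bar> \<le> \<bar>a\<bar>")
    case True
    have "lat p r X = {(x, y) \<in> \<Gamma>. \<bar>x\<bar> \<le> X \<and> \<bar>y\<bar> \<le> X}" by (auto simp: lat_def \<Gamma>_def)
    moreover have "(a, b) \<in> \<Gamma>" "\<bar>a\<bar> = int (lam p r)" "\<bar>b\<bar> \<le> int (lam p r)"
      using ab True by (auto simp: \<Gamma>_def)
    ultimately show ?thesis
      using card_lattice_box_aux(2)[of \<Gamma> p "int (lam p r)" a b X, OF diff cross min] l X p by simp
  next
    case False
    have "lat p r X = prod.swap ` {(y, x) \<in> prod.swap ` \<Gamma>. \<bar>y\<bar> \<le> X \<and> \<bar>x\<bar> \<le> X}"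
      by (auto simp: lat_def \<Gamma>_def image_iff)
    hence "card (lat p r X) = card {(y, x) \<in> prod.swap ` \<Gamma>. \<bar>y\<bar> \<le> X \<and> \<bar>x\<bar> \<le> X}"
      by (simp add: card_image)
    moreover have "(b, a) \<in> prod.swap ` \<Gamma>" "\<bar>b\<bar> = int (lam p r)" "\<bar>a\<bar> \<le> int (lam p r)"
      using ab False by (auto simp: \<Gamma>_def)
    moreover have "p dvd x * y' - y * x'" if "(x, y) \<in> prod.swap ` \<Gamma>" "(x', y') \<in> prod.swap ` \<Gamma>" for x y x' y'
    proof -
      have "p dvd y' * x - x' * y" using that by (intro cross) auto
      thus ?thesis by (simp add: mult.commute)
    qed
    moreover have "(x - x', y - y') \<in> prod.swap ` \<Gamma>"
      if "(x, y) \<in> prod.swap ` \<Gamma>" "(x', y') \<in> prod.swap ` \<Gamma>" for x y x' y'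
      using that diff by force
    moreover have "max \<bar>x\<bar> \<bar>y\<bar> \<ge> int (lam p r)" if "(x, y) \<in> prod.swap ` \<Gamma>" "(x, y) \<noteq> (0, 0)" for x y
      using min[of y x] that by (auto simp: max.commute)
    ultimately show ?thesis
      using card_lattice_box_aux(2)[of "prod.swap ` \<Gamma>" p "int (lam p r)" b a X] l X p by simp
  qed
qed

lemma lat_eq_zero:
  assumes "0 \<le> X" "X < int (lam p r)"
  shows "lat p r X = {(0, 0)}"
  using assms lam_le[of _ r _ p] by (force simp: lat_def)

text \<open>Below the shortest length only the origin is left. With the origin removed the estimate
  therefore holds for boxes of every size and can be summed over ratios without a term counting the
  ratios.\<close>

lemma card_lat_nonzero_le:
  assumes p: "p > 1" and X: "X \<ge> 0"
  shows "real (card (lat p r X - {(0, 0)})) \<le> 12 * real_of_int X ^ 2 / p + 3 * X / lam p r"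
proof (cases "X \<ge> int (lam p r)")
  case True
  have "card (lat p r X - {(0, 0)}) \<le> card (lat p r X)" by (intro card_mono finite_lat) auto
  thus ?thesis using card_lat_le[OF p True] by linarith
next
  case False
  thus ?thesis using assms by (simp add: lat_eq_zero)
qed

lemma card_lat_le_Suc:
  assumes p: "p > 1" and X: "X \<ge> 0"
  shows "real (card (lat p r X)) \<le> 1 + 12 * real_of_int X ^ 2 / p + 3 * X / lam p r"
proof -
  have "card (lat p r X) = Suc (card (lat p r X - {(0, 0)}))"
    using card_Suc_Diff1[OF finite_lat zero_in_lat[OF X]] by metis
  thus ?thesis using card_lat_nonzero_le[OF assms, of r] by simp
qed

section \<open>Sums and products modulo a prime\<close>

text \<open>Cauchy-Schwarz for the fibre sizes \<open>c y\<close> of \<open>f\<close>: they add up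
  to the size of \<open>S\<close>, and their squares to the number of collisions.\<close>

lemma card_square_le_collisions:
  assumes "finite S"
  shows "(card S)\<^sup>2 \<le> card (f ` S) * card {(u, v). u \<in> S \<and> v \<in> S \<and> f u = f v}"
proof -
  define c where "c y = real (card {u \<in> S. f u = y})" for y
  let ?I = "f ` S"
  have fin: "finite ?I" using assms by simp
  have s1: "real (card S) = (\<Sum>y\<in>?I. c y)"
    using sum.image_gen[OF assms, of "\<lambda>_. 1::real" f] by (simp add: c_def)
  have "{(u, v). u \<in> S \<and> v \<in> S \<and> f u = f v} = (\<Union>y\<in>?I. {u \<in> S. f u = y} \<times> {u \<in> S. f u = y})"
    by auto
  also have "card \<dots> = (\<Sum>y\<in>?I. card ({u \<in> S. f u = y} \<times> {u \<in> S. f u = y}))"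
    using assms by (intro card_UN_disjoint) auto
  finally have s2: "real (card {(u, v). u \<in> S \<and> v \<in> S \<and> f u = f v}) = (\<Sum>y\<in>?I. (c y)\<^sup>2)"
    by (simp add: c_def card_cartesian_product power2_eq_square)
  let ?n = "real (card ?I)" and ?s = "\<Sum>y\<in>?I. c y"
  \<comment> \<open>Sum of the squared deviations from the mean fibre size, with the denominator
    cleared.\<close>
  have "0 \<le> (\<Sum>y\<in>?I. (?n * c y - ?s)\<^sup>2)" by (intro sum_nonneg) auto
  also have "\<dots> = (\<Sum>y\<in>?I. ?n\<^sup>2 * (c y)\<^sup>2 - 2 * ?n * ?s * c y + ?s\<^sup>2)"
    by (intro sum.cong) (auto simp: power2_eq_square algebra_simps)
  also have "\<dots> = ?n\<^sup>2 * (\<Sum>y\<in>?I. (c y)\<^sup>2) - 2 * ?n * ?s * ?s + ?n * ?s\<^sup>2"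
    by (simp add: sum.distrib sum_subtractf sum_distrib_left)
  also have "\<dots> = ?n * (?n * (\<Sum>y\<in>?I. (c y)\<^sup>2) - ?s\<^sup>2)"
    by (simp add: power2_eq_square algebra_simps)
  finally have "0 \<le> ?n * (?n * (\<Sum>y\<in>?I. (c y)\<^sup>2) - ?s\<^sup>2)" .
  hence "?s\<^sup>2 \<le> ?n * (\<Sum>y\<in>?I. (c y)\<^sup>2)"
  proof (cases "card ?I = 0")
    case False
    with \<open>0 \<le> ?n * _\<close> show ?thesis by (simp add: zero_le_mult_iff)
  qed (use fin in simp)
  hence "real ((card S)\<^sup>2) \<le> real (card ?I * card {(u, v). u \<in> S \<and> v \<in> S \<and> f u = f v})"
    using s1 s2 by simp
  thus ?thesis by (simp only: of_nat_le_iff)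
qed

section \<open>Additive energy between a set and its dilates\<close>

definition linear_energy :: "int \<Rightarrow> int set \<Rightarrow> int \<Rightarrow> ((int \<times> int) \<times> (int \<times> int)) set" where
  "linear_energy p Z s = {(u, v). u \<in> Z \<times> Z \<and> v \<in> Z \<times> Z \<and>
     (case u of (a, b) \<Rightarrow> (a + s * b) mod p) = (case v of (a, b) \<Rightarrow> (a + s * b) mod p)}"

lemma card_pow4_le_linear_energy:
  assumes "finite Z"
  shows "card Z ^ 4 \<le> card ((\<lambda>(a, b). (a + s * b) mod p) ` (Z \<times> Z)) * card (linear_energy p Z s)"
proof -
  have "(card (Z \<times> Z))\<^sup>2 \<le> card ((\<lambda>(a, b). (a + s * b) mod p) ` (Z \<times> Z)) * card (linear_energy p Z s)"
  proof -
    have "finite (Z \<times> Z)" using assms by simp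
    from card_square_le_collisions[OF this, of "\<lambda>(a, b). (a + s * b) mod p"]
    show ?thesis unfolding linear_energy_def .
  qed
  moreover have "(card (Z \<times> Z))\<^sup>2 = card Z ^ 4"
    by (simp add: card_cartesian_product power2_eq_square power4_eq_xxxx)
  ultimately show ?thesis by simp
qed

lemma cong_imp_eq_of_inj_on_mod:
  "inj_on (\<lambda>x. x mod (p::int)) Z \<Longrightarrow> a \<in> Z \<Longrightarrow> b \<in> Z \<Longrightarrow> [a = b] (mod p) \<Longrightarrow> a = b"
  by (auto simp: inj_on_def cong_def)

lemma prime_cong_mult_cancel:
  fixes p :: int
  assumes "prime p" "[a * c = b * c] (mod p)" "\<not> [c = 0] (mod p)"
  shows "[a = b] (mod p)"
proof -
  have "p dvd (a - b) * c" using assms(2) by (simp add: cong_iff_dvd_diff algebra_simps)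
  hence "p dvd a - b" using assms by (auto simp: prime_dvd_mult_iff cong_0_iff)
  thus ?thesis by (simp add: cong_iff_dvd_diff)
qed

text \<open>The diagonal \<open>u = v\<close> contributes the square of \<open>card Z\<close> for
  each \<open>s\<close>. Off the diagonal \<open>b\<close> and \<open>b'\<close> must differ modulo
  \<open>p\<close>, so the quadruple determines \<open>s\<close> as
  \<open>(a' - a) / (b - b')\<close>; hence all \<open>s\<close> together share at most
  \<open>card Z ^ 4\<close> such quadruples.\<close>

lemma sum_linear_energy_le:
  fixes p :: int
  assumes p: "prime p" and Z: "finite Z" "inj_on (\<lambda>x. x mod p) Z" and R: "R \<subseteq> {0..<p}"
  shows "(\<Sum>s\<in>R. card (linear_energy p Z s)) \<le> card Z ^ 4 + card R * (card Z)\<^sup>2"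
proof -
  have finR: "finite R" using R finite_subset by blast
  have finE: "finite (linear_energy p Z s)" for s
  proof (rule finite_subset)
    show "linear_energy p Z s \<subseteq> (Z \<times> Z) \<times> (Z \<times> Z)" unfolding linear_energy_def by blast
  qed (use Z(1) in simp)
  define D where "D = (\<lambda>(s, u). (s, u, u)) ` (R \<times> (Z \<times> Z))"
  define O' where "O' = (SIGMA s:R. linear_energy p Z s) - D"
  have "inj_on snd O'"
  proof (rule inj_onI)
    fix x y assume xy: "x \<in> O'" "y \<in> O'" "snd x = snd y"
    obtain s u v where x': "x = (s, u, v)" by (cases x)
    obtain a b a' b' where "u = (a, b)" "v = (a', b')" by (cases u; cases v)
    with x' have x: "x = (s, (a, b), (a', b'))" by simp
    obtain t where y: "y = (t, (a, b), (a', b'))" using xy(3) x by (cases y) auto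
    have mem: "a \<in> Z" "b \<in> Z" "a' \<in> Z" "b' \<in> Z" "s \<in> R" "t \<in> R"
      and e: "[a + s * b = a' + s * b'] (mod p)" "[a + t * b = a' + t * b'] (mod p)"
      and nd: "(a, b) \<noteq> (a', b')"
    proof -
      have "((a, b), (a', b')) \<in> linear_energy p Z s" "((a, b), (a', b')) \<in> linear_energy p Z t"
        and st: "s \<in> R" "t \<in> R" using xy x y unfolding O'_def by blast+
      thus mem': "a \<in> Z" "b \<in> Z" "a' \<in> Z" "b' \<in> Z"
        and "[a + s * b = a' + s * b'] (mod p)" "[a + t * b = a' + t * b'] (mod p)"
        unfolding linear_energy_def cong_def by simp_all
      show "s \<in> R" "t \<in> R" by fact+
      show "(a, b) \<noteq> (a', b')"
      proof
        assume "(a, b) = (a', b')"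
        hence "x = (\<lambda>(s, u). (s, u, u)) (s, (a, b))" using x by simp
        hence "x \<in> D" unfolding D_def using st mem' by blast
        thus False using xy unfolding O'_def by blast
      qed
    qed
    have "b \<noteq> b'"
    proof
      assume "b = b'"
      hence "[a = a'] (mod p)" using e(1) by (simp add: cong_add_rcancel)
      with mem Z(2) nd \<open>b = b'\<close> show False using cong_imp_eq_of_inj_on_mod by blast
    qed
    hence nb: "\<not> [b - b' = 0] (mod p)"
      using mem Z(2) cong_imp_eq_of_inj_on_mod[of p Z b b'] by (auto simp: cong_iff_dvd_diff)
    have "[s * (b - b') = t * (b - b')] (mod p)"
      using cong_diff[OF e] by (simp add: cong_iff_dvd_diff algebra_simps)
    hence "[s = t] (mod p)" using prime_cong_mult_cancel[OF p _ nb] by blast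
    moreover have "s \<in> {0..<p}" "t \<in> {0..<p}" using mem R by blast+
    ultimately have "s = t" by (simp add: cong_def)
    thus "x = y" using x y by simp
  qed
  hence "card O' = card (snd ` O')" by (simp add: card_image)
  also have "\<dots> \<le> card ((Z \<times> Z) \<times> (Z \<times> Z))"
  proof (rule card_mono)
    show "snd ` O' \<subseteq> (Z \<times> Z) \<times> (Z \<times> Z)" unfolding O'_def linear_energy_def by auto
  qed (use Z(1) in simp)
  also have "\<dots> = card Z ^ 4" by (simp add: card_cartesian_product power4_eq_xxxx)
  finally have 1: "card O' \<le> card Z ^ 4" .
  have "card D \<le> card (R \<times> (Z \<times> Z))" unfolding D_def using finR Z(1) by (intro card_image_le) auto
  hence 2: "card D \<le> card R * (card Z)\<^sup>2" by (simp add: card_cartesian_product power2_eq_square)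
  have "(\<Sum>s\<in>R. card (linear_energy p Z s)) = card (SIGMA s:R. linear_energy p Z s)"
    using finR finE by (subst card_SigmaI) auto
  also have "\<dots> \<le> card (O' \<union> D)"
    unfolding O'_def using finR finE Z(1) by (intro card_mono) (auto simp: D_def)
  also have "\<dots> \<le> card O' + card D" by (rule card_Un_le)
  finally show ?thesis using 1 2 by linarith
qed

text \<open>Averaging over the \<open>P\<close> nonzero residues gives an \<open>s\<close> of energy
  at most \<open>n ^ 4 / P + n ^ 2\<close>. By Cauchy-Schwarz the set \<open>Z + s Z\<close> then
  has at least \<open>P * n ^ 2 / (n ^ 2 + P)\<close> elements, which is at least half of the
  smaller of \<open>n ^ 2\<close> and \<open>P\<close>.\<close>

lemma exists_large_dilate_sum:
  fixes p :: int
  assumes p: "prime p" and Z: "finite Z" "Z \<noteq> {}" "inj_on (\<lambda>x. x mod p) Z"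
  obtains s where "s \<in> {1..<p}"
    "min ((card Z)\<^sup>2) (nat p - 1) \<le> 2 * card ((\<lambda>(a, b). (a + s * b) mod p) ` (Z \<times> Z))"
proof -
  define n where "n = card Z"
  define P where "P = nat p - 1"
  have p1: "p > 1" using p prime_gt_1_int by blast
  have n0: "n > 0" using Z by (simp add: n_def card_gt_0_iff)
  have cR: "card {1..<p} = P" by (simp add: P_def)
  have P0: "P > 0" using p1 by (simp add: P_def)
  have tot: "(\<Sum>s\<in>{1..<p}. card (linear_energy p Z s)) \<le> n ^ 4 + P * n\<^sup>2"
    using sum_linear_energy_le[OF p Z(1) Z(3), of "{1..<p}"] cR by (simp add: n_def)
  have "\<exists>s\<in>{1..<p}. P * card (linear_energy p Z s) \<le> n ^ 4 + P * n\<^sup>2"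
  proof (rule ccontr)
    assume "\<not> ?thesis"
    hence "(\<Sum>s\<in>{1..<p}. n ^ 4 + P * n\<^sup>2) < (\<Sum>s\<in>{1..<p}. P * card (linear_energy p Z s))"
      using p1 by (intro sum_strict_mono) (auto simp: not_le)
    hence "P * (n ^ 4 + P * n\<^sup>2) < P * (\<Sum>s\<in>{1..<p}. card (linear_energy p Z s))"
      by (simp add: cR sum_distrib_left del: card_atLeastLessThan_int)
    with tot show False by simp
  qed
  then obtain s where s: "s \<in> {1..<p}" "P * card (linear_energy p Z s) \<le> n ^ 4 + P * n\<^sup>2" by blast
  define V where "V = card ((\<lambda>(a, b). (a + s * b) mod p) ` (Z \<times> Z))"
  have "P * n ^ 4 \<le> P * (V * card (linear_energy p Z s))"
    using card_pow4_le_linear_energy[OF Z(1), of s p] unfolding V_def n_def by simp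
  also have "\<dots> \<le> V * (n ^ 4 + P * n\<^sup>2)"
    using mult_left_mono[OF s(2), of V] by (simp add: algebra_simps)
  finally have "n\<^sup>2 * (P * n\<^sup>2) \<le> n\<^sup>2 * (V * (n\<^sup>2 + P))"
    by (simp add: power4_eq_xxxx power2_eq_square algebra_simps)
  hence main: "P * n\<^sup>2 \<le> V * (n\<^sup>2 + P)" using n0 by simp
  have "min (n\<^sup>2) P \<le> 2 * V"
  proof (cases "n\<^sup>2 \<le> P")
    case True
    have "V * (n\<^sup>2 + P) \<le> V * (2 * P)" using True by simp
    hence "P * n\<^sup>2 \<le> V * (2 * P)" using main by linarith
    hence "P * n\<^sup>2 \<le> P * (2 * V)" by (simp only: ac_simps)
    hence "n\<^sup>2 \<le> 2 * V" using P0 by (metis nat_mult_le_cancel1)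
    thus ?thesis by simp
  next
    case False
    have "V * (n\<^sup>2 + P) \<le> V * (2 * n\<^sup>2)" using False by simp
    hence "P * n\<^sup>2 \<le> V * (2 * n\<^sup>2)" using main by linarith
    hence "n\<^sup>2 * P \<le> n\<^sup>2 * (2 * V)" by (simp only: ac_simps)
    hence "P \<le> 2 * V" using n0 by (metis nat_mult_le_cancel1 zero_less_power)
    thus ?thesis by simp
  qed
  with s that show ?thesis unfolding V_def n_def P_def by blast
qed

text \<open>
  Either every residue is a quotient of differences of \<open>Z\<close>, and an average dilate works, or some
  quotient \<open>q\<close> has a non-quotient \<open>q + 1\<close> as successor, and then \<open>Z + (q + 1) Z\<close> has no collisions.
\<close>
lemma exists_large_combination:
  fixes p :: int
  assumes p: "prime p" and Z: "finite Z" "card Z \<ge> 2" "inj_on (\<lambda>x. x mod p) Z"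
  obtains a b where
    "\<exists>z1\<in>Z. \<exists>z2\<in>Z. \<exists>z3\<in>Z. \<exists>z4\<in>Z. a = (z1 - z2) + (z3 - z4)"
    "\<exists>z1\<in>Z. \<exists>z2\<in>Z. \<exists>z3\<in>Z. \<exists>z4\<in>Z. b = (z1 - z2) + (z3 - z4)"
    "min ((card Z)\<^sup>2) (nat p - 1) \<le> 2 * card ((\<lambda>(x, y). (a * x + b * y) mod p) ` (Z \<times> Z))"
proof -
  define Q where "Q s \<longleftrightarrow> (\<exists>z1\<in>Z. \<exists>z2\<in>Z. \<exists>z3\<in>Z. \<exists>z4\<in>Z. z3 \<noteq> z4 \<and> [s * (z3 - z4) = z1 - z2] (mod p))"
    for s :: int
  have ne: "\<not> [z - z' = 0] (mod p)" if "z \<in> Z" "z' \<in> Z" "z \<noteq> z'" for z z'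
  proof
    assume "[z - z' = 0] (mod p)"
    hence "[z = z'] (mod p)" by (simp add: cong_iff_dvd_diff)
    with that cong_imp_eq_of_inj_on_mod[OF Z(3)] show False by blast
  qed
  have Zne: "Z \<noteq> {}" using Z by auto
  show ?thesis
  proof (cases "\<forall>s\<in>{0..<p}. Q s")
    case True
    obtain s where s: "s \<in> {1..<p}"
      "min ((card Z)\<^sup>2) (nat p - 1) \<le> 2 * card ((\<lambda>(a, b). (a + s * b) mod p) ` (Z \<times> Z))"
      by (rule exists_large_dilate_sum[OF p Z(1) Zne Z(3)])
    have "Q s" using True s(1) by simp
    then obtain z1 z2 z3 z4 where z: "z1 \<in> Z" "z2 \<in> Z" "z3 \<in> Z" "z4 \<in> Z" "z3 \<noteq> z4"
      "[s * (z3 - z4) = z1 - z2] (mod p)" unfolding Q_def by blast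
    define v u where "v = z3 - z4" and "u = z1 - z2"
    let ?f = "\<lambda>(a, b). (a + s * b) mod p" and ?g = "\<lambda>(x, y). (v * x + u * y) mod p"
    have nv: "\<not> [v = 0] (mod p)" using ne z unfolding v_def by blast
    \<comment> \<open>Since \<open>s * v\<close> is congruent to \<open>u\<close>, multiplication by
      the unit \<open>v\<close> carries \<open>x + s * y\<close> to \<open>v * x + u * y\<close>, so
      both images have the same size.\<close>
    have gf: "?g w = (v * ?f w) mod p" for w
    proof -
      obtain x y where w: "w = (x, y)" by fastforce
      have "[u * y = (s * v) * y] (mod p)"
        using z(6) unfolding u_def v_def by (intro cong_mult) (auto simp: cong_sym)
      hence "[v * x + u * y = v * (x + s * y)] (mod p)"
        using cong_add[OF cong_refl[of "v * x"]] by (fastforce simp: algebra_simps)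
      thus ?thesis by (simp add: w cong_def mod_mult_right_eq)
    qed
    have "?g ` (Z \<times> Z) = (\<lambda>t. (v * t) mod p) ` (?f ` (Z \<times> Z))"
      unfolding image_image using gf by (intro image_cong) auto
    moreover have "inj_on (\<lambda>t. (v * t) mod p) (?f ` (Z \<times> Z))"
    proof (rule inj_onI)
      fix t t' assume t: "t \<in> ?f ` (Z \<times> Z)" "t' \<in> ?f ` (Z \<times> Z)" "(v * t) mod p = (v * t') mod p"
      have "[t * v = t' * v] (mod p)" using t(3) by (simp add: cong_def mult.commute)
      hence "[t = t'] (mod p)" using prime_cong_mult_cancel[OF p _ nv] by blast
      thus "t = t'" using t(1,2) by (auto simp: cong_def)
    qed
    ultimately have "card (?g ` (Z \<times> Z)) = card (?f ` (Z \<times> Z))" by (simp add: card_image)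
    \<comment> \<open>The zero difference \<open>z3 - z3\<close> pads the coefficients to the
      required sum of two differences.\<close>
    moreover have "v = (z3 - z4) + (z3 - z3)" "u = (z1 - z2) + (z3 - z3)" by (simp_all add: v_def u_def)
    ultimately show ?thesis using that[of v u] z s(2) by metis
  next
    case False
    have "\<exists>x\<in>Z. \<exists>y\<in>Z. x \<noteq> y" using Z(1,2)
      by (metis One_nat_def Suc_1 card_le_Suc0_iff_eq not_less_eq_eq)
    hence Q0: "Q 0" unfolding Q_def by force
    \<comment> \<open>Starting from the quotient 0, adding 1 repeatedly would otherwise reach every
      residue.\<close>
    have "\<exists>m::nat. Q (int m) \<and> \<not> Q (int m + 1)"
    proof (rule ccontr)
      assume *: "\<not> ?thesis"
      have "Q (int m)" for m
      proof (induction m)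
        case (Suc m)
        hence "Q (int m + 1)" using * by blast
        thus ?case by (simp add: add.commute)
      qed (use Q0 in simp)
      moreover obtain s where "s \<in> {0..<p}" "\<not> Q s" using False by blast
      ultimately show False by (metis atLeastLessThan_iff int_nat_eq)
    qed
    then obtain m where m: "Q m" "\<not> Q (m + 1)" by blast
    then obtain z1 z2 z3 z4 where z: "z1 \<in> Z" "z2 \<in> Z" "z3 \<in> Z" "z4 \<in> Z" "z3 \<noteq> z4"
      "[m * (z3 - z4) = z1 - z2] (mod p)" unfolding Q_def by blast
    define v u where "v = z3 - z4" and "u = z1 - z2"
    have nv: "\<not> [v = 0] (mod p)" using ne z unfolding v_def by blast
    let ?g = "\<lambda>(x, y). (v * x + (u + v) * y) mod p"
    \<comment> \<open>With \<open>u\<close> congruent to \<open>m * v\<close>, a collision says,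
      after cancelling \<open>v\<close>, that \<open>(m + 1) * (y - y')\<close> is congruent to
      \<open>x' - x\<close>. If \<open>y\<close> and \<open>y'\<close> differed,
      \<open>m + 1\<close> would be a quotient of differences.\<close>
    have "inj_on ?g (Z \<times> Z)"
    proof (rule inj_onI, clarify)
      fix x y x' y' assume mem: "x \<in> Z" "y \<in> Z" "x' \<in> Z" "y' \<in> Z"
        and eq: "(v * x + (u + v) * y) mod p = (v * x' + (u + v) * y') mod p"
      have "p dvd (v * x + (u + v) * y) - (v * x' + (u + v) * y')"
        using eq by (simp add: mod_eq_dvd_iff)
      moreover have "p dvd (m * v - u) * (y - y')"
        using z(6) by (simp add: cong_iff_dvd_diff u_def v_def)
      ultimately have "p dvd ((v * x + (u + v) * y) - (v * x' + (u + v) * y')) + (m * v - u) * (y - y')"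
        by (rule dvd_add)
      also have "\<dots> = ((m + 1) * (y - y') - (x' - x)) * v" by (simp add: algebra_simps)
      finally have "p dvd (m + 1) * (y - y') - (x' - x)"
        using p nv by (auto simp: prime_dvd_mult_iff cong_0_iff)
      hence c: "[(m + 1) * (y - y') = x' - x] (mod p)" by (simp add: cong_iff_dvd_diff)
      have "y = y'"
      proof (rule ccontr)
        assume "y \<noteq> y'"
        hence "Q (m + 1)" unfolding Q_def using c mem by blast
        with m show False by blast
      qed
      moreover from this have "x = x'" using c mem cong_imp_eq_of_inj_on_mod[OF Z(3), of x' x]
        by (simp add: cong_iff_dvd_diff dvd_diff_commute)
      ultimately show "x = x' \<and> y = y'" by simp
    qed
    hence "card (?g ` (Z \<times> Z)) = (card Z)\<^sup>2"
      by (simp add: card_image card_cartesian_product power2_eq_square)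
    moreover have "v = (z3 - z4) + (z3 - z3)" "u + v = (z1 - z2) + (z3 - z4)" by (simp_all add: v_def u_def)
    ultimately show ?thesis using that[of v "u + v"] z by (metis min.cobounded1 mult_2 trans_le_add1)
  qed
qed

text \<open>Ruzsa's covering argument: let \<open>F\<close> be a largest subset of \<open>X\<close>
  whose translates \<open>f + A\<close> are disjoint modulo \<open>p\<close>. They all lie in
  \<open>X + A\<close>, which bounds \<open>F\<close>; by maximality each \<open>x + A\<close> meets
  some \<open>f + A\<close>, and this puts \<open>x\<close> into \<open>f + A - A\<close>.\<close>

lemma ruzsa_covering_mod:
  fixes p :: int
  assumes X: "finite X" and A: "finite A" "A \<noteq> {}" "inj_on (\<lambda>x. x mod p) A"
  obtains F where "F \<subseteq> X" "finite F"
    "card F * card A \<le> card ((\<lambda>(x, a). (x + a) mod p) ` (X \<times> A))"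
    "\<forall>x\<in>X. \<exists>f\<in>F. \<exists>a\<in>A. \<exists>a'\<in>A. [x = f + (a - a')] (mod p)"
proof -
  let ?g = "\<lambda>(x, a). (x + a) mod p"
  define \<F> where "\<F> = {F. F \<subseteq> X \<and> inj_on ?g (F \<times> A)}"
  have "finite \<F>" using X by (simp add: \<F>_def)
  moreover have "{} \<in> \<F>" by (simp add: \<F>_def)
  ultimately have "\<exists>F\<in>\<F>. card F = Max (card ` \<F>)"
    by (metis (no_types, lifting) Max_in empty_iff finite_imageI image_iff image_is_empty)
  then obtain F where F: "F \<in> \<F>" "card F = Max (card ` \<F>)" by blast
  have mx: "card G \<le> card F" if "G \<in> \<F>" for G using that F \<open>finite \<F>\<close> by simp
  have FX: "F \<subseteq> X" "inj_on ?g (F \<times> A)" using F by (auto simp: \<F>_def)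
  have finF: "finite F" using FX X finite_subset by blast
  have "card F * card A = card (?g ` (F \<times> A))"
    using FX by (simp add: card_image card_cartesian_product)
  also have "\<dots> \<le> card (?g ` (X \<times> A))" using FX X A by (intro card_mono) auto
  finally have c: "card F * card A \<le> card (?g ` (X \<times> A))" .
  have "\<exists>f\<in>F. \<exists>a\<in>A. \<exists>a'\<in>A. [x = f + (a - a')] (mod p)" if x: "x \<in> X" for x
  proof (cases "x \<in> F")
    case True
    thus ?thesis using A(2) by (metis add.right_neutral cong_refl diff_self ex_in_conv)
  next
    case False
    have "insert x F \<notin> \<F>"
    proof
      assume "insert x F \<in> \<F>"
      from mx[OF this] show False using False finF by simp
    qed
    hence "\<not> inj_on ?g (insert x F \<times> A)" using x FX by (auto simp: \<F>_def)
    then obtain y a y' a' where m: "y \<in> insert x F" "y' \<in> insert x F" "a \<in> A" "a' \<in> A"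
      "(y, a) \<noteq> (y', a')" and e: "[y + a = y' + a'] (mod p)"
      unfolding inj_on_def cong_def by auto
    have "\<not> (y \<in> F \<and> y' \<in> F)"
      using FX(2) m e unfolding inj_on_def cong_def by fastforce
    moreover have "\<not> (y = x \<and> y' = x)"
      using m e cong_imp_eq_of_inj_on_mod[OF A(3)] by (auto simp: cong_add_lcancel)
    ultimately consider "y = x" "y' \<in> F" | "y' = x" "y \<in> F" using m by blast
    thus ?thesis
    proof cases
      case 1
      hence "[x = y' + (a' - a)] (mod p)" using e by (simp add: cong_iff_dvd_diff algebra_simps)
      thus ?thesis using 1 m by blast
    next
      case 2
      hence "[x = y + (a - a')] (mod p)" using cong_sym[OF e] by (simp add: cong_iff_dvd_diff algebra_simps)
      thus ?thesis using 2 m by blast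
    qed
  qed
  with that FX finF c show ?thesis by blast
qed

section \<open>Multipliers that nearly preserve a difference set\<close>

definition covers_dilate :: "int \<Rightarrow> int set \<Rightarrow> nat \<Rightarrow> int \<Rightarrow> bool" where
  "covers_dilate p A K s \<longleftrightarrow> (\<exists>F. finite F \<and> card F \<le> K \<and>
     (\<forall>a\<in>A. \<forall>b\<in>A. \<exists>f\<in>F. \<exists>c\<in>A. \<exists>e\<in>A. [s * (a - b) = f + (c - e)] (mod p)))"

text \<open>Small doubling of the difference set in covering form. The number \<open>K\<close> is
  the price paid each time two multipliers are added.\<close>

definition covers_double :: "int \<Rightarrow> int set \<Rightarrow> nat \<Rightarrow> bool" where
  "covers_double p A K \<longleftrightarrow> (\<exists>F. finite F \<and> card F \<le> K \<and>
     (\<forall>a\<in>A. \<forall>b\<in>A. \<forall>c\<in>A. \<forall>e\<in>A. \<exists>f\<in>F. \<exists>c'\<in>A. \<exists>e'\<in>A.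
        [(a - b) + (c - e) = f + (c' - e')] (mod p)))"

lemma covers_double_mono: "covers_double p A K \<Longrightarrow> K \<le> L \<Longrightarrow> covers_double p A L"
  unfolding covers_double_def by (elim exE conjE, intro exI conjI) (assumption | rule le_trans)+

lemma covers_dilate_cong:
  assumes "covers_dilate p A K s" "[s = t] (mod p)"
  shows "covers_dilate p A K t"
proof -
  obtain F where F: "finite F" "card F \<le> K"
    "\<forall>a\<in>A. \<forall>b\<in>A. \<exists>f\<in>F. \<exists>c\<in>A. \<exists>e\<in>A. [s * (a - b) = f + (c - e)] (mod p)"
    using assms(1) unfolding covers_dilate_def by blast
  have "\<exists>f\<in>F. \<exists>c\<in>A. \<exists>e\<in>A. [t * (a - b) = f + (c - e)] (mod p)" if ab: "a \<in> A" "b \<in> A" for a b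
  proof -
    obtain f c e where f: "f \<in> F" "c \<in> A" "e \<in> A" "[s * (a - b) = f + (c - e)] (mod p)"
      using F(3) ab by blast
    have "[t * (a - b) = s * (a - b)] (mod p)"
      using cong_sym[OF assms(2)] by (rule cong_mult[OF _ cong_refl])
    from cong_trans[OF this f(4)] show ?thesis using f(1-3) by blast
  qed
  with F(1,2) show ?thesis unfolding covers_dilate_def by blast
qed

text \<open>Negation is free because a difference set is symmetric: exchange \<open>a\<close> and
  \<open>b\<close>.\<close>

lemma covers_dilate_uminus:
  assumes "covers_dilate p A K s"
  shows "covers_dilate p A K (- s)"
proof -
  obtain F where F: "finite F" "card F \<le> K"
    "\<forall>a\<in>A. \<forall>b\<in>A. \<exists>f\<in>F. \<exists>c\<in>A. \<exists>e\<in>A. [s * (a - b) = f + (c - e)] (mod p)"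
    using assms unfolding covers_dilate_def by blast
  have "\<exists>f\<in>F. \<exists>c\<in>A. \<exists>e\<in>A. [- s * (a - b) = f + (c - e)] (mod p)" if ab: "a \<in> A" "b \<in> A" for a b
  proof -
    obtain f c e where f: "f \<in> F" "c \<in> A" "e \<in> A" "[s * (b - a) = f + (c - e)] (mod p)"
      using F(3) ab by blast
    have "- s * (a - b) = s * (b - a)" by (simp add: algebra_simps)
    with f show ?thesis by auto
  qed
  with F(1,2) show ?thesis unfolding covers_dilate_def by blast
qed

text \<open>Apply the covering for \<open>t\<close>, dilate each of its translates by
  \<open>s\<close>, and cover again; the new translations are \<open>s * g + f\<close>.\<close>

lemma covers_dilate_mult:
  assumes "covers_dilate p A K s" "covers_dilate p A L t"
  shows "covers_dilate p A (K * L) (s * t)"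
proof -
  obtain F where F: "finite F" "card F \<le> K"
    "\<forall>a\<in>A. \<forall>b\<in>A. \<exists>f\<in>F. \<exists>c\<in>A. \<exists>e\<in>A. [s * (a - b) = f + (c - e)] (mod p)"
    using assms(1) unfolding covers_dilate_def by blast
  obtain G where G: "finite G" "card G \<le> L"
    "\<forall>a\<in>A. \<forall>b\<in>A. \<exists>f\<in>G. \<exists>c\<in>A. \<exists>e\<in>A. [t * (a - b) = f + (c - e)] (mod p)"
    using assms(2) unfolding covers_dilate_def by blast
  let ?F = "(\<lambda>(f, g). s * g + f) ` (F \<times> G)"
  have "card ?F \<le> card (F \<times> G)" using F G by (intro card_image_le) auto
  also have "\<dots> \<le> K * L" using F G by (simp add: card_cartesian_product mult_le_mono)
  finally have "card ?F \<le> K * L" .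
  moreover have "\<exists>f\<in>?F. \<exists>c\<in>A. \<exists>e\<in>A. [s * t * (a - b) = f + (c - e)] (mod p)"
    if ab: "a \<in> A" "b \<in> A" for a b
  proof -
    obtain g c e where 1: "g \<in> G" "c \<in> A" "e \<in> A" "[t * (a - b) = g + (c - e)] (mod p)"
      using G(3) ab by blast
    obtain f c' e' where 2: "f \<in> F" "c' \<in> A" "e' \<in> A" "[s * (c - e) = f + (c' - e')] (mod p)"
      using F(3) 1 by blast
    have "[s * (t * (a - b)) = s * (g + (c - e))] (mod p)" by (intro cong_mult cong_refl 1)
    hence "[s * t * (a - b) = s * g + s * (c - e)] (mod p)" by (simp add: algebra_simps)
    also have "[s * g + s * (c - e) = s * g + (f + (c' - e'))] (mod p)" by (intro cong_add cong_refl 2)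
    also have "s * g + (f + (c' - e')) = (s * g + f) + (c' - e')" by simp
    finally have "[s * t * (a - b) = s * g + f + (c' - e')] (mod p)" .
    moreover have "s * g + f \<in> ?F" using 1(1) 2(1) by (intro rev_image_eqI[of "(f, g)"]) auto
    ultimately show ?thesis using 2(2,3) by blast
  qed
  moreover have "finite ?F" using F G by simp
  ultimately show ?thesis unfolding covers_dilate_def by (intro exI[of _ ?F]) simp
qed

text \<open>Covering the two summands separately leaves a sum of two differences, which the doubling
  hypothesis turns back into a single difference.\<close>

lemma covers_dilate_add:
  assumes "covers_dilate p A K s" "covers_dilate p A L t" "covers_double p A M"
  shows "covers_dilate p A (K * L * M) (s + t)"
proof -
  obtain F where F: "finite F" "card F \<le> K"
    "\<forall>a\<in>A. \<forall>b\<in>A. \<exists>f\<in>F. \<exists>c\<in>A. \<exists>e\<in>A. [s * (a - b) = f + (c - e)] (mod p)"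
    using assms(1) unfolding covers_dilate_def by blast
  obtain G where G: "finite G" "card G \<le> L"
    "\<forall>a\<in>A. \<forall>b\<in>A. \<exists>f\<in>G. \<exists>c\<in>A. \<exists>e\<in>A. [t * (a - b) = f + (c - e)] (mod p)"
    using assms(2) unfolding covers_dilate_def by blast
  obtain E where E: "finite E" "card E \<le> M"
    "\<forall>a\<in>A. \<forall>b\<in>A. \<forall>c\<in>A. \<forall>e\<in>A. \<exists>f\<in>E. \<exists>c'\<in>A. \<exists>e'\<in>A.
        [(a - b) + (c - e) = f + (c' - e')] (mod p)"
    using assms(3) unfolding covers_double_def by blast
  let ?F = "(\<lambda>(f, g, h). f + g + h) ` (F \<times> G \<times> E)"
  have "card ?F \<le> card (F \<times> G \<times> E)" using F G E by (intro card_image_le) auto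
  also have "\<dots> \<le> K * (L * M)"
    unfolding card_cartesian_product using F G E by (intro mult_le_mono)
  finally have "card ?F \<le> K * L * M" by (simp add: mult.assoc)
  moreover have "\<exists>f\<in>?F. \<exists>c\<in>A. \<exists>e\<in>A. [(s + t) * (a - b) = f + (c - e)] (mod p)"
    if ab: "a \<in> A" "b \<in> A" for a b
  proof -
    obtain f c e where 1: "f \<in> F" "c \<in> A" "e \<in> A" "[s * (a - b) = f + (c - e)] (mod p)"
      using F(3) ab by blast
    obtain g c' e' where 2: "g \<in> G" "c' \<in> A" "e' \<in> A" "[t * (a - b) = g + (c' - e')] (mod p)"
      using G(3) ab by blast
    obtain h u v where 3: "h \<in> E" "u \<in> A" "v \<in> A" "[(c - e) + (c' - e') = h + (u - v)] (mod p)"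
      using E(3) 1 2 by blast
    have "[s * (a - b) + t * (a - b) = (f + (c - e)) + (g + (c' - e'))] (mod p)"
      by (intro cong_add 1 2)
    hence "[(s + t) * (a - b) = (f + g) + ((c - e) + (c' - e'))] (mod p)" by (simp add: algebra_simps)
    also have "[(f + g) + ((c - e) + (c' - e')) = (f + g) + (h + (u - v))] (mod p)"
      by (intro cong_add cong_refl 3)
    also have "(f + g) + (h + (u - v)) = (f + g + h) + (u - v)" by simp
    finally have "[(s + t) * (a - b) = (f + g + h) + (u - v)] (mod p)" .
    moreover have "f + g + h \<in> ?F" using 1(1) 2(1) 3(1) by (intro rev_image_eqI[of "(f, g, h)"]) auto
    ultimately show ?thesis using 3(2,3) by blast
  qed
  moreover have "finite ?F" using F G E by simp
  ultimately show ?thesis unfolding covers_dilate_def by (intro exI[of _ ?F]) simp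
qed

text \<open>Bookkeeping of the exponent: a difference of multipliers costs \<open>K ^ 3\<close>, a
  sum of two such differences \<open>K ^ 7\<close>, its product with a further multiplier
  \<open>K ^ 8\<close>, and the final addition \<open>K ^ 8 * K ^ 8 * K\<close>.\<close>

lemma covers_dilate_combination:
  assumes Z: "\<And>z. z \<in> Z \<Longrightarrow> covers_dilate p A K z" and M: "covers_double p A K"
    and a: "\<exists>z1\<in>Z. \<exists>z2\<in>Z. \<exists>z3\<in>Z. \<exists>z4\<in>Z. a = (z1 - z2) + (z3 - z4)"
    and b: "\<exists>z1\<in>Z. \<exists>z2\<in>Z. \<exists>z3\<in>Z. \<exists>z4\<in>Z. b = (z1 - z2) + (z3 - z4)"
    and xy: "x \<in> Z" "y \<in> Z"
  shows "covers_dilate p A (K ^ 17) ((a * x + b * y) mod p)"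
proof -
  have diff: "covers_dilate p A (K ^ 3) (z - z')" if "z \<in> Z" "z' \<in> Z" for z z'
    using covers_dilate_add[OF Z[OF that(1)] covers_dilate_uminus[OF Z[OF that(2)]] M]
    by (simp add: power3_eq_cube)
  have comb: "covers_dilate p A (K ^ 7) c"
    if "\<exists>z1\<in>Z. \<exists>z2\<in>Z. \<exists>z3\<in>Z. \<exists>z4\<in>Z. c = (z1 - z2) + (z3 - z4)" for c
  proof -
    obtain z1 z2 z3 z4 where z: "z1 \<in> Z" "z2 \<in> Z" "z3 \<in> Z" "z4 \<in> Z" "c = (z1 - z2) + (z3 - z4)"
      using \<open>\<exists>z1\<in>Z. \<exists>z2\<in>Z. \<exists>z3\<in>Z. \<exists>z4\<in>Z. c = (z1 - z2) + (z3 - z4)\<close> by blast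
    have "covers_dilate p A (K ^ 3 * K ^ 3 * K) c"
      unfolding z(5) by (rule covers_dilate_add[OF diff[OF z(1,2)] diff[OF z(3,4)] M])
    moreover have "K ^ 3 * K ^ 3 * K = K ^ 7" using power_add[of K 6 1] power_add[of K 3 3] by simp
    ultimately show ?thesis by simp
  qed
  have "covers_dilate p A ((K ^ 7 * K) * (K ^ 7 * K) * K) (a * x + b * y)"
    by (rule covers_dilate_add[OF covers_dilate_mult[OF comb[OF a] Z[OF xy(1)]]
          covers_dilate_mult[OF comb[OF b] Z[OF xy(2)]] M])
  moreover have "(K ^ 7 * K) * (K ^ 7 * K) * K = K ^ 17"
  proof -
    have "K ^ 8 = K ^ 7 * K" using power_add[of K 7 1] by simp
    moreover have "K ^ 17 = K ^ 8 * K ^ 8 * K" using power_add[of K 16 1] power_add[of K 8 8] by simp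
    ultimately show ?thesis by simp
  qed
  ultimately have "covers_dilate p A (K ^ 17) (a * x + b * y)" by simp
  moreover have "[a * x + b * y = (a * x + b * y) mod p] (mod p)" by (simp add: cong_def)
  ultimately show ?thesis by (rule covers_dilate_cong)
qed

text \<open>For such a multiplier \<open>s\<close> the set \<open>A + s A\<close> lies in at most
  \<open>K\<close> translates of \<open>A + A - A\<close>. It is therefore small, and Cauchy-Schwarz
  makes the energy of \<open>A\<close> and \<open>s A\<close> at least
  \<open>n ^ 4 / (K * Y)\<close>. The bound for the sum of all energies leaves room for few such
  \<open>s\<close>.\<close>

lemma card_covers_dilate_le:
  fixes p :: int
  assumes p: "prime p" and A: "finite A" "A \<noteq> {}" "inj_on (\<lambda>x. x mod p) A"
    and Y: "card ((\<lambda>(a, b, c). (a + b - c) mod p) ` (A \<times> A \<times> A)) \<le> Y"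
  shows "card {s \<in> {0..<p}. covers_dilate p A K s} * (card A)\<^sup>2 \<le> K * Y * ((card A)\<^sup>2 + nat p)"
proof -
  define n where "n = card A"
  define R where "R = {s \<in> {0..<p}. covers_dilate p A K s}"
  have n0: "n > 0" using A(1,2) by (simp add: n_def card_gt_0_iff)
  have R: "R \<subseteq> {0..<p}" by (auto simp: R_def)
  have "card R \<le> card {0..<p}" by (intro card_mono R) auto
  hence Rp: "card R \<le> nat p" by simp
  let ?D = "(\<lambda>(a, b, c). (a + b - c) mod p) ` (A \<times> A \<times> A)"
  have each: "n ^ 4 \<le> K * Y * card (linear_energy p A s)" if "s \<in> R" for s
  proof -
    obtain F where F: "finite F" "card F \<le> K"
      "\<forall>a\<in>A. \<forall>b\<in>A. \<exists>f\<in>F. \<exists>c\<in>A. \<exists>e\<in>A. [s * (a - b) = f + (c - e)] (mod p)"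
      using \<open>s \<in> R\<close> unfolding R_def covers_dilate_def by blast
    obtain b0 where b0: "b0 \<in> A" using A by blast
    let ?V = "(\<lambda>(a, b). (a + s * b) mod p) ` (A \<times> A)"
    \<comment> \<open>Writing \<open>s * b = s * b0 + s * (b - b0)\<close> with a fixed base point
      \<open>b0\<close> makes the covering of dilated differences applicable.\<close>
    have "?V \<subseteq> (\<lambda>(f, d). (s * b0 + f + d) mod p) ` (F \<times> ?D)"
    proof clarify
      fix a b assume ab: "a \<in> A" "b \<in> A"
      obtain f c e where f: "f \<in> F" "c \<in> A" "e \<in> A" "[s * (b - b0) = f + (c - e)] (mod p)"
        using F(3) ab b0 by blast
      have "[(a + s * b0) + s * (b - b0) = (a + s * b0) + (f + (c - e))] (mod p)"
        by (intro cong_add cong_refl f)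
      hence "(a + s * b) mod p = (s * b0 + f + (a + c - e)) mod p"
        by (simp add: cong_def algebra_simps)
      also have "\<dots> = (s * b0 + f + (a + c - e) mod p) mod p" by (simp add: mod_add_right_eq)
      finally have *: "(a + s * b) mod p = (s * b0 + f + (a + c - e) mod p) mod p" .
      have "(a + c - e) mod p \<in> ?D" using ab f by force
      hence "(f, (a + c - e) mod p) \<in> F \<times> ?D" using f by blast
      thus "(a + s * b) mod p \<in> (\<lambda>(f, d). (s * b0 + f + d) mod p) ` (F \<times> ?D)"
        unfolding * by (rule rev_image_eqI) simp
    qed
    hence "card ?V \<le> card ((\<lambda>(f, d). (s * b0 + f + d) mod p) ` (F \<times> ?D))"
      using F A by (intro card_mono) auto
    also have "\<dots> \<le> card (F \<times> ?D)" using F A by (intro card_image_le) auto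
    also have "\<dots> \<le> K * Y" unfolding card_cartesian_product using F Y by (intro mult_le_mono)
    finally have "card ?V \<le> K * Y" .
    hence "card ?V * card (linear_energy p A s) \<le> K * Y * card (linear_energy p A s)"
      by (rule mult_le_mono1)
    with card_pow4_le_linear_energy[OF A(1), of s p] show ?thesis unfolding n_def by linarith
  qed
  have "card R * n ^ 4 = (\<Sum>s\<in>R. n ^ 4)" by simp
  also have "\<dots> \<le> (\<Sum>s\<in>R. K * Y * card (linear_energy p A s))" by (intro sum_mono each)
  also have "\<dots> = K * Y * (\<Sum>s\<in>R. card (linear_energy p A s))" by (simp add: sum_distrib_left)
  also have "\<dots> \<le> K * Y * (n ^ 4 + card R * n\<^sup>2)"
    unfolding n_def by (intro mult_le_mono sum_linear_energy_le[OF p A(1,3) R] order_refl)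
  also have "\<dots> \<le> K * Y * (n ^ 4 + nat p * n\<^sup>2)"
    using Rp by (intro mult_le_mono add_le_mono) auto
  finally have "n\<^sup>2 * (card R * n\<^sup>2) \<le> n\<^sup>2 * (K * Y * (n\<^sup>2 + nat p))"
    by (simp add: power4_eq_xxxx power2_eq_square algebra_simps)
  hence "card R * n\<^sup>2 \<le> K * Y * (n\<^sup>2 + nat p)" using n0 by (metis nat_mult_le_cancel1 zero_less_power)
  thus ?thesis unfolding R_def n_def .
qed

text \<open>Ruzsa covering with \<open>X = (A - A) + (A - A)\<close>, for which \<open>X + A\<close>
  is the fivefold combination in the hypothesis.\<close>

lemma covers_double_of_small_sumset:
  fixes p :: int
  assumes A: "finite A" "A \<noteq> {}" "inj_on (\<lambda>x. x mod p) A"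
    and Y: "card ((\<lambda>(a, b, c, d, e). (a + b + c - d - e) mod p) ` (A \<times> A \<times> A \<times> A \<times> A)) \<le> K * card A"
  shows "covers_double p A K"
proof -
  define X where "X = (\<lambda>(a, b, c, e). (a - b) + (c - e)) ` (A \<times> A \<times> A \<times> A)"
  have finX: "finite X" using A(1) by (simp add: X_def)
  obtain F where F: "F \<subseteq> X" "finite F" "card F * card A \<le> card ((\<lambda>(x, a). (x + a) mod p) ` (X \<times> A))"
    "\<forall>x\<in>X. \<exists>f\<in>F. \<exists>a\<in>A. \<exists>a'\<in>A. [x = f + (a - a')] (mod p)"
    by (rule ruzsa_covering_mod[OF finX A])
  have "(\<lambda>(x, a). (x + a) mod p) ` (X \<times> A) \<subseteq>
      (\<lambda>(a, b, c, d, e). (a + b + c - d - e) mod p) ` (A \<times> A \<times> A \<times> A \<times> A)"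
  proof (clarsimp simp: X_def)
    fix g a b c e assume "g \<in> A" "a \<in> A" "b \<in> A" "c \<in> A" "e \<in> A"
    hence "(a, c, g, b, e) \<in> A \<times> A \<times> A \<times> A \<times> A" by simp
    thus "(a - b + (c - e) + g) mod p \<in>
      (\<lambda>(a, b, c, d, e). (a + b + c - d - e) mod p) ` (A \<times> A \<times> A \<times> A \<times> A)"
      by (rule rev_image_eqI) (simp add: algebra_simps)
  qed
  hence "card ((\<lambda>(x, a). (x + a) mod p) ` (X \<times> A)) \<le> K * card A"
    using A by (intro order_trans[OF card_mono Y]) auto
  hence "card F * card A \<le> K * card A" using F by linarith
  moreover have "card A > 0" using A by (simp add: card_gt_0_iff)
  ultimately have "card F \<le> K" by simp
  moreover have "(a - b) + (c - e) \<in> X" if "a \<in> A" "b \<in> A" "c \<in> A" "e \<in> A" for a b c e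
    unfolding X_def using that by (intro rev_image_eqI[of "(a, b, c, e)"]) auto
  ultimately show ?thesis unfolding covers_double_def
    by (intro exI[of _ F] conjI ballI F(2) F(4)[rule_format])
qed

text \<open>Let \<open>B\<close> be the part of \<open>A\<close> that \<open>h\<close> maps into
  \<open>A\<close> modulo \<open>p\<close>. Ruzsa covering places \<open>A - A\<close> in a few
  translates of \<open>B - B\<close>, since \<open>(A - A) + B\<close> lies in
  \<open>A + A - A\<close>; multiplication by \<open>h\<close> then sends \<open>B - B\<close> into
  \<open>A - A\<close>.\<close>

lemma covers_dilate_of_overlap:
  fixes p :: int
  assumes A: "finite A" "inj_on (\<lambda>x. x mod p) A"
    and n1: "n1 > 0" "n1 \<le> card {a \<in> A. \<exists>a'\<in>A. [a' = h * a] (mod p)}"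
    and Y: "card ((\<lambda>(a, b, c). (a + b - c) mod p) ` (A \<times> A \<times> A)) \<le> K * n1"
  shows "covers_dilate p A K h"
proof -
  define B where "B = {a \<in> A. \<exists>a'\<in>A. [a' = h * a] (mod p)}"
  define X where "X = (\<lambda>(a, b). a - b) ` (A \<times> A)"
  have finX: "finite X" using A(1) by (simp add: X_def)
  have BA: "B \<subseteq> A" by (auto simp: B_def)
  have B: "finite B" "B \<noteq> {}" "inj_on (\<lambda>x. x mod p) B"
    using A n1 BA unfolding B_def[symmetric] by (auto intro: finite_subset inj_on_subset)
  obtain F where F: "F \<subseteq> X" "finite F" "card F * card B \<le> card ((\<lambda>(x, a). (x + a) mod p) ` (X \<times> B))"
    "\<forall>x\<in>X. \<exists>f\<in>F. \<exists>a\<in>B. \<exists>a'\<in>B. [x = f + (a - a')] (mod p)"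
    by (rule ruzsa_covering_mod[OF finX B])
  have "(\<lambda>(x, a). (x + a) mod p) ` (X \<times> B) \<subseteq> (\<lambda>(a, b, c). (a + b - c) mod p) ` (A \<times> A \<times> A)"
  proof (clarsimp simp: X_def)
    fix g a b assume "g \<in> B" "a \<in> A" "b \<in> A"
    hence "(a, g, b) \<in> A \<times> A \<times> A" using BA by auto
    thus "(a - b + g) mod p \<in> (\<lambda>(a, b, c). (a + b - c) mod p) ` (A \<times> A \<times> A)"
      by (rule rev_image_eqI) (simp add: algebra_simps)
  qed
  hence "card ((\<lambda>(x, a). (x + a) mod p) ` (X \<times> B)) \<le> K * n1"
    using A by (intro order_trans[OF card_mono Y]) auto
  moreover have "card F * n1 \<le> card F * card B" using n1 unfolding B_def by simp
  ultimately have "card F * n1 \<le> K * n1" using F by linarith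
  hence cF: "card F \<le> K" using n1 by simp
  define G where "G = (\<lambda>f. h * f) ` F"
  have "card G \<le> K" unfolding G_def using card_image_le[OF F(2)] cF le_trans by blast
  moreover have "\<exists>f\<in>G. \<exists>c\<in>A. \<exists>e\<in>A. [h * (a - b) = f + (c - e)] (mod p)"
    if ab: "a \<in> A" "b \<in> A" for a b
  proof -
    have "a - b \<in> X" unfolding X_def using ab by (intro rev_image_eqI[of "(a, b)"]) auto
    then obtain f u v where f: "f \<in> F" "u \<in> B" "v \<in> B" "[a - b = f + (u - v)] (mod p)" using F(4) by blast
    obtain u' v' where u: "u' \<in> A" "v' \<in> A" "[u' = h * u] (mod p)" "[v' = h * v] (mod p)"
      using f unfolding B_def by blast
    have "[h * (a - b) = h * (f + (u - v))] (mod p)" by (intro cong_mult cong_refl f)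
    hence "[h * (a - b) = h * f + (h * u - h * v)] (mod p)" by (simp add: algebra_simps)
    also have "[h * f + (h * u - h * v) = h * f + (u' - v')] (mod p)"
      by (intro cong_add cong_diff cong_refl cong_sym[OF u(3)] cong_sym[OF u(4)])
    finally show ?thesis using f u unfolding G_def by blast
  qed
  ultimately show ?thesis unfolding covers_dilate_def G_def using F by blast
qed

text \<open>The elements of \<open>Z\<close> are multipliers of cost \<open>K\<close>. One linear
  combination of \<open>Z\<close> with itself yields a set \<open>W\<close> of at least about the
  square root of \<open>p\<close> multipliers of cost \<open>K ^ 17\<close>, and a second one a set
  \<open>V\<close> of at least \<open>(p - 1) / 2\<close> multipliers of cost
  \<open>K ^ 289\<close>, where 289 is the square of 17. Comparison with the upper bound for the
  number of multipliers gives the inequality.\<close>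

lemma sum_product_bound:
  fixes p :: int and K n1 :: nat
  assumes p: "prime p" "p \<ge> 5" and A: "finite A" "inj_on (\<lambda>x. x mod p) A"
    and Z: "Z \<subseteq> {0..<p}" "4 * (nat p - 1) \<le> card Z ^ 4"
    and n1: "n1 > 0" "\<And>h. h \<in> Z \<Longrightarrow> n1 \<le> card {a \<in> A. \<exists>a'\<in>A. [a' = h * a] (mod p)}"
    and Y: "card ((\<lambda>(a, b, c, d, e). (a + b + c - d - e) mod p) ` (A \<times> A \<times> A \<times> A \<times> A)) \<le> Y" "Y \<le> K * n1"
  shows "(nat p - 1) * (card A)\<^sup>2 \<le> 2 * K ^ 289 * Y * ((card A)\<^sup>2 + nat p)"
proof -
  define P where "P = nat p - 1"
  have P4: "P \<ge> 4" using p by (simp add: P_def)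
  have finZ: "finite Z" using Z finite_subset by blast
  have cZ: "card Z \<ge> 2"
  proof (rule ccontr)
    assume "\<not> card Z \<ge> 2"
    hence "card Z ^ 4 \<le> 1 ^ 4" by (intro power_mono) auto
    thus False using Z(2) P4 unfolding P_def by simp
  qed
  have modinj: "inj_on (\<lambda>x. x mod p) X" if "X \<subseteq> {0..<p}" for X
    using that by (auto simp: inj_on_def subset_eq)
  obtain h where h: "h \<in> Z" using cZ by fastforce
  have n1A: "n1 \<le> card A"
    using n1(2)[OF h] card_mono[OF A(1), of "{a \<in> A. \<exists>a'\<in>A. [a' = h * a] (mod p)}"] by auto
  hence Ane: "A \<noteq> {}" using n1 by auto
  have dbl: "covers_double p A K"
  proof (rule covers_double_of_small_sumset[OF A(1) Ane A(2)])
    have "K * n1 \<le> K * card A" using n1A by simp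
    thus "card ((\<lambda>(a, b, c, d, e). (a + b + c - d - e) mod p) ` (A \<times> A \<times> A \<times> A \<times> A)) \<le> K * card A"
      using Y by linarith
  qed
  have Y3: "card ((\<lambda>(a, b, c). (a + b - c) mod p) ` (A \<times> A \<times> A)) \<le> Y"
  proof (rule order_trans[OF card_mono Y(1)])
    show "(\<lambda>(a, b, c). (a + b - c) mod p) ` (A \<times> A \<times> A) \<subseteq>
      (\<lambda>(a, b, c, d, e). (a + b + c - d - e) mod p) ` (A \<times> A \<times> A \<times> A \<times> A)"
    proof clarify
      fix a b c assume "a \<in> A" "b \<in> A" "c \<in> A"
      thus "(a + b - c) mod p \<in> (\<lambda>(a, b, c, d, e). (a + b + c - d - e) mod p) ` (A \<times> A \<times> A \<times> A \<times> A)"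
        by (intro rev_image_eqI[of "(a, b, c, c, c)"]) auto
    qed
  qed (use A in simp)
  have good1: "covers_dilate p A K z" if "z \<in> Z" for z
    by (rule covers_dilate_of_overlap[OF A n1(1) n1(2)[OF that]]) (use Y3 Y(2) in linarith)
  obtain a b where ab:
    "\<exists>z1\<in>Z. \<exists>z2\<in>Z. \<exists>z3\<in>Z. \<exists>z4\<in>Z. a = (z1 - z2) + (z3 - z4)"
    "\<exists>z1\<in>Z. \<exists>z2\<in>Z. \<exists>z3\<in>Z. \<exists>z4\<in>Z. b = (z1 - z2) + (z3 - z4)"
    "min ((card Z)\<^sup>2) (nat p - 1) \<le> 2 * card ((\<lambda>(x, y). (a * x + b * y) mod p) ` (Z \<times> Z))"
    by (rule exists_large_combination[OF p(1) finZ cZ modinj[OF Z(1)]])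
  define W where "W = (\<lambda>(x, y). (a * x + b * y) mod p) ` (Z \<times> Z)"
  have W: "W \<subseteq> {0..<p}" "finite W" using p finZ by (auto simp: W_def)
  have good2: "covers_dilate p A (K ^ 17) w" if "w \<in> W" for w
  proof -
    obtain x y where "x \<in> Z" "y \<in> Z" "w = (a * x + b * y) mod p" using \<open>w \<in> W\<close> unfolding W_def by auto
    thus ?thesis using covers_dilate_combination[OF good1 dbl ab(1,2)] by simp
  qed
  have mW: "min ((card Z)\<^sup>2) P \<le> 2 * card W" unfolding W_def P_def by (rule ab(3))
  \<comment> \<open>From \<open>card W\<close> at least half the square of \<open>card Z\<close>
    follows \<open>4 * (card W) ^ 2 >= card Z ^ 4\<close>; this is the origin of the factor 4 in the
    hypothesis on \<open>Z\<close>.\<close>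
  have Wsq: "P \<le> (card W)\<^sup>2"
  proof (cases "(card Z)\<^sup>2 \<le> P")
    case True
    hence "(card Z)\<^sup>2 \<le> 2 * card W" using mW by simp
    from mult_le_mono[OF this this] have "card Z ^ 4 \<le> 4 * (card W)\<^sup>2"
      by (simp add: power2_eq_square power4_eq_xxxx mult.assoc)
    hence "4 * P \<le> 4 * (card W)\<^sup>2" using Z(2) unfolding P_def by linarith
    thus ?thesis by simp
  next
    case False
    hence "P \<le> 2 * card W" using mW by simp
    from mult_le_mono[OF this this] have "P * P \<le> (2 * card W) * (2 * card W)" .
    moreover have "4 * P \<le> P * P" using P4 by simp
    moreover have "(2 * card W) * (2 * card W) = 4 * (card W)\<^sup>2" by (simp add: power2_eq_square)
    ultimately have "4 * P \<le> 4 * (card W)\<^sup>2" by linarith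
    thus ?thesis by simp
  qed
  have cW: "card W \<ge> 2"
  proof (rule ccontr)
    assume "\<not> card W \<ge> 2"
    hence "(card W)\<^sup>2 \<le> 1\<^sup>2" by (intro power_mono) auto
    thus False using Wsq P4 by simp
  qed
  obtain c d where cd:
    "\<exists>z1\<in>W. \<exists>z2\<in>W. \<exists>z3\<in>W. \<exists>z4\<in>W. c = (z1 - z2) + (z3 - z4)"
    "\<exists>z1\<in>W. \<exists>z2\<in>W. \<exists>z3\<in>W. \<exists>z4\<in>W. d = (z1 - z2) + (z3 - z4)"
    "min ((card W)\<^sup>2) (nat p - 1) \<le> 2 * card ((\<lambda>(x, y). (c * x + d * y) mod p) ` (W \<times> W))"
    by (rule exists_large_combination[OF p(1) W(2) cW modinj[OF W(1)]])
  define V where "V = (\<lambda>(x, y). (c * x + d * y) mod p) ` (W \<times> W)"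
  have "min ((card W)\<^sup>2) P \<le> 2 * card V" unfolding V_def P_def by (rule cd(3))
  hence cV: "P \<le> 2 * card V" using Wsq by simp
  \<comment> \<open>The combination lemma has one cost for multipliers and doubling, so the doubling
    constant is weakened to match.\<close>
  have "K \<le> K ^ 17" by (cases "K = 0") (simp_all add: self_le_power)
  hence dbl2: "covers_double p A (K ^ 17)" by (rule covers_double_mono[OF dbl])
  have "covers_dilate p A ((K ^ 17) ^ 17) v" if "v \<in> V" for v
  proof -
    obtain x y where "x \<in> W" "y \<in> W" "v = (c * x + d * y) mod p" using \<open>v \<in> V\<close> unfolding V_def by auto
    thus ?thesis using covers_dilate_combination[OF good2 dbl2 cd(1,2)] by simp
  qed
  moreover have "(K ^ 17) ^ 17 = K ^ (17 * 17)" by (rule power_mult[symmetric])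
  moreover have "17 * 17 = (289::nat)" by simp
  ultimately have "\<And>v. v \<in> V \<Longrightarrow> covers_dilate p A (K ^ 289) v" by metis
  moreover have "V \<subseteq> {0..<p}" using p unfolding V_def by auto
  ultimately have "V \<subseteq> {s \<in> {0..<p}. covers_dilate p A (K ^ 289) s}" by blast
  hence "card V \<le> card {s \<in> {0..<p}. covers_dilate p A (K ^ 289) s}"
    by (rule card_mono[OF finite_subset[of _ "{0..<p}"], rotated 2]) auto
  hence "card V * (card A)\<^sup>2 \<le> card {s \<in> {0..<p}. covers_dilate p A (K ^ 289) s} * (card A)\<^sup>2"
    by (rule mult_le_mono1)
  also have "\<dots> \<le> K ^ 289 * Y * ((card A)\<^sup>2 + nat p)"
    by (rule card_covers_dilate_le[OF p(1) A(1) Ane A(2) Y3])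
  finally have "2 * (card V * (card A)\<^sup>2) \<le> 2 * (K ^ 289 * Y * ((card A)\<^sup>2 + nat p))" by simp
  moreover have "P * (card A)\<^sup>2 \<le> 2 * card V * (card A)\<^sup>2" using cV by (rule mult_le_mono1)
  ultimately have "P * (card A)\<^sup>2 \<le> 2 * (K ^ 289 * Y * ((card A)\<^sup>2 + nat p))" by linarith
  thus ?thesis unfolding P_def by (simp only: mult.assoc)
qed

section \<open>Shortest vectors attached to roots of unity\<close>

definition roots_unity_mod :: "int \<Rightarrow> nat \<Rightarrow> int set" where
  "roots_unity_mod p d = {h \<in> {0..<p}. [h ^ d = 1] (mod p)}"

lemma finite_roots_unity_mod [simp]: "finite (roots_unity_mod p d)"
  unfolding roots_unity_mod_def by (rule finite_subset[of _ "{0..<p}"]) auto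

lemma roots_unity_mod_bounds:
  assumes "p > 1" "d > 0" "h \<in> roots_unity_mod p d"
  shows "0 < h" "h < p"
proof -
  have "h \<noteq> 0" using assms by (auto simp: roots_unity_mod_def cong_def zero_power)
  thus "0 < h" "h < p" using assms by (auto simp: roots_unity_mod_def)
qed

lemma mult_in_roots_unity_mod:
  assumes "p > 0" "h \<in> roots_unity_mod p d" "h' \<in> roots_unity_mod p d"
  shows "(h * h') mod p \<in> roots_unity_mod p d"
proof -
  have "[(h * h') ^ d = 1 * 1] (mod p)"
    unfolding power_mult_distrib using assms by (intro cong_mult) (auto simp: roots_unity_mod_def)
  hence "[((h * h') mod p) ^ d = 1] (mod p)" by (simp add: cong_def power_mod)
  thus ?thesis using assms by (simp add: roots_unity_mod_def)
qed

lemma card_roots_unity_mod_le: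
  fixes p :: nat
  assumes "prime p" "d > 0"
  shows "card (roots_unity_mod (int p) d) \<le> d"
proof -
  have "roots_unity_mod (int p) d \<subseteq> int ` {x \<in> {..<p}. [x ^ d = 1] (mod p)}"
  proof
    fix h assume h: "h \<in> roots_unity_mod (int p) d"
    have "[int (nat h) ^ d = int 1] (mod int p)" using h by (simp add: roots_unity_mod_def)
    hence "[nat h ^ d = 1] (mod p)" by (simp flip: cong_int_iff)
    moreover have "nat h < p" "h = int (nat h)" using h by (auto simp: roots_unity_mod_def)
    ultimately show "h \<in> int ` {x \<in> {..<p}. [x ^ d = 1] (mod p)}" by blast
  qed
  hence "card (roots_unity_mod (int p) d) \<le> card (int ` {x \<in> {..<p}. [x ^ d = 1] (mod p)})"
    by (intro card_mono) auto
  also have "\<dots> = card {x \<in> {..<p}. [x ^ d = 1] (mod p)}" by (simp add: card_image)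
  also have "\<dots> \<le> d" by (rule roots_mod_prime_bound[OF assms])
  finally show ?thesis .
qed

lemma not_cong_0_of_power_cong:
  fixes p x l :: int
  assumes "prime p" "coprime l p" "d > 0" "[x ^ d = l] (mod p)"
  shows "\<not> [x = 0] (mod p)"
proof
  assume "[x = 0] (mod p)"
  hence "p dvd x ^ d" using assms(3) by (simp add: cong_0_iff dvd_power_same dvd_trans)
  hence "p dvd l" using assms(4) cong_dvd_iff by blast
  thus False using assms(1,2) by (meson coprime_absorb_right coprime_commute not_prime_unit)
qed

lemma ratio_in_roots_unity_mod:
  fixes p x y l :: int
  assumes "prime p" "coprime l p" "d > 0" "[x ^ d = l] (mod p)" "[y ^ d = l] (mod p)"
  obtains r where "r \<in> roots_unity_mod p d" "[x = r * y] (mod p)"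
proof -
  have p0: "p > 0" using assms(1) by (simp add: prime_gt_0_int)
  have "\<not> p dvd y" using not_cong_0_of_power_cong[OF assms(1-3,5)] by (simp add: cong_0_iff)
  hence "coprime y p" using assms(1) by (metis coprime_commute prime_imp_coprime)
  then obtain y' where y': "[y * y' = 1] (mod p)" using cong_solve_coprime_int by blast
  define r where "r = (x * y') mod p"
  have "[r * y = x * y' * y] (mod p)" unfolding r_def by (intro cong_mult cong_refl) (simp add: cong_def)
  also have "x * y' * y = x * (y * y')" by simp
  also have "[x * (y * y') = x * 1] (mod p)" by (intro cong_mult cong_refl y')
  finally have "[x = r * y] (mod p)" by (simp add: cong_sym)
  moreover have "r \<in> roots_unity_mod p d"
  proof -
    have "[r ^ d = (x * y') ^ d] (mod p)" unfolding r_def by (intro cong_pow) (simp add: cong_def)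
    also have "(x * y') ^ d = x ^ d * y' ^ d" by (rule power_mult_distrib)
    also have "[x ^ d * y' ^ d = y ^ d * y' ^ d] (mod p)"
      using assms(4,5) by (intro cong_mult cong_refl) (metis cong_sym cong_trans)
    also have "y ^ d * y' ^ d = (y * y') ^ d" by (rule power_mult_distrib[symmetric])
    also have "[(y * y') ^ d = 1 ^ d] (mod p)" by (intro cong_pow y')
    finally show ?thesis using p0 by (simp add: roots_unity_mod_def r_def)
  qed
  ultimately show ?thesis using that by blast
qed

lemma card_le_mult_card_image:
  assumes "finite X" "\<And>y. y \<in> f ` X \<Longrightarrow> card {x \<in> X. f x = y} \<le> K"
  shows "card X \<le> K * card (f ` X)"
proof -
  have "card X = (\<Sum>y\<in>f ` X. card {x \<in> X. f x = y})"
    using sum.image_gen[OF assms(1), of "\<lambda>_. 1::nat" f] by simp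
  also have "\<dots> \<le> (\<Sum>y\<in>f ` X. K)" using assms(2) by (intro sum_mono) auto
  finally show ?thesis by (simp add: mult.commute)
qed

lemma card_int_divisors_le:
  fixes u :: int
  assumes "u \<noteq> 0"
  shows "finite {a. a dvd u}" "card {a. a dvd u} \<le> 2 * card {k. k dvd nat \<bar>u\<bar>}"
proof -
  let ?D = "{k. k dvd nat \<bar>u\<bar>}"
  have fin: "finite ?D" by (rule finite_divisors_nat) (use assms in simp)
  have sub: "{a. a dvd u} \<subseteq> int ` ?D \<union> (\<lambda>k. - int k) ` ?D"
  proof
    fix a assume "a \<in> {a. a dvd u}"
    hence "nat \<bar>a\<bar> \<in> ?D" by (simp add: nat_abs_dvd_iff)
    moreover have "a = int (nat \<bar>a\<bar>) \<or> a = - int (nat \<bar>a\<bar>)" by linarith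
    ultimately show "a \<in> int ` ?D \<union> (\<lambda>k. - int k) ` ?D" by blast
  qed
  thus "finite {a. a dvd u}" by (rule finite_subset) (use fin in auto)
  have "card {a. a dvd u} \<le> card (int ` ?D \<union> (\<lambda>k. - int k) ` ?D)"
    using fin by (intro card_mono sub) auto
  also have "\<dots> \<le> card (int ` ?D) + card ((\<lambda>k. - int k) ` ?D)" by (rule card_Un_le)
  also have "\<dots> \<le> card ?D + card ?D" using fin by (intro add_mono card_image_le)
  finally show "card {a. a dvd u} \<le> 2 * card ?D" by simp
qed

section \<open>The sum of inverse shortest lengths, called S in the outline\<close>

definition lam_inv_sum :: "int \<Rightarrow> nat \<Rightarrow> real" where
  "lam_inv_sum p d = (\<Sum>r\<in>roots_unity_mod p d. 1 / real (lam p r))"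

lemma sum_card_lat_nonzero_le:
  fixes p :: nat
  assumes p: "prime p" and d: "d > 0" and X: "X \<ge> 0"
  shows "(\<Sum>r\<in>roots_unity_mod p d. real (card (lat p r X - {(0, 0)})))
           \<le> 12 * real d * real_of_int X ^ 2 / p + 3 * X * lam_inv_sum p d"
proof -
  let ?H = "roots_unity_mod (int p) d"
  have p1: "int p > 1" using prime_gt_1_nat[OF p] by simp
  have "(\<Sum>r\<in>?H. real (card (lat p r X - {(0, 0)})))
      \<le> (\<Sum>r\<in>?H. 12 * real_of_int X ^ 2 / p + 3 * X * (1 / lam p r))"
    using card_lat_nonzero_le[OF p1 X] by (intro sum_mono) simp
  also have "\<dots> = card ?H * (12 * real_of_int X ^ 2 / p) + 3 * X * lam_inv_sum p d"
    by (simp add: sum.distrib lam_inv_sum_def sum_distrib_left)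
  also have "card ?H * (12 * real_of_int X ^ 2 / p) \<le> d * (12 * real_of_int X ^ 2 / p)"
    using card_roots_unity_mod_le[OF p d] by (intro mult_right_mono) auto
  finally show ?thesis by (simp add: algebra_simps)
qed

text \<open>
  Multiplying shortest vectors coordinatewise turns two roots of unity with short vectors into
  a lattice vector of length at most \<open>Q\<^sup>2\<close> for their product; the divisor bound controls how
  often a given vector arises.
\<close>
lemma card_small_lam_square_le:
  fixes p :: nat and D :: nat
  assumes p: "prime p" and d: "d > 0"
    and D: "\<And>n. n > 0 \<Longrightarrow> n \<le> Q\<^sup>2 \<Longrightarrow> card {k. k dvd n} \<le> D"
  shows "real (card {r \<in> roots_unity_mod p d. lam p r \<le> Q}) ^ 2
           \<le> 48 * real D ^ 2 * (real Q)\<^sup>2 * (real d * real Q ^ 2 / p + lam_inv_sum p d)"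
proof -
  let ?H = "roots_unity_mod (int p) d"
  define M where "M = {r \<in> ?H. lam p r \<le> Q}"
  have p1: "int p > 1" and pp: "prime (int p)" using prime_gt_1_nat[OF p] p by auto
  have finM: "finite M" by (simp add: M_def)
  have "\<forall>r\<in>?H. \<exists>a b. max \<bar>a\<bar> \<bar>b\<bar> = int (lam p r) \<and> [a = r * b] (mod int p)"
    using lam_props(3)[OF p1] by blast
  then obtain a b where ab: "\<And>r. r \<in> ?H \<Longrightarrow> max \<bar>a r\<bar> \<bar>b r\<bar> = int (lam p r)"
    "\<And>r. r \<in> ?H \<Longrightarrow> [a r = r * b r] (mod int p)" by metis
  have lt: "\<bar>a r\<bar> < int p" "\<bar>b r\<bar> < int p" if "r \<in> ?H" for r
    using ab(1)[OF that] lam_less roots_unity_mod_bounds[OF p1 d that] by (metis max_less_iff_conj)+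
  \<comment> \<open>As \<open>r\<close> is a unit, \<open>p\<close> divides both coordinates or
    neither. Both are smaller than \<open>p\<close> in absolute value, so divisibility would make
    them zero, contrary to the positive length.\<close>
  have nz: "\<not> int p dvd a r" "\<not> int p dvd b r" if r: "r \<in> ?H" for r
  proof -
    have pos: "lam p r > 0" by (rule lam_props(1)[OF p1])
    have nr: "\<not> int p dvd r" using roots_unity_mod_bounds[OF p1 d r] zdvd_not_zless by blast
    have zero: "x = 0" if "int p dvd x" "\<bar>x\<bar> < int p" for x
      using that dvd_imp_le_int[of x "int p"] by auto
    have "int p dvd a r \<longleftrightarrow> int p dvd b r"
      using cong_dvd_iff[OF ab(2)[OF r]] nr pp by (auto simp: prime_dvd_mult_iff)
    moreover have "\<not> (a r = 0 \<and> b r = 0)" using ab(1)[OF r] pos by auto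
    ultimately show "\<not> int p dvd a r" "\<not> int p dvd b r" using zero lt[OF r] by blast+
  qed
  define X where "X = int Q ^ 2"
  define \<phi> where "\<phi> = (\<lambda>(r, s). ((r * s) mod int p, (a r * a s, b r * b s)))"
  have img: "\<phi> ` (M \<times> M) \<subseteq> (SIGMA r:?H. lat p r X - {(0, 0)})"
  proof
    fix w assume "w \<in> \<phi> ` (M \<times> M)"
    then obtain r s where rs: "r \<in> M" "s \<in> M" "w = \<phi> (r, s)" by auto
    hence H: "r \<in> ?H" "s \<in> ?H" "lam p r \<le> Q" "lam p s \<le> Q" by (auto simp: M_def)
    have 1: "(r * s) mod int p \<in> ?H" using p1 H by (intro mult_in_roots_unity_mod) auto
    have "[a r * a s = (r * b r) * (s * b s)] (mod int p)" by (intro cong_mult ab H)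
    also have "(r * b r) * (s * b s) = (r * s) * (b r * b s)" by simp
    also have "[(r * s) * (b r * b s) = ((r * s) mod int p) * (b r * b s)] (mod int p)"
      by (intro cong_mult cong_refl) (simp add: cong_def)
    finally have c: "[a r * a s = ((r * s) mod int p) * (b r * b s)] (mod int p)" .
    have bd: "\<bar>a r\<bar> \<le> int Q" "\<bar>b r\<bar> \<le> int Q" "\<bar>a s\<bar> \<le> int Q" "\<bar>b s\<bar> \<le> int Q"
      using ab(1)[OF H(1)] ab(1)[OF H(2)] H by linarith+
    have 2: "(a r * a s, b r * b s) \<in> lat p ((r * s) mod int p) X"
      using c bd by (simp add: lat_def X_def abs_mult power2_eq_square mult_mono)
    have "a r * a s \<noteq> 0" using nz[OF H(1)] nz[OF H(2)] by auto
    with 1 2 show "w \<in> (SIGMA r:?H. lat p r X - {(0, 0)})" by (simp add: rs(3) \<phi>_def)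
  qed
  have finS: "finite (SIGMA r:?H. lat p r X - {(0, 0)})" by (simp add: finite_lat)
  \<comment> \<open>In a fibre the coordinates \<open>a r\<close> and \<open>b r\<close> divide the
    fixed nonzero numbers \<open>u\<close> and \<open>v\<close>, which leaves at most
    \<open>(2 * D) * (2 * D)\<close> choices, signs included. These coordinates determine
    \<open>r\<close>, and the fixed product modulo \<open>p\<close> then determines
    \<open>s\<close>.\<close>
  have fibre: "card {w \<in> M \<times> M. \<phi> w = y} \<le> 4 * D\<^sup>2" if y: "y \<in> \<phi> ` (M \<times> M)" for y
  proof -
    obtain r s where rs: "r \<in> M" "s \<in> M" "y = \<phi> (r, s)" using y by auto
    define u v where "u = a r * a s" and "v = b r * b s"
    have H: "r \<in> ?H" "s \<in> ?H" "lam p r \<le> Q" "lam p s \<le> Q" using rs by (auto simp: M_def)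
    have y': "y = ((r * s) mod int p, (u, v))" by (simp add: rs \<phi>_def u_def v_def)
    have bd: "\<bar>a r\<bar> \<le> int Q" "\<bar>b r\<bar> \<le> int Q" "\<bar>a s\<bar> \<le> int Q" "\<bar>b s\<bar> \<le> int Q"
      using ab(1)[OF H(1)] ab(1)[OF H(2)] H by linarith+
    have uv: "u \<noteq> 0" "v \<noteq> 0" using nz[OF H(1)] nz[OF H(2)] by (auto simp: u_def v_def)
    have uvX: "\<bar>u\<bar> \<le> int (Q\<^sup>2)" "\<bar>v\<bar> \<le> int (Q\<^sup>2)"
      using bd by (simp_all add: u_def v_def abs_mult power2_eq_square mult_mono)
    have Du: "card {k. k dvd nat \<bar>u\<bar>} \<le> D" "card {k. k dvd nat \<bar>v\<bar>} \<le> D"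
      using uv uvX by (intro D; simp add: nat_le_iff)+
    let ?E = "{x. x dvd u} \<times> {x. x dvd v}"
    define \<psi> where "\<psi> = (\<lambda>w::int \<times> int. (a (fst w), b (fst w)))"
    have sub: "\<psi> ` {w \<in> M \<times> M. \<phi> w = y} \<subseteq> ?E"
      unfolding y' \<phi>_def \<psi>_def by auto
    have inj: "inj_on \<psi> {w \<in> M \<times> M. \<phi> w = y}"
    proof (rule inj_onI)
      fix w w' assume w: "w \<in> {w \<in> M \<times> M. \<phi> w = y}" "w' \<in> {w \<in> M \<times> M. \<phi> w = y}" "\<psi> w = \<psi> w'"
      obtain r1 s1 r2 s2 where ww: "w = (r1, s1)" "w' = (r2, s2)" by (cases w; cases w')
      have m: "r1 \<in> M" "s1 \<in> M" "r2 \<in> M" "s2 \<in> M" "\<phi> (r1, s1) = y" "\<phi> (r2, s2) = y"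
        and e: "\<psi> (r1, s1) = \<psi> (r2, s2)" using w ww by auto
      have H': "r1 \<in> ?H" "s1 \<in> ?H" "r2 \<in> ?H" "s2 \<in> ?H" using m by (auto simp: M_def)
      have rng: "0 < r1" "r1 < int p" "0 < r2" "r2 < int p" "0 < s1" "s1 < int p" "0 < s2" "s2 < int p"
        using roots_unity_mod_bounds[OF p1 d] H' by blast+
      have e': "a r1 = a r2" "b r1 = b r2" using e by (auto simp: \<psi>_def)
      have "[r1 * b r1 = r2 * b r1] (mod int p)"
        using ab(2)[OF H'(1)] ab(2)[OF H'(3)] unfolding e' by (metis cong_sym cong_trans)
      hence "int p dvd (r1 - r2) * b r1" by (simp add: cong_iff_dvd_diff algebra_simps)
      hence "int p dvd r1 - r2" using nz(2)[OF H'(1)] pp by (auto simp: prime_dvd_mult_iff)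
      hence "[r1 = r2] (mod int p)" by (simp add: cong_iff_dvd_diff)
      hence r: "r1 = r2" using rng by (simp add: cong_def)
      have "(r1 * s1) mod int p = (r1 * s2) mod int p" using m(5,6) r unfolding y' \<phi>_def by simp
      hence "int p dvd r1 * (s1 - s2)" by (simp add: mod_eq_dvd_iff algebra_simps)
      moreover have "\<not> int p dvd r1" using rng zdvd_not_zless by blast
      ultimately have "int p dvd s1 - s2" using pp by (auto simp: prime_dvd_mult_iff)
      hence "[s1 = s2] (mod int p)" by (simp add: cong_iff_dvd_diff)
      hence "s1 = s2" using rng by (simp add: cong_def)
      thus "w = w'" using r ww by simp
    qed
    have "card {w \<in> M \<times> M. \<phi> w = y} \<le> card ?E"
      using card_inj_on_le[OF inj sub] card_int_divisors_le(1) uv by blast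
    also have "\<dots> \<le> (2 * D) * (2 * D)"
      unfolding card_cartesian_product
      using card_int_divisors_le(2)[OF uv(1)] card_int_divisors_le(2)[OF uv(2)] Du
      by (intro mult_le_mono) linarith+
    finally show ?thesis by (simp add: power2_eq_square)
  qed
  have "card (M \<times> M) \<le> 4 * D\<^sup>2 * card (\<phi> ` (M \<times> M))"
    using finM fibre by (intro card_le_mult_card_image) auto
  also have "\<dots> \<le> 4 * D\<^sup>2 * card (SIGMA r:?H. lat p r X - {(0, 0)})"
    using card_mono[OF finS img] by simp
  also have "card (SIGMA r:?H. lat p r X - {(0, 0)}) = (\<Sum>r\<in>?H. card (lat p r X - {(0, 0)}))"
    by (simp add: finite_lat)
  finally have "real (card (M \<times> M)) \<le> real (4 * D\<^sup>2 * (\<Sum>r\<in>?H. card (lat p r X - {(0, 0)})))"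
    by (simp only: of_nat_le_iff)
  hence "real (card M) ^ 2 \<le> 4 * real D ^ 2 * (\<Sum>r\<in>?H. real (card (lat p r X - {(0, 0)})))"
    by (simp add: card_cartesian_product power2_eq_square)
  also have "\<dots> \<le> 4 * real D ^ 2 * (12 * real d * real_of_int X ^ 2 / p + 3 * X * lam_inv_sum p d)"
    using sum_card_lat_nonzero_le[OF p d, of X] by (intro mult_left_mono) (auto simp: X_def)
  \<comment> \<open>The coefficient 3 is enlarged to 12 so that a common factor can be taken
    out.\<close>
  also have "\<dots> \<le> 4 * real D ^ 2 * (12 * real d * real_of_int X ^ 2 / p + 12 * X * lam_inv_sum p d)"
    by (intro mult_left_mono add_left_mono mult_right_mono)
       (auto simp: X_def lam_inv_sum_def intro: sum_nonneg)
  also have "\<dots> = 48 * real D ^ 2 * (real Q)\<^sup>2 * (real d * real Q ^ 2 / p + lam_inv_sum p d)"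
    by (simp add: X_def algebra_simps power2_eq_square)
  finally show ?thesis unfolding M_def .
qed

lemma lam_inv_sum_nonneg: "lam_inv_sum p d \<ge> 0"
  unfolding lam_inv_sum_def by (intro sum_nonneg) auto

text \<open>Dyadic decomposition by length. Up to length \<open>R\<close> the product argument
  bounds the number of ratios, in terms of the sum itself; beyond \<open>R\<close> the trivial bound
  \<open>d\<close> is used. With \<open>R\<close> the fourth root of \<open>d * p\<close>, both
  contributions are of order \<open>d / R\<close>, the fourth root of
  \<open>d ^ 3 / p\<close>.\<close>

lemma lam_inv_sum_le:
  fixes p d J D :: nat and R :: real
  assumes p: "prime p" and d: "d > 0" and J: "p \<le> 2 ^ J" "2 ^ J \<le> 2 * p"
    and D: "D \<ge> 1" "\<And>n. n > 0 \<Longrightarrow> n \<le> (2 * p)\<^sup>2 \<Longrightarrow> card {k. k dvd n} \<le> D"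
    and R: "R > 0" "R ^ 4 = real d * real p"
  shows "lam_inv_sum p d \<le> 784 * (real J)\<^sup>2 * (real D)\<^sup>2 * (1 + real d / R)"
proof -
  let ?H = "roots_unity_mod (int p) d"
  define S where "S = lam_inv_sum p d"
  define E where "E = real d / R"
  define M where "M j = {r \<in> ?H. lam p r \<le> 2 ^ (j + 1)}" for j :: nat
  have p1: "int p > 1" using prime_gt_1_nat[OF p] by simp
  have S0: "S \<ge> 0" unfolding S_def by (rule lam_inv_sum_nonneg)
  have E0: "E \<ge> 0" unfolding E_def using R by simp
  \<comment> \<open>The balance that fixes \<open>R\<close>: the area term at length
    \<open>R\<close> equals the square of \<open>d / R\<close>.\<close>
  have E2: "E\<^sup>2 = real d * R\<^sup>2 / real p"
  proof -
    have "E\<^sup>2 * R ^ 4 = (real d)\<^sup>2 * R\<^sup>2"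
      using R(1) unfolding E_def by (simp add: field_simps power2_eq_square power4_eq_xxxx)
    hence "E\<^sup>2 * real p = real d * R\<^sup>2"
      using d unfolding R(2) by (simp add: power2_eq_square algebra_simps)
    thus ?thesis using p1 by (simp add: field_simps)
  qed
  have pw: "1 / real (lam p r) \<le> (\<Sum>j<J. if r \<in> M j then 1 / 2 ^ j else 0)" if r: "r \<in> ?H" for r
  proof -
    have l: "lam p r > 0" by (rule lam_props(1)[OF p1])
    have "int (lam p r) < int p" using lam_less roots_unity_mod_bounds[OF p1 d r] by blast
    hence lp: "lam p r < 2 ^ J" using J by linarith
    obtain j where j: "2 ^ j \<le> lam p r" "lam p r < 2 ^ (j + 1)"
      using ex_power_ivl1[of 2 "lam p r"] l by auto
    have "(2::nat) ^ j < 2 ^ J" using j(1) lp by linarith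
    hence jJ: "j < J" by simp
    have "(2::real) ^ j \<le> real (lam p r)" using j(1) by (metis of_nat_le_iff of_nat_numeral of_nat_power)
    hence "1 / real (lam p r) \<le> 1 / 2 ^ j" using l by (intro divide_left_mono) auto
    also have "\<dots> = (if r \<in> M j then 1 / 2 ^ j else 0)" using r j by (simp add: M_def)
    also have "\<dots> \<le> (\<Sum>j<J. if r \<in> M j then 1 / 2 ^ j else 0)"
      using jJ by (intro member_le_sum) auto
    finally show ?thesis .
  qed
  have "S \<le> (\<Sum>r\<in>?H. \<Sum>j<J. if r \<in> M j then 1 / 2 ^ j else 0)"
    unfolding S_def lam_inv_sum_def by (intro sum_mono pw)
  also have "\<dots> = (\<Sum>j<J. \<Sum>r\<in>?H. if r \<in> M j then 1 / 2 ^ j else 0)" by (rule sum.swap)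
  also have "\<dots> = (\<Sum>j<J. real (card (M j)) / 2 ^ j)"
  proof (intro sum.cong refl)
    fix j
    have "(\<Sum>r\<in>?H. if r \<in> M j then 1 / 2 ^ j else 0) = (\<Sum>r\<in>?H \<inter> M j. (1::real) / 2 ^ j)"
      by (rule sum.inter_restrict[symmetric]) simp
    also have "?H \<inter> M j = M j" by (auto simp: M_def)
    finally show "(\<Sum>r\<in>?H. if r \<in> M j then 1 / 2 ^ j else 0) = real (card (M j)) / 2 ^ j" by simp
  qed
  also have "\<dots> \<le> (\<Sum>j<J. 14 * real D * (E + sqrt S))"
  proof (intro sum_mono)
    fix j assume "j \<in> {..<J}"
    define Q where "Q = (2::nat) ^ (j + 1)"
    have "Q \<le> 2 ^ J" unfolding Q_def using \<open>j \<in> {..<J}\<close> by (intro power_increasing) auto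
    hence Qp: "Q \<le> 2 * p" using J by linarith
    have Q0: "Q > 0" by (simp add: Q_def)
    have Q2: "real Q = 2 * 2 ^ j" by (simp add: Q_def)
    have MQ: "M j = {r \<in> ?H. lam p r \<le> Q}" by (simp add: M_def Q_def)
    show "real (card (M j)) / 2 ^ j \<le> 14 * real D * (E + sqrt S)"
    proof (cases "real Q \<le> R")
      case True
      have "card {k. k dvd n} \<le> D" if "n > 0" "n \<le> Q\<^sup>2" for n
        using that Qp power_mono[OF Qp, of 2] by (intro D(2)) auto
      hence "real (card (M j)) ^ 2 \<le> 48 * real D ^ 2 * (real Q)\<^sup>2 * (real d * real Q ^ 2 / p + S)"
        unfolding MQ S_def by (intro card_small_lam_square_le[OF p d])
      \<comment> \<open>Rounding 48 up to 49 makes the square root exact. The factor 14 below is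
        this 7 times \<open>Q / 2 ^ j = 2\<close>.\<close>
      also have "\<dots> \<le> 49 * real D ^ 2 * (real Q)\<^sup>2 * (E + sqrt S)\<^sup>2"
      proof (rule mult_mono)
        have "real d * real Q ^ 2 / p \<le> real d * R\<^sup>2 / p"
          using True by (intro divide_right_mono mult_left_mono power_mono) auto
        also have "\<dots> + S \<le> (E + sqrt S)\<^sup>2"
          using E0 S0 unfolding E2[symmetric] by (simp add: power2_sum)
        finally show "real d * real Q ^ 2 / p + S \<le> (E + sqrt S)\<^sup>2" by simp
      qed (use S0 in auto)
      also have "\<dots> = (7 * real D * real Q * (E + sqrt S))\<^sup>2"
        by (simp add: power_mult_distrib)
      finally have "real (card (M j)) ^ 2 \<le> (7 * real D * real Q * (E + sqrt S))\<^sup>2" .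
      hence "real (card (M j)) \<le> 7 * real D * real Q * (E + sqrt S)"
        by (rule power2_le_imp_le) (use E0 S0 in simp)
      thus ?thesis unfolding Q2 by (simp add: field_simps)
    next
      case False
      have "card (M j) \<le> card ?H" unfolding M_def by (intro card_mono) auto
      hence "card (M j) \<le> d" using card_roots_unity_mod_le[OF p d] by linarith
      hence "real (card (M j)) / 2 ^ j \<le> real d / 2 ^ j" by (intro divide_right_mono) auto
      also have "\<dots> = 2 * (real d / real Q)" by (simp add: Q2)
      also have "\<dots> \<le> 2 * E" unfolding E_def using False R Q0 by (intro mult_left_mono divide_left_mono) auto
      also have "\<dots> \<le> 14 * real D * E" using E0 D(1) by (intro mult_right_mono) auto
      also have "\<dots> \<le> 14 * real D * (E + sqrt S)" using S0 by (intro mult_left_mono) auto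
      finally show ?thesis .
    qed
  qed
  finally have S1: "S \<le> real J * (14 * real D * (E + sqrt S))" by simp
  define w where "w = 14 * real J * real D"
  have "J > 0" using J(1) p1 by (cases J) auto
  hence w1: "w \<ge> 1" unfolding w_def using D(1) mult_mono[of 1 "real J" 1 "real D"] by simp
  \<comment> \<open>The inequality \<open>S <= w * E + w * sqrt S\<close> is solved for
    \<open>S\<close> by absorbing half of \<open>S\<close>. The final constant is
    \<open>784 = 4 * 14 ^ 2\<close>.\<close>
  have "2 * (w * sqrt S) \<le> w\<^sup>2 + S"
    using sum_squares_bound[of w "sqrt S"] S0 by (simp add: mult.assoc)
  moreover have "S \<le> w * E + w * sqrt S" using S1 unfolding w_def by (simp add: algebra_simps)
  ultimately have "S \<le> 2 * (w * E) + w\<^sup>2" by linarith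
  also have "w * E \<le> w\<^sup>2 * E" using w1 E0 by (intro mult_right_mono) (auto simp: power2_eq_square)
  also have "2 * (w\<^sup>2 * E) + w\<^sup>2 \<le> 4 * w\<^sup>2 * (1 + E)" using E0 by (simp add: algebra_simps)
  finally have "S \<le> 4 * w\<^sup>2 * (1 + E)" by simp
  thus ?thesis unfolding S_def E_def w_def by (simp add: power_mult_distrib)
qed

section \<open>A coset in an interval\<close>

text \<open>The set \<open>A\<close> may be any collection of solutions in the interval. The last
  assumption says that the length is at most \<open>p / d\<close>, in integers and without
  division.\<close>

locale coset_in_interval =
  fixes p d :: nat and l z N :: int and A :: "int set"
  assumes prime_p: "prime p" and d_pos: "d > 0" and coprime_l: "coprime l (int p)"
    and A_sub: "A \<subseteq> {z..<z + N}" and A_root: "\<And>x. x \<in> A \<Longrightarrow> [x ^ d = l] (mod int p)"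
    and N_pos: "N \<ge> 1" and N_le: "N * int d \<le> int p"
begin

abbreviation H :: "int set" where "H \<equiv> roots_unity_mod (int p) d"

definition ratio_pairs :: "int set \<Rightarrow> int \<Rightarrow> (int \<times> int) set" where
  "ratio_pairs B r = {(x, y). x \<in> B \<and> y \<in> B \<and> [x = r * y] (mod int p)}"

definition overlap :: "int set \<Rightarrow> int \<Rightarrow> int set" where
  "overlap B r = {a \<in> B. \<exists>a'\<in>B. [a' = r * a] (mod int p)}"

lemma p_gt_1: "int p > 1" and prime_int_p: "prime (int p)"
  using prime_gt_1_nat[OF prime_p] prime_p by auto

lemma N_le_p: "N \<le> int p"
proof -
  have "N * 1 \<le> N * int d" using d_pos N_pos by (intro mult_left_mono) auto
  thus ?thesis using N_le by linarith
qed

lemma finite_A: "finite A" using A_sub finite_subset by blast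

lemma diff_A: "x \<in> A \<Longrightarrow> y \<in> A \<Longrightarrow> \<bar>x - y\<bar> < N"
  using subsetD[OF A_sub, of x] subsetD[OF A_sub, of y] by (auto simp: abs_if)

lemma inj_on_mod_A: "inj_on (\<lambda>x. x mod int p) A"
proof (rule inj_onI)
  fix x y assume xy: "x \<in> A" "y \<in> A" "x mod int p = y mod int p"
  have "int p dvd x - y" using xy(3) by (simp add: mod_eq_dvd_iff)
  moreover have "\<bar>x - y\<bar> < int p" using diff_A[OF xy(1,2)] N_le_p by linarith
  ultimately show "x = y" using dvd_imp_le_int[of "x - y" "int p"] by auto
qed

lemma cong_A_imp_eq: "x \<in> A \<Longrightarrow> y \<in> A \<Longrightarrow> [x = y] (mod int p) \<Longrightarrow> x = y"
  using cong_imp_eq_of_inj_on_mod[OF inj_on_mod_A] by blast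

lemma finite_ratio_pairs: "B \<subseteq> A \<Longrightarrow> finite (ratio_pairs B r)"
  by (rule finite_subset[of _ "A \<times> A"]) (auto simp: ratio_pairs_def finite_A)

lemma card_ratio_pairs_eq:
  assumes "B \<subseteq> A"
  shows "card (ratio_pairs B r) = card (overlap B r)"
proof -
  have "inj_on snd (ratio_pairs B r)"
  proof (rule inj_onI)
    fix u v assume uv: "u \<in> ratio_pairs B r" "v \<in> ratio_pairs B r" "snd u = snd v"
    hence "[fst u = r * snd u] (mod int p)" "[fst v = r * snd u] (mod int p)"
      by (auto simp: ratio_pairs_def)
    hence "[fst u = fst v] (mod int p)" using cong_sym cong_trans by blast
    thus "u = v" using uv assms cong_A_imp_eq[of "fst u" "fst v"]
      by (auto simp: ratio_pairs_def prod_eq_iff subset_iff)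
  qed
  moreover have "snd ` ratio_pairs B r = overlap B r"
    by (force simp: ratio_pairs_def overlap_def)
  ultimately show ?thesis by (metis card_image)
qed

text \<open>Any two elements of the coset have their ratio in \<open>H\<close>, so the pairs from
  \<open>B\<close> are distributed over the ratios.\<close>

lemma card_square_le_sum_overlap:
  assumes "B \<subseteq> A"
  shows "(card B)\<^sup>2 \<le> (\<Sum>r\<in>H. card (overlap B r))"
proof -
  have "B \<times> B \<subseteq> (\<Union>r\<in>H. ratio_pairs B r)"
  proof clarify
    fix x y assume xy: "x \<in> B" "y \<in> B"
    obtain r where "r \<in> H" "[x = r * y] (mod int p)"
      using ratio_in_roots_unity_mod[OF prime_int_p coprime_l d_pos] A_root xy assms by (metis subsetD)
    thus "(x, y) \<in> (\<Union>r\<in>H. ratio_pairs B r)" using xy by (auto simp: ratio_pairs_def)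
  qed
  hence "card (B \<times> B) \<le> card (\<Union>r\<in>H. ratio_pairs B r)"
    using finite_ratio_pairs[OF assms] by (intro card_mono) auto
  also have "\<dots> \<le> (\<Sum>r\<in>H. card (ratio_pairs B r))" by (intro card_UN_le) simp
  finally show ?thesis
    by (simp add: card_ratio_pairs_eq[OF assms] card_cartesian_product power2_eq_square)
qed

text \<open>Subtracting a fixed pair of ratio \<open>r\<close> moves the others injectively into the
  lattice, with coordinates below \<open>N\<close>.\<close>

lemma card_ratio_pairs_le: "card (ratio_pairs A r) \<le> card (lat p r N)"
proof (cases "ratio_pairs A r = {}")
  case False
  then obtain x0 y0 where 0: "(x0, y0) \<in> ratio_pairs A r" by auto
  have sub: "(\<lambda>(x, y). (x - x0, y - y0)) ` ratio_pairs A r \<subseteq> lat p r N"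
  proof clarify
    fix x y assume xy: "(x, y) \<in> ratio_pairs A r"
    have "[x - x0 = r * y - r * y0] (mod int p)"
      using 0 xy by (intro cong_diff) (auto simp: ratio_pairs_def)
    moreover have "\<bar>x - x0\<bar> < N" "\<bar>y - y0\<bar> < N" using 0 xy diff_A by (auto simp: ratio_pairs_def)
    ultimately show "(x - x0, y - y0) \<in> lat p r N" by (simp add: lat_def algebra_simps)
  qed
  have "inj_on (\<lambda>(x, y). (x - x0, y - y0)) (ratio_pairs A r)" by (auto simp: inj_on_def)
  from card_inj_on_le[OF this sub finite_lat] show ?thesis .
qed simp

lemma card_overlap_le:
  "real (card (overlap A r)) \<le> 1 + 12 * real_of_int N ^ 2 / p + 3 * N * (1 / lam p r)"
proof -
  have "card (overlap A r) \<le> card (lat p r N)"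
    using card_ratio_pairs_le card_ratio_pairs_eq[of A] by simp
  hence "real (card (overlap A r)) \<le> real (card (lat p r N))" by (simp only: of_nat_le_iff)
  also have "\<dots> \<le> 1 + 12 * real_of_int N ^ 2 / p + 3 * N * (1 / lam p r)"
    using card_lat_le_Suc[OF p_gt_1, of N r] N_pos by simp
  finally show ?thesis .
qed

text \<open>Sum of the lattice counts over at most \<open>d\<close> ratios;
  \<open>N * d <= p\<close> reduces the total area term to \<open>12 * N\<close>.\<close>

lemma card_A_square_le:
  "(real (card A))\<^sup>2 \<le> real d + 12 * real_of_int N + 3 * real_of_int N * lam_inv_sum p d"
proof -
  have "real ((card A)\<^sup>2) \<le> real (\<Sum>r\<in>H. card (overlap A r))"
    using card_square_le_sum_overlap[of A] by (simp only: of_nat_le_iff)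
  hence "(real (card A))\<^sup>2 \<le> (\<Sum>r\<in>H. real (card (overlap A r)))" by simp
  also have "\<dots> \<le> (\<Sum>r\<in>H. 1 + 12 * real_of_int N ^ 2 / p + 3 * N * (1 / lam p r))"
    by (intro sum_mono card_overlap_le)
  also have "\<dots> = card H * (1 + 12 * real_of_int N ^ 2 / p) + 3 * N * lam_inv_sum p d"
    by (simp add: sum.distrib lam_inv_sum_def sum_distrib_left algebra_simps)
  also have "card H * (1 + 12 * real_of_int N ^ 2 / p) \<le> d * (1 + 12 * real_of_int N ^ 2 / p)"
    using card_roots_unity_mod_le[OF prime_p d_pos] by (intro mult_right_mono) auto
  also have "d * (1 + 12 * real_of_int N ^ 2 / p) \<le> d + 12 * real_of_int N"
  proof -
    have "real_of_int (N * int d) \<le> real_of_int (int p)" using N_le by (simp only: of_int_le_iff)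
    hence "real_of_int N * real d / p \<le> 1" using p_gt_1 by simp
    hence "12 * real_of_int N * (real_of_int N * real d / p) \<le> 12 * real_of_int N * 1"
      using N_pos by (intro mult_left_mono) auto
    thus ?thesis by (simp add: algebra_simps power2_eq_square)
  qed
  finally show ?thesis by simp
qed
end

section \<open>Ratios with large overlap, for d near the cube root of p\<close>

context coset_in_interval
begin

lemma overlap_subset: "overlap B r \<subseteq> B"
  by (auto simp: overlap_def)

text \<open>Ratios with shortest length at most \<open>Q\<close> account for at most half of the
  pairs, since each overlap is at most \<open>T <= T * Q / lam\<close>. If no other ratio had a
  large overlap, the rest would account for at most a quarter.\<close>

lemma exists_ratio_large_overlap:
  fixes Q :: real
  assumes T: "card A > 0" and Q: "Q > 0" "2 * Q * lam_inv_sum p d \<le> card A"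
  obtains r where "r \<in> H" "real (lam p r) > Q" "(real (card A))\<^sup>2 \<le> 4 * real d * real (card (overlap A r))"
proof -
  define T where "T = real (card A)"
  have T0: "T > 0" using T by (simp add: T_def)
  have "\<exists>r\<in>H. real (lam p r) > Q \<and> T\<^sup>2 \<le> 4 * real d * real (card (overlap A r))"
  proof (rule ccontr)
    assume neg: "\<not> ?thesis"
    have pw: "real (card (overlap A r)) \<le> T * Q * (1 / lam p r) + T\<^sup>2 / (4 * real d)" if "r \<in> H" for r
    proof (cases "real (lam p r) > Q")
      case True
      hence "4 * real d * real (card (overlap A r)) < T\<^sup>2" using neg that by auto
      hence "real (card (overlap A r)) \<le> T\<^sup>2 / (4 * real d)" using d_pos by (simp add: field_simps)
      moreover have "0 \<le> T * Q * (1 / lam p r)" using T0 Q by simp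
      ultimately show ?thesis by linarith
    next
      case False
      have "lam p r > 0" by (rule lam_props(1)[OF p_gt_1])
      hence "1 \<le> Q * (1 / lam p r)" using False by (simp add: field_simps)
      hence "T * 1 \<le> T * (Q * (1 / lam p r))" using T0 by (intro mult_left_mono) auto
      hence "T \<le> T * Q * (1 / lam p r)" by simp
      moreover have "real (card (overlap A r)) \<le> T"
        unfolding T_def of_nat_le_iff by (intro card_mono finite_A overlap_subset)
      moreover have "0 \<le> T\<^sup>2 / (4 * real d)" by simp
      ultimately show ?thesis by linarith
    qed
    have "real ((card A)\<^sup>2) \<le> real (\<Sum>r\<in>H. card (overlap A r))"
      using card_square_le_sum_overlap[of A] by (simp only: of_nat_le_iff)
    hence "T\<^sup>2 \<le> (\<Sum>r\<in>H. real (card (overlap A r)))" by (simp add: T_def)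
    also have "\<dots> \<le> (\<Sum>r\<in>H. T * Q * (1 / lam p r) + T\<^sup>2 / (4 * real d))" by (intro sum_mono pw)
    also have "\<dots> = T * Q * lam_inv_sum p d + card H * (T\<^sup>2 / (4 * real d))"
      by (simp add: sum.distrib lam_inv_sum_def sum_distrib_left)
    also have "card H * (T\<^sup>2 / (4 * real d)) \<le> d * (T\<^sup>2 / (4 * real d))"
      using card_roots_unity_mod_le[OF prime_p d_pos] by (intro mult_right_mono) auto
    also have "d * (T\<^sup>2 / (4 * real d)) = T\<^sup>2 / 4" using d_pos by simp
    finally have "T\<^sup>2 \<le> T * (Q * lam_inv_sum p d) + T\<^sup>2 / 4" by (simp add: mult.assoc)
    moreover have "T * (Q * lam_inv_sum p d) \<le> T * (T / 2)"
      using Q T0 by (intro mult_left_mono) (auto simp: T_def)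
    moreover have "T * (T / 2) = T\<^sup>2 / 2" by (simp add: power2_eq_square)
    moreover have "T\<^sup>2 > 0" using T0 by simp
    ultimately show False by linarith
  qed
  thus ?thesis using that unfolding T_def by blast
qed

text \<open>Each \<open>y\<close> in the overlap lifts to a point \<open>(g y, y)\<close> with both
  coordinates in \<open>A\<close>. After subtracting the base point \<open>y0\<close>, the fivefold
  combination is a sum of three differences of such points, hence a lattice vector in the box of
  size \<open>3 * N\<close>.\<close>

lemma card_sumset_overlap_le:
  fixes r :: int
  defines "B \<equiv> overlap A r"
  shows "card ((\<lambda>(a, b, c, e, f). (a + b + c - e - f) mod int p) ` (B \<times> B \<times> B \<times> B \<times> B))
           \<le> card (lat p r (3 * N))"
proof (cases "B = {}")
  case False
  then obtain y0 where y0: "y0 \<in> B" by blast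
  have "\<forall>y\<in>B. \<exists>x\<in>A. [x = r * y] (mod int p)" by (auto simp: B_def overlap_def)
  then obtain g where g: "\<And>y. y \<in> B \<Longrightarrow> g y \<in> A" "\<And>y. y \<in> B \<Longrightarrow> [g y = r * y] (mod int p)" by metis
  have BA: "y \<in> A" if "y \<in> B" for y using that by (auto simp: B_def overlap_def)
  have "(\<lambda>(a, b, c, e, f). (a + b + c - e - f) mod int p) ` (B \<times> B \<times> B \<times> B \<times> B)
      \<subseteq> (\<lambda>(u, v). (v + y0) mod int p) ` lat p r (3 * N)"
  proof clarify
    fix a b c e f assume m: "a \<in> B" "b \<in> B" "c \<in> B" "e \<in> B" "f \<in> B"
    define v where "v = (a - e) + (b - f) + (c - y0)"
    define u where "u = (g a - g e) + (g b - g f) + (g c - g y0)"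
    have "[u = (r * a - r * e) + (r * b - r * f) + (r * c - r * y0)] (mod int p)"
      unfolding u_def by (intro cong_add cong_diff g m y0)
    hence c: "[u = r * v] (mod int p)" by (simp add: v_def algebra_simps)
    have "\<bar>a - e\<bar> < N" "\<bar>b - f\<bar> < N" "\<bar>c - y0\<bar> < N" using m y0 BA by (auto intro!: diff_A)
    hence v: "\<bar>v\<bar> \<le> 3 * N" unfolding v_def by linarith
    have "\<bar>g a - g e\<bar> < N" "\<bar>g b - g f\<bar> < N" "\<bar>g c - g y0\<bar> < N" using m y0 g by (auto intro!: diff_A)
    hence u: "\<bar>u\<bar> \<le> 3 * N" unfolding u_def by linarith
    have "(u, v) \<in> lat p r (3 * N)" using c u v by (simp add: lat_def)
    moreover have "(a + b + c - e - f) mod int p = (case (u, v) of (u, v) \<Rightarrow> (v + y0) mod int p)"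
      by (simp add: v_def algebra_simps)
    ultimately show "(a + b + c - e - f) mod int p \<in> (\<lambda>(u, v). (v + y0) mod int p) ` lat p r (3 * N)"
      by (rule rev_image_eqI)
  qed
  hence "card ((\<lambda>(a, b, c, e, f). (a + b + c - e - f) mod int p) ` (B \<times> B \<times> B \<times> B \<times> B))
      \<le> card ((\<lambda>(u, v). (v + y0) mod int p) ` lat p r (3 * N))"
    by (intro card_mono finite_imageI finite_lat)
  also have "\<dots> \<le> card (lat p r (3 * N))" by (intro card_image_le finite_lat)
  finally show ?thesis .
qed simp

text \<open>Popularity argument: overlaps below \<open>n1\<close> account for at most
  \<open>d * n1\<close>, half of all pairs, and every popular \<open>h\<close> accounts for at most
  \<open>card B\<close>.\<close>

lemma card_large_overlap_le:
  assumes B: "B \<subseteq> A" "B \<noteq> {}" and n1: "2 * d * n1 \<le> (card B)\<^sup>2"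
  shows "card B \<le> 2 * card {h \<in> H. n1 \<le> card (overlap B h)}"
proof -
  define n where "n = card B"
  define Z where "Z = {h \<in> H. n1 \<le> card (overlap B h)}"
  have finB: "finite B" using B finite_A finite_subset by blast
  have n0: "n > 0" using B finB by (simp add: n_def card_gt_0_iff)
  have "n\<^sup>2 \<le> (\<Sum>h\<in>H. card (overlap B h))"
    unfolding n_def by (rule card_square_le_sum_overlap[OF B(1)])
  also have "\<dots> \<le> (\<Sum>h\<in>H. (if h \<in> Z then n else 0) + n1)"
  proof (rule sum_mono)
    fix h assume "h \<in> H"
    have "card (overlap B h) \<le> n" unfolding n_def by (intro card_mono finB overlap_subset)
    thus "card (overlap B h) \<le> (if h \<in> Z then n else 0) + n1" using \<open>h \<in> H\<close> by (auto simp: Z_def)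
  qed
  also have "\<dots> = (\<Sum>h\<in>H. if h \<in> Z then n else 0) + card H * n1" by (simp add: sum.distrib)
  also have "(\<Sum>h\<in>H. if h \<in> Z then n else 0) = (\<Sum>h\<in>H \<inter> Z. n)"
    by (rule sum.inter_restrict[symmetric]) simp
  also have "H \<inter> Z = Z" by (auto simp: Z_def)
  finally have "n\<^sup>2 \<le> card Z * n + card H * n1" by simp
  moreover have "card H * n1 \<le> d * n1" using card_roots_unity_mod_le[OF prime_p d_pos] by simp
  moreover have "2 * (d * n1) \<le> n\<^sup>2" using n1 by (simp add: n_def mult.assoc)
  ultimately have "n\<^sup>2 \<le> 2 * (card Z * n)" by linarith
  hence "n * n \<le> n * (2 * card Z)" by (simp add: power2_eq_square mult.commute mult.left_commute)
  hence "n \<le> 2 * card Z" using n0 nat_mult_le_cancel1 by blast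
  thus ?thesis unfolding n_def Z_def .
qed

text \<open>The popular multipliers of \<open>B\<close> serve as \<open>Z\<close> in the sum-product
  bound. They number at least half of \<open>card B\<close>, so the fourth power loses 16, and
  \<open>64 = 16 * 4\<close>.\<close>

lemma sum_product_overlap:
  fixes r :: int and K n1 :: nat
  defines "B \<equiv> overlap A r"
  assumes p5: "p \<ge> 5" and n1: "n1 > 0" "2 * d * n1 \<le> (card B)\<^sup>2"
    and K: "card (lat p r (3 * N)) \<le> K * n1" and big: "64 * (p - 1) \<le> card B ^ 4"
  shows "(p - 1) * (card B)\<^sup>2 \<le> 2 * K ^ 289 * card (lat p r (3 * N)) * ((card B)\<^sup>2 + p)"
proof -
  have BA: "B \<subseteq> A" unfolding B_def by (rule overlap_subset)
  have finB: "finite B" using BA finite_A finite_subset by blast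
  have "card B \<noteq> 0" using big p5 by (intro notI) simp
  hence Bne: "B \<noteq> {}" by auto
  define Z where "Z = {h \<in> H. n1 \<le> card (overlap B h)}"
  have "card B \<le> 2 * card Z" unfolding Z_def by (rule card_large_overlap_le[OF BA Bne n1(2)])
  hence "card B ^ 4 \<le> (2 * card Z) ^ 4" by (rule power_mono) simp
  hence "16 * (4 * (p - 1)) \<le> 16 * card Z ^ 4" using big by (simp add: power_mult_distrib)
  hence Z4: "4 * (nat (int p) - 1) \<le> card Z ^ 4" by simp
  have "(nat (int p) - 1) * (card B)\<^sup>2 \<le>
      2 * K ^ 289 * card (lat p r (3 * N)) * ((card B)\<^sup>2 + nat (int p))"
  proof (rule sum_product_bound[OF prime_int_p _ finB _ _ Z4 n1(1) _ _ K])
    show "int p \<ge> 5" using p5 by simp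
    show "inj_on (\<lambda>x. x mod int p) B" by (rule inj_on_subset[OF inj_on_mod_A BA])
    show "Z \<subseteq> {0..<int p}" by (auto simp: Z_def roots_unity_mod_def)
    show "n1 \<le> card {a \<in> B. \<exists>a'\<in>B. [a' = h * a] (mod int p)}" if "h \<in> Z" for h
      using that by (simp add: Z_def overlap_def)
    show "card ((\<lambda>(a, b, c, d, e). (a + b + c - d - e) mod int p) ` (B \<times> B \<times> B \<times> B \<times> B))
        \<le> card (lat p r (3 * N))"
      unfolding B_def by (rule card_sumset_overlap_le)
  qed
  thus ?thesis by simp
qed

end

section \<open>Linear equations in roots of unity\<close>

lemma solution_set_linear_cong:
  fixes p s t g :: int
  assumes "prime p" "\<not> p dvd s"
  shows "card {(x, y). x \<in> {0..<p} \<and> y \<in> {0..<p} \<and> [x * s + y * t = g] (mod p)} = nat p"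
proof -
  let ?S = "{(x, y). x \<in> {0..<p} \<and> y \<in> {0..<p} \<and> [x * s + y * t = g] (mod p)}"
  have p0: "p > 0" using assms(1) by (simp add: prime_gt_0_int)
  have "coprime s p" using assms by (metis coprime_commute prime_imp_coprime)
  then obtain s' where s': "[s * s' = 1] (mod p)" using cong_solve_coprime_int by blast
  have "bij_betw snd ?S {0..<p}"
  proof (rule bij_betw_imageI)
    show "inj_on snd ?S"
    proof (rule inj_onI)
      fix u v assume uv: "u \<in> ?S" "v \<in> ?S" "snd u = snd v"
      obtain x x' y where e: "u = (x, y)" "v = (x', y)" using uv(3) by (cases u; cases v) auto
      have "[x * s + y * t = x' * s + y * t] (mod p)"
        using uv(1,2) unfolding e by (auto intro: cong_trans cong_sym)
      hence "[x * s = x' * s] (mod p)" by (simp add: cong_add_rcancel)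
      hence "[x = x'] (mod p)"
        using prime_cong_mult_cancel[OF assms(1)] assms(2) by (auto simp: cong_0_iff)
      thus "u = v" using uv(1,2) unfolding e by (auto simp: cong_def)
    qed
    show "snd ` ?S = {0..<p}"
    proof
      show "{0..<p} \<subseteq> snd ` ?S"
      proof
        fix y assume y: "y \<in> {0..<p}"
        define x where "x = ((g - y * t) * s') mod p"
        have "[x * s = (g - y * t) * s' * s] (mod p)"
          unfolding x_def by (intro cong_mult cong_refl) (simp add: cong_def)
        also have "(g - y * t) * s' * s = (g - y * t) * (s * s')" by simp
        also have "[(g - y * t) * (s * s') = (g - y * t) * 1] (mod p)" by (intro cong_mult cong_refl s')
        finally have "[x * s + y * t = (g - y * t) * 1 + y * t] (mod p)" by (intro cong_add cong_refl)
        hence "(x, y) \<in> ?S" using y p0 by (simp add: x_def)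
        thus "y \<in> snd ` ?S" by force
      qed
    qed auto
  qed
  thus ?thesis by (simp add: bij_betw_same_card)
qed

text \<open>
  A variance computation over all pairs of coefficients: the number of solutions is constant on
  the \<open>|H|\<^sup>2\<close> pairs \<open>(\<alpha>h, \<beta>h')\<close>, so a single large deviation from the mean would be too expensive.
\<close>
lemma card_linear_solutions_le:
  fixes p d :: nat and \<alpha> \<beta> \<gamma> :: int
  assumes p: "prime p" and d: "d > 0"
    and nz: "\<not> int p dvd \<alpha>" "\<not> int p dvd \<beta>" "\<not> int p dvd \<gamma>"
  defines "H \<equiv> roots_unity_mod (int p) d"
  shows "real (card {(s, t). s \<in> H \<and> t \<in> H \<and> [\<alpha> * s + \<beta> * t = \<gamma>] (mod int p)})
           \<le> (real d)\<^sup>2 / p + sqrt p"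
proof -
  have p1: "int p > 1" and pp: "prime (int p)" using prime_gt_1_nat[OF p] p by auto
  define P where "P = int p"
  define U where "U = {0..<P} \<times> {0..<P}"
  define S where "S x y = {(s, t). s \<in> H \<and> t \<in> H \<and> [x * s + y * t = \<gamma>] (mod P)}" for x y
  define f where "f w = real (card (S (fst w) (snd w)))" for w :: "int \<times> int"
  define e where "e = real (card H)"
  define \<mu> where "\<mu> = e\<^sup>2 / p"
  have finH: "finite H" by (simp add: H_def)
  have Hnz: "\<not> P dvd h" if "h \<in> H" for h
    using roots_unity_mod_bounds[OF p1 d] that zdvd_not_zless unfolding H_def P_def by blast
  have Hrng: "h \<in> {0..<P}" if "h \<in> H" for h using that by (auto simp: H_def P_def roots_unity_mod_def)
  have "1 \<in> H" using p1 by (simp add: H_def roots_unity_mod_def)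
  hence e0: "e > 0" unfolding e_def using finH by (auto simp: card_gt_0_iff)
  have finS: "finite (S x y)" for x y
    by (rule finite_subset[of _ "H \<times> H"]) (auto simp: S_def finH)
  have finU: "finite U" by (simp add: U_def)
  define V where "V u v = {w \<in> U. u \<in> S (fst w) (snd w) \<and> v \<in> S (fst w) (snd w)}" for u v
  have f_sum: "f w = (\<Sum>u\<in>H \<times> H. if u \<in> S (fst w) (snd w) then 1 else 0)" for w
  proof -
    have "(\<Sum>u\<in>H \<times> H. if u \<in> S (fst w) (snd w) then 1 else 0) = (\<Sum>u\<in>(H \<times> H) \<inter> S (fst w) (snd w). (1::real))"
      using finH by (intro sum.inter_restrict[symmetric]) auto
    also have "(H \<times> H) \<inter> S (fst w) (snd w) = S (fst w) (snd w)" by (auto simp: S_def)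
    finally show ?thesis by (simp add: f_def)
  qed
  have Vdiag: "card (V u u) = p" if u: "u \<in> H \<times> H" for u
  proof -
    obtain s t where st: "u = (s, t)" "s \<in> H" "t \<in> H" using u by auto
    have "V u u = {(x, y). x \<in> {0..<P} \<and> y \<in> {0..<P} \<and> [x * s + y * t = \<gamma>] (mod P)}"
      using st by (auto simp: V_def U_def S_def)
    thus ?thesis using solution_set_linear_cong[OF pp, of s t \<gamma>] Hnz[OF st(2)] by (simp add: P_def)
  qed
  \<comment> \<open>Two distinct points of \<open>H x H\<close> give two linear equations for
    \<open>(x, y)\<close>. Were their determinant zero modulo \<open>p\<close>, combining the
    equations would force \<open>s' = s\<close>, because \<open>p\<close> does not divide the
    right-hand side, and then \<open>t' = t\<close>.\<close>
  have Voff: "card (V u v) \<le> 1" if u: "u \<in> H \<times> H" and v: "v \<in> H \<times> H" and uv: "u \<noteq> v" for u v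
  proof -
    obtain s t where st: "u = (s, t)" "s \<in> H" "t \<in> H" using u by auto
    obtain s' t' where st': "v = (s', t')" "s' \<in> H" "t' \<in> H" using v by auto
    have eqs: "[x * s + y * t = \<gamma>] (mod P)" "[x * s' + y * t' = \<gamma>] (mod P)" "x \<in> {0..<P}" "y \<in> {0..<P}"
      if "(x, y) \<in> V u v" for x y
      using that st st' by (auto simp: V_def U_def S_def)
    have "w = w'" if w: "w \<in> V u v" "w' \<in> V u v" for w w'
    proof -
      obtain x y x' y' where xy: "w = (x, y)" "w' = (x', y')" by (cases w; cases w')
      note 1 = eqs[of x y] and 2 = eqs[of x' y']
      have E1: "P dvd (x - x') * s + (y - y') * t"
        using cong_diff[OF 1(1) 2(1)] w unfolding xy by (simp add: cong_0_iff algebra_simps)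
      have E2: "P dvd (x - x') * s' + (y - y') * t'"
        using cong_diff[OF 1(2) 2(2)] w unfolding xy by (simp add: cong_0_iff algebra_simps)
      have det: "\<not> P dvd s * t' - s' * t"
      proof
        assume a: "P dvd s * t' - s' * t"
        have c1: "P dvd \<gamma> - (x * s + y * t)" "P dvd \<gamma> - (x * s' + y * t')"
          using 1 w(1) unfolding xy by (auto simp: cong_iff_dvd_diff dvd_diff_commute)
        have "P dvd s' * (\<gamma> - (x * s + y * t)) - s * (\<gamma> - (x * s' + y * t')) - y * (s * t' - s' * t)"
          by (rule dvd_diff[OF dvd_diff[OF dvd_mult[OF c1(1)] dvd_mult[OF c1(2)]] dvd_mult[OF a]])
        also have "\<dots> = \<gamma> * (s' - s)" by (simp add: algebra_simps)
        finally have "P dvd s' - s" using nz(3) pp by (auto simp: P_def prime_dvd_mult_iff)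
        hence "[s' = s] (mod P)" by (simp add: cong_iff_dvd_diff)
        hence ss: "s' = s" using Hrng[OF st(2)] Hrng[OF st'(2)] by (auto simp: cong_def)
        have "P dvd s * (t' - t)" using a ss by (simp add: algebra_simps)
        hence "P dvd t' - t" using Hnz[OF st(2)] pp by (auto simp: P_def prime_dvd_mult_iff)
        hence "[t' = t] (mod P)" by (simp add: cong_iff_dvd_diff)
        hence "t' = t" using Hrng[OF st(3)] Hrng[OF st'(3)] by (auto simp: cong_def)
        with ss uv st st' show False by simp
      qed
      have "P dvd t' * ((x - x') * s + (y - y') * t) - t * ((x - x') * s' + (y - y') * t')"
        by (rule dvd_diff[OF dvd_mult[OF E1] dvd_mult[OF E2]])
      also have "\<dots> = (x - x') * (s * t' - s' * t)" by (simp add: algebra_simps)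
      finally have "P dvd x - x'" using det pp by (auto simp: P_def prime_dvd_mult_iff)
      hence "[x = x'] (mod P)" by (simp add: cong_iff_dvd_diff)
      hence xx: "x = x'" using 1(3) 2(3) w unfolding xy by (auto simp: cong_def)
      have "P dvd s * ((x - x') * s' + (y - y') * t') - s' * ((x - x') * s + (y - y') * t)"
        by (rule dvd_diff[OF dvd_mult[OF E2] dvd_mult[OF E1]])
      also have "\<dots> = (y - y') * (s * t' - s' * t)" by (simp add: algebra_simps)
      finally have "P dvd y - y'" using det pp by (auto simp: P_def prime_dvd_mult_iff)
      hence "[y = y'] (mod P)" by (simp add: cong_iff_dvd_diff)
      hence "y = y'" using 1(4) 2(4) w unfolding xy by (auto simp: cong_def)
      thus ?thesis using xx xy by simp
    qed
    moreover have "finite (V u v)" using finU by (simp add: V_def)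
    ultimately show ?thesis by (metis One_nat_def card_le_Suc0_iff_eq)
  qed
  have sumV: "(\<Sum>w\<in>U. (if u \<in> S (fst w) (snd w) then 1 else 0) * (if v \<in> S (fst w) (snd w) then 1 else 0))
      = real (card (V u v))" for u v
  proof -
    have "(\<Sum>w\<in>U. (if u \<in> S (fst w) (snd w) then 1 else 0) * (if v \<in> S (fst w) (snd w) then 1 else 0))
        = (\<Sum>w\<in>U. if w \<in> V u v then 1 else (0::real))"
      by (intro sum.cong) (auto simp: V_def)
    also have "\<dots> = (\<Sum>w\<in>U \<inter> V u v. 1)" using finU by (intro sum.inter_restrict[symmetric])
    also have "U \<inter> V u v = V u v" by (auto simp: V_def)
    finally show ?thesis by simp
  qed
  have sum1: "(\<Sum>w\<in>U. f w) = e\<^sup>2 * p"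
  proof -
    have "(\<Sum>w\<in>U. f w) = (\<Sum>u\<in>H \<times> H. \<Sum>w\<in>U. if u \<in> S (fst w) (snd w) then 1 else 0)"
      unfolding f_sum by (rule sum.swap)
    also have "\<dots> = (\<Sum>u\<in>H \<times> H. real (card (V u u)))"
      unfolding sumV[symmetric] by (intro sum.cong refl) auto
    also have "\<dots> = (\<Sum>u\<in>H \<times> H. real p)" by (intro sum.cong refl) (simp add: Vdiag)
    finally show ?thesis by (simp add: card_cartesian_product e_def power2_eq_square)
  qed
  have sum2: "(\<Sum>w\<in>U. (f w)\<^sup>2) \<le> e\<^sup>2 * p + e ^ 4"
  proof -
    have "(\<Sum>w\<in>U. (f w)\<^sup>2) = (\<Sum>w\<in>U. \<Sum>u\<in>H \<times> H. \<Sum>v\<in>H \<times> H.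
        (if u \<in> S (fst w) (snd w) then 1 else 0) * (if v \<in> S (fst w) (snd w) then 1 else 0))"
      unfolding f_sum power2_eq_square sum_product ..
    also have "\<dots> = (\<Sum>u\<in>H \<times> H. \<Sum>w\<in>U. \<Sum>v\<in>H \<times> H.
        (if u \<in> S (fst w) (snd w) then 1 else 0) * (if v \<in> S (fst w) (snd w) then 1 else 0))"
      by (rule sum.swap)
    also have "\<dots> = (\<Sum>u\<in>H \<times> H. \<Sum>v\<in>H \<times> H. \<Sum>w\<in>U.
        (if u \<in> S (fst w) (snd w) then 1 else 0) * (if v \<in> S (fst w) (snd w) then 1 else 0))"
      by (intro sum.cong refl sum.swap)
    also have "\<dots> = (\<Sum>u\<in>H \<times> H. \<Sum>v\<in>H \<times> H. real (card (V u v)))" unfolding sumV ..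
    also have "\<dots> \<le> (\<Sum>u\<in>H \<times> H. \<Sum>v\<in>H \<times> H. (if v = u then real p else 0) + 1)"
    proof (intro sum_mono)
      fix u v assume "u \<in> H \<times> H" "v \<in> H \<times> H"
      thus "real (card (V u v)) \<le> (if v = u then real p else 0) + 1"
        using Vdiag[of u] Voff[of u v] by (cases "v = u") auto
    qed
    also have "\<dots> = (\<Sum>u\<in>H \<times> H. real p + real (card (H \<times> H)))"
      using finH by (intro sum.cong refl) (simp add: sum.distrib sum.delta')
    also have "\<dots> = e\<^sup>2 * p + e ^ 4"
      by (simp add: card_cartesian_product e_def power2_eq_square power4_eq_xxxx algebra_simps)
    finally show ?thesis .
  qed
  have cU: "real (card U) = (real p)\<^sup>2" by (simp add: U_def card_cartesian_product P_def power2_eq_square)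
  \<comment> \<open>Here \<open>\<mu>\<close> is the exact mean of \<open>f\<close> over
    \<open>U\<close>, so the fourth power of \<open>e\<close> in the second moment cancels.\<close>
  have var: "(\<Sum>w\<in>U. (f w - \<mu>)\<^sup>2) \<le> e\<^sup>2 * p"
  proof -
    have "(\<Sum>w\<in>U. (f w - \<mu>)\<^sup>2) = (\<Sum>w\<in>U. (f w)\<^sup>2 - 2 * \<mu> * f w + \<mu>\<^sup>2)"
      by (intro sum.cong refl) (simp add: power2_diff)
    also have "\<dots> = (\<Sum>w\<in>U. (f w)\<^sup>2) - 2 * \<mu> * (\<Sum>w\<in>U. f w) + real (card U) * \<mu>\<^sup>2"
      by (simp add: sum.distrib sum_subtractf sum_distrib_left)
    also have "\<dots> = (\<Sum>w\<in>U. (f w)\<^sup>2) - e ^ 4"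
      unfolding sum1 cU \<mu>_def using p1 by (simp add: power2_eq_square power4_eq_xxxx field_simps)
    finally show ?thesis using sum2 by linarith
  qed
  define f0 where "f0 = real (card (S \<alpha> \<beta>))"
  have mulbij: "(\<lambda>s. (h * s) mod P) ` H = H" if h: "h \<in> H" for h
  proof (rule endo_inj_surj[OF finH])
    show "(\<lambda>s. (h * s) mod P) ` H \<subseteq> H"
      using mult_in_roots_unity_mod[of "int p" h d] h p1 unfolding H_def P_def by auto
    show "inj_on (\<lambda>s. (h * s) mod P) H"
    proof (rule inj_onI)
      fix s s' assume s: "s \<in> H" "s' \<in> H" "(h * s) mod P = (h * s') mod P"
      have "P dvd h * (s - s')" using s(3) by (simp add: mod_eq_dvd_iff algebra_simps)
      hence "P dvd s - s'" using Hnz[OF h] pp by (auto simp: P_def prime_dvd_mult_iff)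
      hence "[s = s'] (mod P)" by (simp add: cong_iff_dvd_diff)
      thus "s = s'" using Hrng[OF s(1)] Hrng[OF s(2)] by (auto simp: cong_def)
    qed
  qed
  define orb where "orb = (\<lambda>(h, h'). ((\<alpha> * h) mod P, (\<beta> * h') mod P))"
  have orbU: "orb ` (H \<times> H) \<subseteq> U" using p1 by (auto simp: orb_def U_def P_def)
  have cancel: "h = k" if "h \<in> H" "k \<in> H" "\<not> P dvd a" "(a * h) mod P = (a * k) mod P" for a h k
  proof -
    have "P dvd a * (h - k)" using that(4) by (simp add: mod_eq_dvd_iff algebra_simps)
    hence "P dvd h - k" using that(3) pp by (auto simp: P_def prime_dvd_mult_iff)
    hence "[h = k] (mod P)" by (simp add: cong_iff_dvd_diff)
    thus "h = k" using Hrng[OF that(1)] Hrng[OF that(2)] by (auto simp: cong_def)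
  qed
  have orbinj: "inj_on orb (H \<times> H)"
    using cancel nz unfolding orb_def P_def by (auto intro!: inj_onI)
  \<comment> \<open>Substituting \<open>s = h * s'\<close> and \<open>t = h' * t'\<close> turns
    solutions for the original coefficients into solutions for the scaled ones.\<close>
  have orbf: "f0 \<le> f (orb w)" if w: "w \<in> H \<times> H" for w
  proof -
    obtain h h' where h: "w = (h, h')" "h \<in> H" "h' \<in> H" using w by auto
    define x y where "x = (\<alpha> * h) mod P" and "y = (\<beta> * h') mod P"
    have "S \<alpha> \<beta> \<subseteq> (\<lambda>(s, t). ((h * s) mod P, (h' * t) mod P)) ` S x y"
    proof
      fix v assume "v \<in> S \<alpha> \<beta>"
      then obtain s t where v: "v = (s, t)" "s \<in> H" "t \<in> H" "[\<alpha> * s + \<beta> * t = \<gamma>] (mod P)"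
        by (auto simp: S_def)
      obtain s' where s': "s' \<in> H" "s = (h * s') mod P" using mulbij[OF h(2)] v(2) by blast
      obtain t' where t': "t' \<in> H" "t = (h' * t') mod P" using mulbij[OF h(3)] v(3) by blast
      have "[x * s' + y * t' = (\<alpha> * h) * s' + (\<beta> * h') * t'] (mod P)"
        unfolding x_def y_def by (intro cong_add cong_mult cong_refl) (simp_all add: cong_def)
      also have "(\<alpha> * h) * s' + (\<beta> * h') * t' = \<alpha> * (h * s') + \<beta> * (h' * t')" by simp
      also have "[\<alpha> * (h * s') + \<beta> * (h' * t') = \<alpha> * s + \<beta> * t] (mod P)"
        unfolding s' t' by (intro cong_add cong_mult cong_refl) (simp_all add: cong_def)
      also note v(4)
      finally have "(s', t') \<in> S x y" using s' t' by (simp add: S_def)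
      thus "v \<in> (\<lambda>(s, t). ((h * s) mod P, (h' * t) mod P)) ` S x y"
        by (rule rev_image_eqI) (simp add: v s' t')
    qed
    hence "card (S \<alpha> \<beta>) \<le> card ((\<lambda>(s, t). ((h * s) mod P, (h' * t) mod P)) ` S x y)"
      using finS by (intro card_mono) auto
    also have "\<dots> \<le> card (S x y)" by (intro card_image_le finS)
    finally show ?thesis by (simp add: f0_def f_def orb_def h x_def y_def)
  qed
  have "f0 - \<mu> \<le> sqrt p"
  proof (cases "f0 \<le> \<mu>")
    case False
    have "e\<^sup>2 * (f0 - \<mu>)\<^sup>2 = (\<Sum>w\<in>H \<times> H. (f0 - \<mu>)\<^sup>2)"
      by (simp add: card_cartesian_product e_def power2_eq_square)
    \<comment> \<open>The same deviation occurs at \<open>e ^ 2\<close> different points of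
      \<open>U\<close>, while the total variance is at most \<open>e ^ 2 * p\<close>.\<close>
    also have "\<dots> \<le> (\<Sum>w\<in>H \<times> H. (f (orb w) - \<mu>)\<^sup>2)"
      using False orbf by (intro sum_mono power_mono) auto
    also have "\<dots> = (\<Sum>w\<in>orb ` (H \<times> H). (f w - \<mu>)\<^sup>2)"
      by (simp add: sum.reindex[OF orbinj])
    also have "\<dots> \<le> (\<Sum>w\<in>U. (f w - \<mu>)\<^sup>2)" using finU orbU by (intro sum_mono2) auto
    also note var
    finally have "(f0 - \<mu>)\<^sup>2 \<le> real p" using e0 by simp
    thus ?thesis by (rule real_le_rsqrt)
  next
    case True
    have "0 \<le> sqrt (real p)" by simp
    with True show ?thesis by linarith
  qed
  moreover have "\<mu> \<le> (real d)\<^sup>2 / p"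
    unfolding \<mu>_def e_def H_def using card_roots_unity_mod_le[OF p d]
    by (intro divide_right_mono power_mono) auto
  ultimately show ?thesis unfolding f0_def S_def P_def by linarith
qed

section \<open>Three points of a progression, for d near p to the power 2/3\<close>

context coset_in_interval
begin

text \<open>Three points \<open>x1\<close>, \<open>x2\<close>, \<open>x3\<close> at fixed positions
  of a progression satisfy a linear relation that does not depend on \<open>a\<close> and
  \<open>y\<close>. Dividing by \<open>x2\<close> gives a linear equation in two roots of unity,
  with few solutions. Its first component is the ratio of \<open>x1\<close> and \<open>x2\<close>,
  and these two points recover \<open>(a, y)\<close>, so the overlaps of the occurring ratios are
  summed.\<close>

lemma card_progressions_le:
  fixes M b1 b2 b3 :: int
  assumes N2: "N\<^sup>2 \<le> int p" and b: "b1 \<in> {0..<int p}" "b2 \<in> {0..<int p}" "b3 \<in> {0..<int p}"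
    and dist: "b1 \<noteq> b2" "b1 \<noteq> b3" "b2 \<noteq> b3"
  defines "G \<equiv> {(a, y). a \<in> {1..M} \<and> y + a * b1 \<in> A \<and> y + a * b2 \<in> A \<and> y + a * b3 \<in> A}"
  shows "finite G"
    and "real (card G) \<le> 13 * ((real d)\<^sup>2 / p + sqrt p) + 3 * real_of_int N * lam_inv_sum p d"
proof -
  define \<alpha> \<beta> \<gamma> where "\<alpha> = b3 - b2" and "\<beta> = b2 - b1" and "\<gamma> = b3 - b1"
  define W where "W = {(s, t). s \<in> H \<and> t \<in> H \<and> [\<alpha> * s + \<beta> * t = \<gamma>] (mod int p)}"
  have ndvd: "\<not> int p dvd x - y" if "x \<in> {0..<int p}" "y \<in> {0..<int p}" "x \<noteq> y" for x y
    using that dvd_imp_le_int[of "x - y" "int p"] by auto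
  have cW: "real (card W) \<le> (real d)\<^sup>2 / p + sqrt p"
    unfolding W_def \<alpha>_def \<beta>_def \<gamma>_def using dist
    by (intro card_linear_solutions_le[OF prime_p d_pos] ndvd b) simp_all
  have finW: "finite W" by (rule finite_subset[of _ "H \<times> H"]) (auto simp: W_def)
  define g where "g = (\<lambda>(a, y). (y + a * b1, y + a * b2))"
  have inj: "inj_on g G"
  proof (rule inj_onI)
    fix u v assume uv: "u \<in> G" "v \<in> G" "g u = g v"
    obtain a y a' y' where e: "u = (a, y)" "v = (a', y')" by (cases u; cases v)
    have 1: "y + a * b1 = y' + a' * b1" "y + a * b2 = y' + a' * b2" using uv(3) by (auto simp: e g_def)
    hence "(a - a') * (b1 - b2) = 0" by (simp add: algebra_simps)
    hence "a = a'" using dist by simp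
    thus "u = v" using 1 e by simp
  qed
  have img: "g ` G \<subseteq> (\<Union>s\<in>fst ` W. ratio_pairs A s)"
  proof
    fix w assume "w \<in> g ` G"
    then obtain a y where ay: "(a, y) \<in> G" "w = g (a, y)" by auto
    define x1 x2 x3 where "x1 = y + a * b1" and "x2 = y + a * b2" and "x3 = y + a * b3"
    have x: "x1 \<in> A" "x2 \<in> A" "x3 \<in> A" using ay by (auto simp: G_def x1_def x2_def x3_def)
    obtain s where s: "s \<in> H" "[x1 = s * x2] (mod int p)"
      by (rule ratio_in_roots_unity_mod[OF prime_int_p coprime_l d_pos A_root[OF x(1)] A_root[OF x(2)]])
    obtain t where t: "t \<in> H" "[x3 = t * x2] (mod int p)"
      by (rule ratio_in_roots_unity_mod[OF prime_int_p coprime_l d_pos A_root[OF x(3)] A_root[OF x(2)]])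
    have nz: "\<not> [x2 = 0] (mod int p)"
      by (rule not_cong_0_of_power_cong[OF prime_int_p coprime_l d_pos A_root[OF x(2)]])
    have "[\<alpha> * (s * x2) + \<beta> * (t * x2) = \<alpha> * x1 + \<beta> * x3] (mod int p)"
      by (intro cong_add cong_mult cong_refl cong_sym[OF s(2)] cong_sym[OF t(2)])
    moreover have "\<alpha> * x1 + \<beta> * x3 = \<gamma> * x2"
      by (simp add: \<alpha>_def \<beta>_def \<gamma>_def x1_def x2_def x3_def algebra_simps)
    ultimately have "[(\<alpha> * s + \<beta> * t) * x2 = \<gamma> * x2] (mod int p)" by (simp add: algebra_simps)
    hence "[\<alpha> * s + \<beta> * t = \<gamma>] (mod int p)" by (rule prime_cong_mult_cancel[OF prime_int_p _ nz])
    hence "(s, t) \<in> W" using s t by (simp add: W_def)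
    hence "s \<in> fst ` W" by force
    moreover have "w \<in> ratio_pairs A s" using x s by (simp add: ay g_def ratio_pairs_def x1_def x2_def)
    ultimately show "w \<in> (\<Union>s\<in>fst ` W. ratio_pairs A s)" by blast
  qed
  have finUn: "finite (\<Union>s\<in>fst ` W. ratio_pairs A s)" using finW finite_ratio_pairs[of A] by auto
  show "finite G" using finite_subset[OF img finUn] inj by (rule finite_imageD)
  have "card G \<le> card (\<Union>s\<in>fst ` W. ratio_pairs A s)" by (rule card_inj_on_le[OF inj img finUn])
  also have "\<dots> \<le> (\<Sum>s\<in>fst ` W. card (ratio_pairs A s))" using finW by (intro card_UN_le) auto
  finally have "real (card G) \<le> real (\<Sum>s\<in>fst ` W. card (ratio_pairs A s))" by (simp only: of_nat_le_iff)
  also have "\<dots> = (\<Sum>s\<in>fst ` W. real (card (overlap A s)))" by (simp add: card_ratio_pairs_eq)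
  also have "\<dots> \<le> (\<Sum>s\<in>fst ` W. 13 + 3 * N * (1 / lam p s))"
  proof (rule sum_mono)
    fix s
    have "real_of_int (N\<^sup>2) \<le> real_of_int (int p)" using N2 by (simp only: of_int_le_iff)
    hence "12 * real_of_int N ^ 2 / p \<le> 12" using p_gt_1 by (simp add: divide_le_eq)
    thus "real (card (overlap A s)) \<le> 13 + 3 * N * (1 / lam p s)" using card_overlap_le[of s] by linarith
  qed
  also have "\<dots> = 13 * real (card (fst ` W)) + (3 * real_of_int N) * (\<Sum>s\<in>fst ` W. 1 / real (lam p s))"
    by (simp add: sum.distrib sum_distrib_left)
  also have "\<dots> \<le> 13 * ((real d)\<^sup>2 / p + sqrt p) + (3 * real_of_int N) * lam_inv_sum p d"
  proof (intro add_mono mult_left_mono)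
    have "card (fst ` W) \<le> card W" by (intro card_image_le finW)
    thus "real (card (fst ` W)) \<le> (real d)\<^sup>2 / p + sqrt p" using cW by linarith
    show "(\<Sum>s\<in>fst ` W. 1 / real (lam p s)) \<le> lam_inv_sum p d"
      unfolding lam_inv_sum_def by (intro sum_mono2) (auto simp: W_def)
  qed (use N_pos in auto)
  finally show "real (card G) \<le> 13 * ((real d)\<^sup>2 / p + sqrt p) + 3 * real_of_int N * lam_inv_sum p d" by simp
qed

text \<open>Double counting of progressions with step \<open>a <= M\<close> and start
  \<open>y\<close>, together with three distinct positions below \<open>B\<close> at which they hit
  \<open>A\<close>. For each step there are at least \<open>B * card A\<close> hits but at most
  \<open>2 * N\<close> starts, so many triples occur. Each of the at most \<open>B ^ 3\<close>
  position triples is bounded by the previous lemma.\<close>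

lemma progression_count:
  fixes M B :: nat
  assumes N2: "N\<^sup>2 \<le> int p" and B: "B > 0" "B \<le> p" and MB: "int (M * B) \<le> N"
    and BT: "16 * N \<le> int (B * card A)"
  shows "2 * real M * real (card A)
    \<le> (real B)\<^sup>2 * (13 * ((real d)\<^sup>2 / p + sqrt p) + 3 * real_of_int N * lam_inv_sum p d)"
proof -
  define F where "F = 13 * ((real d)\<^sup>2 / p + sqrt p) + 3 * real_of_int N * lam_inv_sum p d"
  \<comment> \<open>The interval is extended downwards by \<open>M * B\<close> so that
    \<open>x - a * b\<close> always stays inside.\<close>
  define Y where "Y = {z - int (M * B)..<z + N}"
  define C where "C = (\<lambda>(a, y). {b \<in> {0..<int B}. y + a * b \<in> A})"
  define triples where "triples X = (SIGMA b1:X. SIGMA b2:X - {b1}. X - {b1, b2})" for X :: "int set"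
  define W where "W = (SIGMA u:{1..int M} \<times> Y. triples (C u))"
  have finC: "finite (C u)" for u
    by (rule finite_subset[of _ "{0..<int B}"]) (auto simp: C_def split: prod.splits)
  have fintr: "finite (triples X)" if "finite X" for X using that by (auto simp: triples_def)
  \<comment> \<open>A linear minorant of \<open>c * (c - 1) * (c - 2)\<close>, which can be summed
    over the starts directly.\<close>
  have card_tr: "int (card (triples X)) \<ge> 4 * (int (card X) - 4)" if X: "finite X" for X
  proof -
    define c where "c = card X"
    have "card (triples X) = (\<Sum>b1\<in>X. \<Sum>b2\<in>X - {b1}. card (X - {b1, b2}))"
      unfolding triples_def using X by (simp add: card_SigmaI)
    also have "\<dots> = (\<Sum>b1\<in>X. \<Sum>b2\<in>X - {b1}. c - 2)"
    proof (intro sum.cong refl)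
      fix b1 b2 assume "b1 \<in> X" "b2 \<in> X - {b1}"
      thus "card (X - {b1, b2}) = c - 2" using X by (subst card_Diff_subset) (auto simp: c_def)
    qed
    also have "\<dots> = c * ((c - 1) * (c - 2))" using X by (simp add: c_def)
    finally have eq: "card (triples X) = c * ((c - 1) * (c - 2))" .
    show ?thesis
    proof (cases "c \<ge> 4")
      case True
      have "3 * 2 \<le> (c - 1) * (c - 2)" using True by (intro mult_le_mono) auto
      hence "c * (3 * 2) \<le> card (triples X)" unfolding eq by (intro mult_le_mono2)
      hence "6 * int c \<le> int (card (triples X))" by linarith
      moreover have "4 * (int c - 4) \<le> 6 * int c" by simp
      ultimately show ?thesis unfolding c_def by (rule order_trans[rotated])
    next
      case False
      hence "4 * (int c - 4) \<le> 0" by simp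
      moreover have "0 \<le> int (card (triples X))" by simp
      ultimately show ?thesis unfolding c_def by (rule order_trans)
    qed
  qed
  have cY: "int (card Y) \<le> 2 * N" unfolding Y_def using MB N_pos by simp
  have each: "int (\<Sum>y\<in>Y. card (triples (C (a, y)))) \<ge> 2 * int (B * card A)" if a: "a \<in> {1..int M}" for a
  proof -
    have "int (card ({0..<int B} \<times> A)) \<le> int (card (SIGMA y:Y. C (a, y)))"
    proof -
      have "inj_on (\<lambda>(b, x). (x - a * b, b)) ({0..<int B} \<times> A)" by (auto simp: inj_on_def)
      moreover have "(\<lambda>(b, x). (x - a * b, b)) ` ({0..<int B} \<times> A) \<subseteq> (SIGMA y:Y. C (a, y))"
      proof clarify
        fix b x assume b: "b \<in> {0..<int B}" and x: "x \<in> A"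
        have "a * b \<le> int M * int B" "0 \<le> a * b" using a b by (auto intro!: mult_mono)
        moreover have "z \<le> x" "x < z + N" using x A_sub by auto
        ultimately have "x - a * b \<in> Y" unfolding Y_def by simp
        thus "x - a * b \<in> Y \<and> b \<in> C (a, x - a * b)" using b x by (simp add: C_def)
      qed
      moreover have "finite (SIGMA y:Y. C (a, y))" using finC by (auto simp: Y_def)
      ultimately have "card ({0..<int B} \<times> A) \<le> card (SIGMA y:Y. C (a, y))" by (rule card_inj_on_le)
      thus ?thesis by simp
    qed
    also have "card (SIGMA y:Y. C (a, y)) = (\<Sum>y\<in>Y. card (C (a, y)))"
      using finC by (subst card_SigmaI) (auto simp: Y_def)
    finally have sumc: "int (B * card A) \<le> (\<Sum>y\<in>Y. int (card (C (a, y))))"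
      by (simp add: card_cartesian_product)
    have "int (\<Sum>y\<in>Y. card (triples (C (a, y)))) = (\<Sum>y\<in>Y. int (card (triples (C (a, y)))))" by simp
    also have "\<dots> \<ge> (\<Sum>y\<in>Y. 4 * (int (card (C (a, y))) - 4))" by (intro sum_mono card_tr finC)
    also have "(\<Sum>y\<in>Y. 4 * (int (card (C (a, y))) - 4)) = 4 * (\<Sum>y\<in>Y. int (card (C (a, y)))) - 16 * int (card Y)"
      by (simp add: sum_subtractf sum_distrib_left right_diff_distrib)
    \<comment> \<open>The loss is at most \<open>32 * N\<close>, and \<open>BT\<close> makes this at
      most half of \<open>4 * B * card A\<close>.\<close>
    finally show ?thesis using sumc cY BT by linarith
  qed
  have finY: "finite Y" by (simp add: Y_def)
  have "int M * (2 * int (B * card A)) = (\<Sum>a\<in>{1..int M}. 2 * int (B * card A))" by simp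
  also have "\<dots> \<le> (\<Sum>a\<in>{1..int M}. int (\<Sum>y\<in>Y. card (triples (C (a, y)))))" by (intro sum_mono each)
  also have "\<dots> = int (\<Sum>a\<in>{1..int M}. \<Sum>y\<in>Y. card (triples (C (a, y))))" by simp
  also have "(\<Sum>a\<in>{1..int M}. \<Sum>y\<in>Y. card (triples (C (a, y)))) = card W"
    unfolding W_def using finY fintr[OF finC] by (simp add: card_SigmaI sum.cartesian_product)
  finally have low: "int M * (2 * int (B * card A)) \<le> int (card W)" .
  define G where "G b1 b2 b3 = {(a, y). a \<in> {1..int M} \<and> y + a * b1 \<in> A \<and> y + a * b2 \<in> A \<and> y + a * b3 \<in> A}"
    for b1 b2 b3 :: int
  define I where "I = {0..<int B}"
  define T3 where "T3 = triples I"
  have Gb: "finite (G b1 b2 b3)" "real (card (G b1 b2 b3)) \<le> F" if "(b1, b2, b3) \<in> T3" for b1 b2 b3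
  proof -
    have b: "b1 \<in> {0..<int p}" "b2 \<in> {0..<int p}" "b3 \<in> {0..<int p}" "b1 \<noteq> b2" "b1 \<noteq> b3" "b2 \<noteq> b3"
      using that B by (auto simp: T3_def triples_def I_def)
    show "finite (G b1 b2 b3)" "real (card (G b1 b2 b3)) \<le> F"
      unfolding G_def F_def using card_progressions_le[OF N2 b, of "int M"] by simp_all
  qed
  define K where "K = (SIGMA t:T3. case t of (b1, b2, b3) \<Rightarrow> G b1 b2 b3)"
  have finT3: "finite T3" unfolding T3_def by (rule fintr) (simp add: I_def)
  have finK: "finite K" unfolding K_def using finT3 Gb(1) by (intro finite_SigmaI) auto
  have "card W \<le> card K"
  proof (rule card_inj_on_le[OF _ _ finK])
    show "inj_on prod.swap W" by simp
    show "prod.swap ` W \<subseteq> K"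
      unfolding W_def K_def T3_def I_def triples_def C_def G_def by auto
  qed
  also have "card K = (\<Sum>t\<in>T3. card (case t of (b1, b2, b3) \<Rightarrow> G b1 b2 b3))"
    unfolding K_def using finT3 Gb(1) by (intro card_SigmaI) auto
  finally have "real (card W) \<le> real (\<Sum>t\<in>T3. card (case t of (b1, b2, b3) \<Rightarrow> G b1 b2 b3))"
    by (simp only: of_nat_le_iff)
  also have "\<dots> = (\<Sum>t\<in>T3. real (card (case t of (b1, b2, b3) \<Rightarrow> G b1 b2 b3)))" by simp
  also have "\<dots> \<le> (\<Sum>t\<in>T3. F)" using Gb(2) by (intro sum_mono) auto
  also have "\<dots> = real (card T3) * F" by simp
  also have "\<dots> \<le> real B ^ 3 * F"
  proof (rule mult_right_mono)
    have "card T3 \<le> card (I \<times> I \<times> I)"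
      unfolding T3_def triples_def by (intro card_mono) (auto simp: I_def)
    also have "\<dots> = B ^ 3" by (simp add: I_def card_cartesian_product power3_eq_cube)
    finally show "real (card T3) \<le> real B ^ 3" by (metis of_nat_le_iff of_nat_power)
    show "0 \<le> F" unfolding F_def using N_pos lam_inv_sum_nonneg[of p d] by simp
  qed
  finally have "real (card W) \<le> real B ^ 3 * F" .
  moreover have "real_of_int (int M * (2 * int (B * card A))) \<le> real_of_int (int (card W))"
    using low by (simp only: of_int_le_iff)
  ultimately have "real B * (2 * real M * real (card A)) \<le> real B * ((real B)\<^sup>2 * F)"
    by (simp add: power3_eq_cube power2_eq_square algebra_simps)
  thus ?thesis using B(1) unfolding F_def by simp
qed

end

section \<open>The ranges of the exponent\<close>

text \<open>Here \<open>q\<close> is the cube root of \<open>p\<close>. With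
  \<open>f = d / q\<close> the fourth power of \<open>E\<close> is \<open>f ^ 3\<close>, so
  \<open>f / E\<close> is the fourth root of \<open>f\<close> and at least \<open>x ^ 4\<close>.
  Hence \<open>N * f <= q ^ 2\<close> yields \<open>N * E * x ^ 4 <= q ^ 2\<close>. The four terms
  then have total weight \<open>1 + 12 + 3 + 3 = 19\<close>, less than \<open>x\<close>.\<close>

lemma middle_range_numeric:
  fixes T d N S E q x :: real
  assumes T: "T\<^sup>2 \<le> d + 12 * N + 3 * N * S" and S: "S \<le> x * (1 + E)" and E: "E > 0" "E ^ 4 * q ^ 3 = d ^ 3"
    and N: "N \<ge> 0" "N * d \<le> q ^ 3" and pos: "q > 0" "d > 0" and x: "x \<ge> 20"
    and lo: "q * x ^ 16 \<le> d" and hi: "d * x ^ 3 \<le> q\<^sup>2"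
  shows "T < q / x"
proof -
  define f where "f = d / q"
  define g where "g = f / E"
  have f0: "f > 0" unfolding f_def using pos by simp
  have g0: "g > 0" unfolding g_def using f0 E by simp
  have d_eq: "d = f * q" unfolding f_def using pos by simp
  have "(E ^ 4 - f ^ 3) * q ^ 3 = 0" using E(2) unfolding d_eq by (simp add: power_mult_distrib algebra_simps)
  hence E4: "E ^ 4 = f ^ 3" using pos by simp
  have "g ^ 4 = f ^ 4 / f ^ 3" unfolding g_def by (simp add: power_divide E4)
  also have "\<dots> = f" using f0 by (simp add: power4_eq_xxxx power3_eq_cube)
  finally have g4: "g ^ 4 = f" .
  have xf: "x ^ 16 \<le> f" using lo pos unfolding f_def by (simp add: field_simps)
  hence "(x ^ 4) ^ 4 \<le> g ^ 4" unfolding g4 by (simp flip: power_mult)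
  hence xg: "x ^ 4 \<le> g" using g0 power_mono_iff[of "x ^ 4" g 4] by simp
  have "(N * f - q\<^sup>2) * q \<le> 0" using N(2) unfolding d_eq
    by (simp add: algebra_simps power2_eq_square power3_eq_cube)
  hence Nf: "N * f \<le> q\<^sup>2" using pos by (simp add: mult_le_0_iff)
  have x0: "x > 0" using x by simp
  have N1: "N * x ^ 16 \<le> q\<^sup>2" using mult_left_mono[OF xf N(1)] Nf by linarith
  have "N * E * x ^ 4 \<le> N * E * g" using xg N E by (intro mult_left_mono) auto
  also have "\<dots> = N * f" unfolding g_def using E by simp
  finally have NE: "N * E * x ^ 4 \<le> q\<^sup>2" using Nf by linarith
  have "T\<^sup>2 \<le> d + 12 * N + 3 * N * (x * (1 + E))"
    using T mult_left_mono[OF S, of "3 * N"] N by linarith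
  hence "T\<^sup>2 * x ^ 3 \<le> (d + 12 * N + 3 * N * (x * (1 + E))) * x ^ 3"
    using x0 by (intro mult_right_mono) auto
  also have "\<dots> = d * x ^ 3 + 12 * (N * x ^ 3) + 3 * (N * x ^ 4) + 3 * (N * E * x ^ 4)"
    by (simp add: algebra_simps power3_eq_cube power4_eq_xxxx)
  also have "N * x ^ 3 \<le> N * x ^ 16" using N x by (intro mult_left_mono power_increasing) auto
  also have "N * x ^ 4 \<le> N * x ^ 16" using N x by (intro mult_left_mono power_increasing) auto
  finally have "T\<^sup>2 * x ^ 3 \<le> 19 * q\<^sup>2" using hi N1 NE by linarith
  also have "19 * q\<^sup>2 < x * q\<^sup>2" using x pos by (intro mult_strict_right_mono) auto
  finally have "x * (T * x)\<^sup>2 < x * q\<^sup>2" by (simp add: power2_eq_square power3_eq_cube algebra_simps)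
  hence "(T * x)\<^sup>2 < q\<^sup>2" using x0 by simp
  hence "T * x < q" using pos power2_less_imp_less[of "T * x" q] by simp
  thus ?thesis using x0 by (simp add: field_simps)
qed

section \<open>Contradictions at the two critical sizes of d\<close>

context coset_in_interval
begin

lemma card_A_le_N: "int (card A) \<le> N"
  using card_mono[OF _ A_sub] N_pos by simp

lemma card_A_le_d: "card A \<le> d"
proof (cases "A = {}")
  case False
  then obtain y where y: "y \<in> A" by blast
  have "\<forall>x\<in>A. \<exists>r. r \<in> H \<and> [x = r * y] (mod int p)"
    using ratio_in_roots_unity_mod[OF prime_int_p coprime_l d_pos _ A_root[OF y]] A_root by metis
  then obtain g where g: "\<And>x. x \<in> A \<Longrightarrow> g x \<in> H" "\<And>x. x \<in> A \<Longrightarrow> [x = g x * y] (mod int p)" by metis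
  have "inj_on g A"
  proof (rule inj_onI)
    fix x x' assume x: "x \<in> A" "x' \<in> A" "g x = g x'"
    have "[x = x'] (mod int p)" using g(2)[OF x(1)] g(2)[OF x(2)] x(3) cong_sym cong_trans by metis
    thus "x = x'" using cong_A_imp_eq x by blast
  qed
  moreover have "g ` A \<subseteq> H" using g by blast
  ultimately have "card A \<le> card H" by (rule card_inj_on_le) simp
  thus ?thesis using card_roots_unity_mod_le[OF prime_p d_pos] by linarith
qed simp

lemma N_mult_d_le: "real_of_int N * real d \<le> real p"
proof -
  have "real_of_int (N * int d) \<le> real_of_int (int p)" using N_le by (simp only: of_int_le_iff)
  thus ?thesis by simp
qed

text \<open>Here \<open>y\<close> is the twelfth root of \<open>p\<close>. Up to powers of
  \<open>x\<close>, the hypotheses pin \<open>N\<close> and \<open>card A\<close> to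
  \<open>y ^ 4\<close>, and \<open>d\<close> to \<open>y ^ 8\<close>. Counting progressions gives
  \<open>n * t\<close> at most \<open>y ^ 7\<close> times a power of \<open>x\<close>, whereas
  \<open>n * t >= t ^ 2\<close> is about \<open>y ^ 8\<close>.\<close>

lemma large_index_contradiction:
  fixes x y E :: real
  assumes p_eq: "real p = y ^ 12" and x: "x \<ge> 1000000" "x ^ 21 \<le> y"
    and S: "lam_inv_sum p d \<le> x * (1 + E)" and E: "E > 0" "E ^ 4 * y ^ 12 = real d ^ 3"
    and T: "y ^ 4 / x \<le> card A" and d: "y ^ 8 \<le> real d * x ^ 3"
  shows False
proof -
  define n where "n = real_of_int N"
  define t where "t = real (card A)"
  have x1: "x \<ge> 1" "x > 0" using x(1) by auto
  have y0: "y > 0" using x(2) x1 by (meson less_le_trans zero_less_power)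
  have xy: "x ^ k \<le> y" if "k \<le> 21" for k
    using power_increasing[OF that x1(1)] x(2) by linarith
  have n0: "n \<ge> 1" using N_pos by (simp add: n_def)
  have nd: "n * real d \<le> y ^ 12" using N_mult_d_le unfolding n_def p_eq .
  have tn: "t \<le> n"
  proof -
    have "real_of_int (int (card A)) \<le> real_of_int N" using card_A_le_N by (simp only: of_int_le_iff)
    thus ?thesis by (simp add: t_def n_def)
  qed
  have t1: "y ^ 4 \<le> t * x" using T x1 by (simp add: t_def field_simps)
  have t0: "t > 0"
  proof -
    have "0 < y ^ 4 / x" using y0 x1 by simp
    thus ?thesis using T unfolding t_def by linarith
  qed
  have "n * y ^ 8 \<le> n * (real d * x ^ 3)" using d n0 by (intro mult_left_mono) auto
  also have "\<dots> = (n * real d) * x ^ 3" by simp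
  also have "\<dots> \<le> y ^ 12 * x ^ 3" using nd x1 by (intro mult_right_mono) auto
  also have "\<dots> = y ^ 4 * x ^ 3 * y ^ 8" by (simp flip: power_add add: mult.commute mult.left_commute)
  finally have n_le: "n \<le> y ^ 4 * x ^ 3" using y0 by simp
  have "real d * y ^ 4 \<le> real d * (t * x)" using t1 by (intro mult_left_mono) auto
  also have "\<dots> \<le> real d * (n * x)" using tn x1 by (intro mult_left_mono mult_right_mono) auto
  also have "\<dots> = (n * real d) * x" by simp
  also have "\<dots> \<le> y ^ 12 * x" using nd x1 by (intro mult_right_mono) auto
  also have "\<dots> = y ^ 8 * x * y ^ 4" by (simp flip: power_add add: mult.commute mult.left_commute)
  finally have d_le: "real d \<le> y ^ 8 * x" using y0 by simp
  have "E ^ 4 * y ^ 12 \<le> (y ^ 8 * x) ^ 3" unfolding E(2) using d_le by (intro power_mono) auto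
  also have "\<dots> = (y ^ 12 * x ^ 3) * y ^ 12" by (simp add: power_mult_distrib flip: power_add power_mult)
  finally have "E ^ 4 \<le> y ^ 12 * x ^ 3" using y0 by (simp add: mult.commute)
  also have "\<dots> \<le> y ^ 12 * x ^ 4" using x1 y0 by (intro mult_left_mono power_increasing) auto
  also have "\<dots> = (y ^ 3 * x) ^ 4" by (simp add: power_mult_distrib flip: power_mult)
  finally have E_le: "E \<le> y ^ 3 * x" using E(1) y0 x1 power_mono_iff[of E "y ^ 3 * x" 4] by simp
  have one_le: "1 \<le> y ^ 3 * x" using xy[of 0] x1 mult_mono[of 1 "y ^ 3" 1 x] one_le_power[of y 3] by simp
  have S_le: "lam_inv_sum p d \<le> 2 * y ^ 3 * x\<^sup>2"
  proof -
    have "x * (1 + E) \<le> x * (2 * (y ^ 3 * x))" using E_le one_le x1 by (intro mult_left_mono) auto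
    thus ?thesis using S by (simp add: power2_eq_square algebra_simps)
  qed
  have N2: "N\<^sup>2 \<le> int p"
  proof -
    have "n\<^sup>2 \<le> (y ^ 4 * x ^ 3)\<^sup>2" using n_le n0 by (intro power_mono) auto
    also have "\<dots> = y ^ 8 * x ^ 6" by (simp add: power_mult_distrib flip: power_mult)
    also have "\<dots> \<le> y ^ 8 * y ^ 4"
    proof (rule mult_left_mono)
      have "y ^ 1 \<le> y ^ 4" using xy[of 0] by (intro power_increasing) auto
      thus "x ^ 6 \<le> y ^ 4" using xy[of 6] by simp
    qed (use y0 in simp)
    also have "\<dots> = real p" unfolding p_eq by (simp flip: power_add)
    finally have "real_of_int (N\<^sup>2) \<le> real_of_int (int p)" by (simp add: n_def)
    thus ?thesis by (simp only: of_int_le_iff)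
  qed
  \<comment> \<open>The least number of positions that meets the density requirement of
    \<open>progression_count\<close>.\<close>
  define B where "B = nat \<lceil>16 * n / t\<rceil>"
  have nt: "16 * n / t \<le> 16 * x ^ 4"
  proof -
    have "n * y ^ 4 \<le> (y ^ 4 * x ^ 3) * (t * x)" using n_le t1 n0 y0 x1 by (intro mult_mono) auto
    also have "\<dots> = (x ^ 4 * t) * y ^ 4" by (simp add: power4_eq_xxxx power3_eq_cube)
    finally have "n \<le> x ^ 4 * t" using y0 by simp
    thus ?thesis using t0 by (simp add: field_simps)
  qed
  have q0: "16 * n / t > 0" using n0 t0 by simp
  have B_lo: "16 * n / t \<le> real B" and B_hi: "real B \<le> 16 * n / t + 1"
    using q0 unfolding B_def by simp_all
  have B0: "B > 0" using B_lo q0 by (intro Nat.gr0I) auto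
  have "1 \<le> x ^ 4" using x1 by simp
  hence B17: "real B \<le> 17 * x ^ 4" using B_hi nt by linarith
  have xbig: "x * 1000000 \<le> x\<^sup>2" using x(1) x1 by (simp add: power2_eq_square)
  have x46: "17 * x ^ 4 * (2 * x) \<le> x ^ 6"
  proof -
    have "34 * x \<le> x\<^sup>2" using xbig x1 by linarith
    hence "x ^ 4 * (34 * x) \<le> x ^ 4 * x\<^sup>2" using x1 by (intro mult_left_mono) auto
    thus ?thesis by (simp flip: power_add)
  qed
  have "real B * (2 * x) \<le> 17 * x ^ 4 * (2 * x)" using B17 x1 by (intro mult_right_mono) auto
  hence "real B * (2 * x) \<le> y" using x46 xy[of 6] by linarith
  hence B2: "2 * real B * x \<le> y" by (simp add: mult_ac)
  have y1: "1 \<le> y" using xy[of 0] by simp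
  have n_lo: "2 * real B \<le> n"
  proof -
    have "2 * real B * x \<le> y ^ 4" using B2 power_increasing[of 1 4 y] y1 by simp
    also have "\<dots> \<le> t * x" by fact
    finally have "2 * real B \<le> t" using x1 by simp
    thus ?thesis using tn by linarith
  qed
  \<comment> \<open>The largest step range allowed by \<open>M * B <= N\<close>. Since
    \<open>n >= 2 * B\<close>, rounding down loses at most half.\<close>
  define M where "M = nat (N div int B)"
  have M_int: "int M = N div int B" unfolding M_def using N_pos B0 by (simp add: pos_imp_zdiv_nonneg_iff)
  have MB: "int (M * B) \<le> N"
    using M_int B0 by (simp add: mult.commute minus_mod_eq_mult_div[symmetric])
  have "N = N div int B * int B + N mod int B" "N mod int B < int B" using B0 by simp_all
  hence "N < N div int B * int B + 1 * int B" by linarith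
  hence "N < (N div int B + 1) * int B" unfolding distrib_right .
  hence "real_of_int N < real_of_int ((int M + 1) * int B)" unfolding M_int by (simp only: of_int_less_iff)
  hence M_lo: "n < (real M + 1) * real B" by (simp add: n_def)
  have M2: "n \<le> 2 * real M * real B" using M_lo n_lo by (simp add: algebra_simps)
  have Bp: "B \<le> p"
  proof -
    have "real B \<le> n" using n_lo by simp
    also have "n \<le> real p" using N_le_p unfolding n_def by linarith
    finally show ?thesis by simp
  qed
  have BT: "16 * N \<le> int (B * card A)"
  proof -
    have "16 * n \<le> real B * t" using B_lo t0 by (simp add: field_simps)
    hence "real_of_int (16 * N) \<le> real_of_int (int (B * card A))" by (simp add: n_def t_def)
    thus ?thesis by (simp only: of_int_le_iff)
  qed
  define F where "F = 13 * ((real d)\<^sup>2 / p + sqrt p) + 3 * n * lam_inv_sum p d"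
  have main: "2 * real M * t \<le> (real B)\<^sup>2 * F"
    using progression_count[OF N2 B0 Bp MB BT] unfolding F_def t_def n_def .
  \<comment> \<open>The constant is \<open>13 + 13 + 3 * 2\<close>.\<close>
  have F_le: "F \<le> 32 * y ^ 7 * x ^ 5"
  proof -
    have "(real d)\<^sup>2 \<le> (y ^ 8 * x)\<^sup>2" using d_le by (intro power_mono) auto
    also have "\<dots> = (y ^ 4 * x\<^sup>2) * y ^ 12" by (simp add: power_mult_distrib flip: power_add power_mult)
    finally have 1: "(real d)\<^sup>2 / p \<le> y ^ 4 * x\<^sup>2" unfolding p_eq using y0 by (simp add: divide_le_eq)
    have "y ^ 4 * x\<^sup>2 \<le> y ^ 7 * x ^ 5" using y1 x1 by (intro mult_mono power_increasing) auto
    with 1 have 1: "(real d)\<^sup>2 / p \<le> y ^ 7 * x ^ 5" by linarith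
    have "sqrt p = y ^ 6" unfolding p_eq using y0
      by (intro real_sqrt_unique) (auto simp flip: power_mult)
    moreover have "y ^ 6 * 1 \<le> y ^ 7 * x ^ 5" using y1 x1 by (intro mult_mono power_increasing) auto
    ultimately have 2: "sqrt p \<le> y ^ 7 * x ^ 5" by simp
    have "n * lam_inv_sum p d \<le> (y ^ 4 * x ^ 3) * (2 * y ^ 3 * x\<^sup>2)"
      using n_le S_le n0 y0 x1 lam_inv_sum_nonneg by (intro mult_mono) auto
    also have "\<dots> = 2 * ((y ^ 4 * y ^ 3) * (x ^ 3 * x\<^sup>2))" by (simp only: ac_simps)
    also have "\<dots> = 2 * (y ^ 7 * x ^ 5)" by (simp only: power_add[symmetric]) simp
    finally show ?thesis using 1 2 unfolding F_def by simp
  qed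
  have "n * t \<le> (2 * real M * real B) * t" using M2 t0 by (intro mult_right_mono) auto
  also have "\<dots> = (2 * real M * t) * real B" by simp
  also have "\<dots> \<le> ((real B)\<^sup>2 * F) * real B" using main by (intro mult_right_mono) auto
  also have "\<dots> = real B ^ 3 * F" by (simp add: power2_eq_square power3_eq_cube)
  also have "\<dots> \<le> (17 * x ^ 4) ^ 3 * (32 * y ^ 7 * x ^ 5)"
    using B17 F_le n0 lam_inv_sum_nonneg[of p d] unfolding F_def
    by (intro mult_mono power_mono) (auto intro!: add_nonneg_nonneg)
  also have "\<dots> = 157216 * (x ^ 17 * y ^ 7)"
    by (simp add: power_mult_distrib flip: power_add power_mult)
  finally have up: "n * t \<le> 157216 * (x ^ 17 * y ^ 7)" .
  have "y ^ 8 = y ^ 4 * y ^ 4" by (simp flip: power_add)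
  also have "\<dots> \<le> (t * x) * (t * x)" using t1 y0 t0 x1 by (intro mult_mono) auto
  also have "\<dots> = t * t * x\<^sup>2" by (simp add: power2_eq_square)
  also have "\<dots> \<le> n * t * x\<^sup>2" using tn t0 by (intro mult_right_mono) auto
  also have "\<dots> \<le> 157216 * (x ^ 17 * y ^ 7) * x\<^sup>2" using up by (intro mult_right_mono) auto
  also have "\<dots> = 157216 * x ^ 19 * y ^ 7" by (simp flip: power_add)
  finally have "y * y ^ 7 \<le> 157216 * x ^ 19 * y ^ 7" by (simp flip: power_Suc)
  hence "y \<le> 157216 * x ^ 19" using y0 by simp
  also have "\<dots> < x\<^sup>2 * x ^ 19"
  proof (rule mult_strict_right_mono)
    show "157216 < x\<^sup>2" using xbig x(1) by linarith
  qed (use x1 in simp)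
  also have "\<dots> = x ^ 21" by (simp flip: power_add)
  finally show False using x(2) by linarith
qed

text \<open>
  The exponent \<open>21153 = 289 \<cdot> 73 + 56\<close> comes from the \<open>K\<^sup>2\<^sup>8\<^sup>9\<close> of \<open>sum_product_bound\<close> with \<open>K \<le> x\<^sup>7\<^sup>3\<close>; it
  forces \<open>x\<close> to be as small as \<open>p\<^sup>1\<^sup>/\<^sup>9\<^sup>0\<^sup>0\<^sup>0\<^sup>0\<close>.
\<close>
lemma small_index_contradiction:
  fixes x q E :: real
  assumes p_eq: "real p = q ^ 3" and x: "x \<ge> 1000000" "x ^ 21153 \<le> q"
    and S: "lam_inv_sum p d \<le> x * (1 + E)" and E: "E > 0" "E ^ 4 * q ^ 3 = real d ^ 3"
    and T: "q / x \<le> card A" and d: "real d \<le> q * x ^ 16"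
  shows False
proof -
  define n where "n = real_of_int N"
  define t where "t = real (card A)"
  have x1: "x \<ge> 1" "x > 0" using x(1) by auto
  have q0: "q > 0" using x(2) x1 by (meson less_le_trans zero_less_power)
  have xq: "x ^ k \<le> q" if "k \<le> 21153" for k
    using power_increasing[OF that x1(1)] x(2) by linarith
  have q1: "q \<ge> 1" using xq[of 0] by simp
  \<comment> \<open>Numerical constants are paid for by one extra power of \<open>x\<close>.\<close>
  have absorb: "c * x ^ k \<le> x ^ Suc k" if "c \<le> 1000000" for c k
    using that x x1 by (simp add: mult_right_mono)
  have n0: "n \<ge> 1" using N_pos by (simp add: n_def)
  have nd: "n * real d \<le> q ^ 3" using N_mult_d_le unfolding n_def p_eq .
  have t1: "q \<le> t * x" using T x1 by (simp add: t_def field_simps)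
  have t0: "t > 0"
  proof -
    have "0 < q / x" using q0 x1 by simp
    thus ?thesis using T unfolding t_def by linarith
  qed
  have td: "t \<le> real d" using card_A_le_d by (simp add: t_def)
  have n_le: "n \<le> q\<^sup>2 * x"
  proof -
    have "q \<le> real d * x" using t1 mult_right_mono[OF td, of x] x1 by linarith
    hence "n * q \<le> n * (real d * x)" using n0 by (intro mult_left_mono) auto
    also have "\<dots> = (n * real d) * x" by simp
    also have "\<dots> \<le> q ^ 3 * x" using nd x1 by (intro mult_right_mono) auto
    also have "\<dots> = q\<^sup>2 * x * q" by (simp add: power2_eq_square power3_eq_cube)
    finally show ?thesis using q0 by simp
  qed
  have E_le: "E \<le> x ^ 12"
  proof -
    have "E ^ 4 * q ^ 3 \<le> (q * x ^ 16) ^ 3" unfolding E(2) using d by (intro power_mono) auto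
    also have "\<dots> = (x ^ 12) ^ 4 * q ^ 3" by (simp add: power_mult_distrib flip: power_mult)
    finally have "E ^ 4 \<le> (x ^ 12) ^ 4" using q0 by (simp only: mult_le_cancel_right) simp
    thus ?thesis using x1 E(1) power_mono_iff[of E "x ^ 12" 4] by simp
  qed
  have S_le: "lam_inv_sum p d \<le> 2 * x ^ 13"
  proof -
    have "1 + E \<le> 2 * x ^ 12" using E_le one_le_power[OF x1(1), of 12] by linarith
    hence "x * (1 + E) \<le> x * (2 * x ^ 12)" using x1 by (intro mult_left_mono) auto
    also have "\<dots> = 2 * x ^ 13" by (simp flip: power_Suc)
    finally show ?thesis using S by linarith
  qed
  \<comment> \<open>With the sum at most \<open>2 * x ^ 13\<close>, this threshold makes
    \<open>2 * Q\<close> times the sum at most \<open>4 * q / x ^ 2\<close>, below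
    \<open>q / x\<close>.\<close>
  define Q where "Q = q / x ^ 15"
  have Q0: "Q > 0" unfolding Q_def using q0 x1 by simp
  have "2 * Q * lam_inv_sum p d \<le> 2 * Q * (2 * x ^ 13)" using S_le Q0 by (intro mult_left_mono) auto
  also have "\<dots> = 4 * q * (x ^ 13 / x ^ 15)" by (simp add: Q_def)
  also have "x ^ 13 / x ^ 15 = 1 / x\<^sup>2" using x1 by (simp add: frac_eq_eq)
  also have "4 * q * (1 / x\<^sup>2) \<le> q / x" using x x1 q0 by (simp add: field_simps power2_eq_square)
  also have "\<dots> \<le> card A" by (rule T)
  finally have QS: "2 * Q * lam_inv_sum p d \<le> card A" .
  have "card A > 0" using t0 by (simp add: t_def)
  from exists_ratio_large_overlap[OF this Q0 QS] obtain r where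
    r: "r \<in> H" "real (lam p r) > Q" "(real (card A))\<^sup>2 \<le> 4 * real d * real (card (overlap A r))" .
  define k where "k = card (overlap A r)"
  define b where "b = real k"
  define Y where "Y = card (lat p r (3 * N))"
  have b_lo: "q \<le> x ^ 19 * b"
  proof -
    have "q * q \<le> (t * x) * (t * x)" using t1 q0 by (intro mult_mono) auto
    also have "\<dots> = t\<^sup>2 * x\<^sup>2" by (simp add: power2_eq_square)
    also have "\<dots> \<le> (4 * real d * b) * x\<^sup>2" using r(3) unfolding t_def b_def k_def by (intro mult_right_mono) auto
    also have "\<dots> \<le> (4 * (q * x ^ 16) * b) * x\<^sup>2"
      using d by (intro mult_right_mono mult_left_mono) (auto simp: b_def)
    also have "\<dots> = q * ((4 * x ^ 18) * b)" by (simp flip: power_add)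
    finally have "q \<le> (4 * x ^ 18) * b" using q0 by simp
    also have "\<dots> \<le> x ^ 19 * b" using absorb[of 4 18] by (intro mult_right_mono) (auto simp: b_def)
    finally show ?thesis .
  qed
  have b0: "b > 0"
  proof (rule ccontr)
    assume "\<not> b > 0"
    hence "b = 0" by (simp add: b_def)
    thus False using b_lo q0 by simp
  qed
  have "k \<le> card A" unfolding k_def by (intro card_mono finite_A overlap_subset)
  hence b_hi: "b \<le> q * x ^ 16" using td d unfolding b_def t_def by linarith
  have Y_le: "real Y \<le> q * x ^ 17"
  proof -
    have "real Y \<le> 1 + 12 * real_of_int (3 * N) ^ 2 / p + 3 * real_of_int (3 * N) / lam p r"
      using card_lat_le_Suc[OF p_gt_1, of "3 * N" r] N_pos by (simp add: Y_def)
    hence 1: "real Y \<le> 1 + 108 * (n\<^sup>2 / p) + 9 * (n / lam p r)" by (simp add: n_def power_mult_distrib)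
    have "n\<^sup>2 \<le> (q\<^sup>2 * x)\<^sup>2" using n_le n0 by (intro power_mono) auto
    also have "\<dots> = (q * x\<^sup>2) * q ^ 3" by (simp add: power2_eq_square power3_eq_cube)
    finally have "n\<^sup>2 / p \<le> q * x\<^sup>2" unfolding p_eq using q0 by (simp add: divide_le_eq)
    also have "\<dots> \<le> q * x ^ 16" using q0 x1 by (intro mult_left_mono power_increasing) auto
    finally have 2: "n\<^sup>2 / p \<le> q * x ^ 16" .
    have "n / lam p r \<le> n / Q" using r(2) Q0 n0 by (intro divide_left_mono) auto
    also have "\<dots> \<le> (q\<^sup>2 * x) / Q" using n_le Q0 by (intro divide_right_mono) auto
    also have "\<dots> = q * x ^ 16" unfolding Q_def using q0 x1 power_Suc[of x 15] by (simp add: power2_eq_square)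
    finally have 3: "n / lam p r \<le> q * x ^ 16" .
    have "1 * 1 \<le> q * x ^ 16" using q1 one_le_power[OF x1(1), of 16] by (intro mult_mono) auto
    hence "real Y \<le> q * (118 * x ^ 16)" using 1 2 3 by simp
    also have "\<dots> \<le> q * x ^ 17" using absorb[of 118 16] q0 by (intro mult_left_mono) auto
    finally show ?thesis .
  qed
  \<comment> \<open>The largest popularity threshold that \<open>card_large_overlap_le\<close>
    permits.\<close>
  define n1 where "n1 = k\<^sup>2 div (2 * d)"
  have n1_le: "2 * d * n1 \<le> k\<^sup>2" unfolding n1_def by (rule times_div_less_eq_dividend)
  have d0: "real d > 0" using d_pos by simp
  have bb: "q\<^sup>2 \<le> x ^ 38 * b\<^sup>2"
  proof -
    have "q\<^sup>2 \<le> (x ^ 19 * b)\<^sup>2" using b_lo q0 by (intro power_mono) auto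
    thus ?thesis by (simp add: power_mult_distrib flip: power_mult)
  qed
  have b2d: "q \<le> 2 * x ^ 54 * (b\<^sup>2 / (2 * real d))"
  proof -
    have "q * real d \<le> q * (q * x ^ 16)" using d q0 by (intro mult_left_mono) auto
    also have "\<dots> = q\<^sup>2 * x ^ 16" by (simp add: power2_eq_square)
    also have "\<dots> \<le> (x ^ 38 * b\<^sup>2) * x ^ 16" using bb x1 by (intro mult_right_mono) auto
    also have "\<dots> = (x ^ 38 * x ^ 16) * b\<^sup>2" by simp
    also have "\<dots> = x ^ 54 * b\<^sup>2" by (simp flip: power_add)
    finally show ?thesis using d0 by (simp add: field_simps)
  qed
  \<comment> \<open>The exponent 55 is 38 from the lower bound for \<open>b ^ 2\<close>, 16 from
    \<open>d\<close>, and 1 for the constants.\<close>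
  have n1_lo: "q \<le> x ^ 55 * real n1"
  proof -
    have "b\<^sup>2 / (2 * real d) < real n1 + 1"
    proof -
      have "k\<^sup>2 < (n1 + 1) * (2 * d)" unfolding n1_def using d_pos
        by (metis Suc_eq_plus1 dividend_less_div_times less_numeral_extra(3) mult_is_0 mult_Suc neq0_conv zero_neq_numeral)
      hence "real (k\<^sup>2) < real ((n1 + 1) * (2 * d))" by (simp only: of_nat_less_iff)
      thus ?thesis using d0 by (simp add: b_def field_simps)
    qed
    hence "2 * x ^ 54 * (b\<^sup>2 / (2 * real d)) \<le> 2 * x ^ 54 * (real n1 + 1)"
      using x1 by (intro mult_left_mono) auto
    hence 1: "q \<le> 2 * x ^ 54 * real n1 + 2 * x ^ 54" using b2d by (simp add: algebra_simps)
    have "4 * x ^ 54 \<le> q" using absorb[of 4 54] xq[of 55] by simp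
    hence "q \<le> (4 * x ^ 54) * real n1" using 1 by linarith
    also have "\<dots> \<le> x ^ 55 * real n1" using absorb[of 4 54] by (intro mult_right_mono) auto
    finally show ?thesis .
  qed
  have n1_pos: "n1 > 0"
  proof (rule Nat.gr0I)
    assume "n1 = 0"
    thus False using n1_lo q0 by simp
  qed
  define K where "K = Y div n1 + 1"
  have YK: "Y \<le> K * n1" unfolding K_def using n1_pos
    by (metis Suc_eq_plus1 dividend_less_div_times less_imp_le_nat mult_Suc add.commute)
  \<comment> \<open>The exponent 73 is \<open>55 + 17\<close>, plus 1 for rounding up.\<close>
  have K_le: "real K \<le> x ^ 73"
  proof -
    have "real (Y div n1) \<le> real Y / real n1" by (rule of_nat_div_le_of_nat)
    also have "\<dots> \<le> x ^ 72"
    proof -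
      have "q * x ^ 17 \<le> (x ^ 55 * real n1) * x ^ 17" using n1_lo x1 by (intro mult_right_mono) auto
      hence "real Y \<le> (x ^ 55 * real n1) * x ^ 17" using Y_le by linarith
      also have "\<dots> = (x ^ 55 * x ^ 17) * real n1" by simp
      also have "\<dots> = x ^ 72 * real n1" by (simp flip: power_add)
      finally show ?thesis using n1_pos by (simp add: divide_le_eq)
    qed
    finally have "real K \<le> x ^ 72 + 1" by (simp add: K_def)
    also have "\<dots> \<le> 2 * x ^ 72" using one_le_power[OF x1(1), of 72] by simp
    also have "\<dots> \<le> x ^ 73" using absorb[of 2 72] by simp
    finally show ?thesis .
  qed
  have p_big: "real p \<ge> 5"
  proof -
    have "5 \<le> q" using xq[of 1] x by simp
    moreover have "q ^ 1 \<le> q ^ 3" using q1 by (intro power_increasing) auto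
    ultimately show ?thesis unfolding p_eq by simp
  qed
  have big: "64 * (p - 1) \<le> k ^ 4"
  proof -
    have "64 * q ^ 3 * x ^ 76 \<le> q ^ 3 * x ^ 77"
      using absorb[of 64 76] q0 mult_left_mono[of "64 * x ^ 76" "x ^ 77" "q ^ 3"] by simp
    also have "\<dots> \<le> q ^ 3 * q" using xq[of 77] q0 by (intro mult_left_mono) auto
    also have "\<dots> = q\<^sup>2 * q\<^sup>2" by (simp add: power2_eq_square power3_eq_cube)
    also have "\<dots> \<le> (x ^ 38 * b\<^sup>2) * (x ^ 38 * b\<^sup>2)" using bb by (intro mult_mono) auto
    also have "\<dots> = b ^ 4 * (x ^ 38 * x ^ 38)" by (simp add: power2_eq_square power4_eq_xxxx)
    also have "\<dots> = b ^ 4 * x ^ 76" by (simp flip: power_add)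
    finally have "64 * q ^ 3 \<le> b ^ 4" using x1 by (simp only: mult_le_cancel_right) auto
    hence "real (64 * p) \<le> real (k ^ 4)" by (simp add: p_eq b_def)
    hence "64 * p \<le> k ^ 4" by (simp only: of_nat_le_iff)
    thus ?thesis by linarith
  qed
  have "(p - 1) * k\<^sup>2 \<le> 2 * K ^ 289 * Y * (k\<^sup>2 + p)"
    unfolding k_def Y_def
    by (rule sum_product_overlap) (use p_big n1_pos n1_le YK big in \<open>simp_all add: k_def Y_def\<close>)
  hence "real ((p - 1) * k\<^sup>2) \<le> real (2 * K ^ 289 * Y * (k\<^sup>2 + p))" by (simp only: of_nat_le_iff)
  hence main: "real (p - 1) * b\<^sup>2 \<le> 2 * real K ^ 289 * real Y * (b\<^sup>2 + real p)" by (simp add: b_def)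
  have b2p: "b\<^sup>2 \<le> real p"
  proof -
    have "b\<^sup>2 \<le> (q * x ^ 16)\<^sup>2" using b_hi b0 by (intro power_mono) auto
    also have "\<dots> = q\<^sup>2 * x ^ 32" by (simp add: power_mult_distrib flip: power_mult)
    also have "\<dots> \<le> q\<^sup>2 * q" using xq[of 32] by (intro mult_left_mono) auto
    also have "\<dots> = real p" by (simp add: p_eq power2_eq_square power3_eq_cube)
    finally show ?thesis .
  qed
  have "real p / 2 \<le> real (p - 1)" using p_big by (simp add: of_nat_diff)
  hence "real p / 2 * b\<^sup>2 \<le> real (p - 1) * b\<^sup>2" by (intro mult_right_mono) auto
  also note main
  also have "2 * real K ^ 289 * real Y * (b\<^sup>2 + real p) \<le> 2 * real K ^ 289 * real Y * (2 * real p)"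
    using b2p by (intro mult_left_mono) auto
  finally have "real p * b\<^sup>2 \<le> real p * (8 * (real K ^ 289 * real Y))" by (simp add: mult_ac)
  hence b2: "b\<^sup>2 \<le> 8 * (real K ^ 289 * real Y)" using p_big by simp
  have "real K ^ 289 \<le> (x ^ 73) ^ 289" using K_le by (intro power_mono) auto
  also have "(x ^ 73) ^ 289 = x ^ 21097" by (simp flip: power_mult)
  finally have "real K ^ 289 * real Y \<le> x ^ 21097 * (q * x ^ 17)"
    using Y_le x1 by (intro mult_mono) auto
  also have "\<dots> = q * (x ^ 21097 * x ^ 17)" by simp
  also have "x ^ 21097 * x ^ 17 = x ^ 21114" by (simp flip: power_add)
  finally have "b\<^sup>2 \<le> 8 * (q * x ^ 21114)" using b2 by linarith
  \<comment> \<open>The exponents add up to \<open>38 + 73 * 289 + 17 = 21152\<close>; the factor 8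
    takes the last power of \<open>x\<close>.\<close>
  hence "x ^ 38 * b\<^sup>2 \<le> x ^ 38 * (8 * (q * x ^ 21114))" using x1 by (intro mult_left_mono) auto
  also have "\<dots> = q * (8 * (x ^ 38 * x ^ 21114))" by simp
  also have "x ^ 38 * x ^ 21114 = x ^ 21152" by (simp flip: power_add)
  finally have "q * q \<le> q * (8 * x ^ 21152)" using bb by (simp add: power2_eq_square)
  hence "q \<le> 8 * x ^ 21152" using q0 by simp
  also have "\<dots> < x * x ^ 21152" using x x1 by (intro mult_strict_right_mono) auto
  also have "\<dots> = x ^ 21153" by (simp flip: power_Suc)
  finally show False using x(2) by linarith
qed

end

text \<open>The divisor bound with exponent \<open>1 / 1000000\<close> makes the prefactor
  \<open>784 * J ^ 2 * D ^ 2\<close> of order \<open>p powr (4 / 1000000)\<close> times a squared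
  logarithm, which \<open>p powr (1 / 90000)\<close> eventually dominates.\<close>

lemma lam_inv_sum_bound_eventually:
  obtains p\<^sub>0 :: nat where
    "\<And>p. p \<ge> p\<^sub>0 \<Longrightarrow> real p powr (1 / 90000) \<ge> 1000000"
    "\<And>p d R. p \<ge> p\<^sub>0 \<Longrightarrow> prime p \<Longrightarrow> d > 0 \<Longrightarrow> R > 0 \<Longrightarrow> R ^ 4 = real d * real p \<Longrightarrow>
       lam_inv_sum (int p) d \<le> real p powr (1 / 90000) * (1 + real d / R)"
proof -
  obtain C :: real where C: "C \<ge> 1"
    "\<And>n. n > 0 \<Longrightarrow> real (card {i::nat. i dvd n}) \<le> C * real n powr (1 / 1000000)"
    using card_divisors_powr_bound[of "1 / 1000000"] by auto
  have "eventually (\<lambda>z::real. 784 * (log 2 (2 * z))\<^sup>2 * (C * (4 * z\<^sup>2) powr (1 / 1000000))\<^sup>2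
      \<le> z powr (1 / 90000)) at_top"
    using C(1) by real_asymp
  moreover have "eventually (\<lambda>z::real. z powr (1 / 90000) \<ge> 1000000) at_top" by real_asymp
  ultimately have "eventually (\<lambda>z::real. 784 * (log 2 (2 * z))\<^sup>2 * (C * (4 * z\<^sup>2) powr (1 / 1000000))\<^sup>2
      \<le> z powr (1 / 90000) \<and> z powr (1 / 90000) \<ge> 1000000) at_top" by (rule eventually_conj)
  then obtain z\<^sub>0 where z\<^sub>0: "\<And>z::real. z \<ge> z\<^sub>0 \<Longrightarrow>
      784 * (log 2 (2 * z))\<^sup>2 * (C * (4 * z\<^sup>2) powr (1 / 1000000))\<^sup>2 \<le> z powr (1 / 90000) \<and>
      z powr (1 / 90000) \<ge> 1000000"
    unfolding eventually_at_top_linorder by blast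
  show ?thesis
  proof (rule that[of "nat \<lceil>z\<^sub>0\<rceil>"])
    fix p assume "p \<ge> nat \<lceil>z\<^sub>0\<rceil>"
    hence "real p \<ge> z\<^sub>0" by linarith
    thus "real p powr (1 / 90000) \<ge> 1000000" using z\<^sub>0 by blast
  next
    fix p d :: nat and R :: real
    assume "p \<ge> nat \<lceil>z\<^sub>0\<rceil>" and p: "prime p" and d: "d > 0" and R: "R > 0" "R ^ 4 = real d * real p"
    hence pz: "real p \<ge> z\<^sub>0" by linarith
    have p0: "p > 0" using p by (simp add: prime_gt_0_nat)
    obtain m where m: "2 ^ m \<le> p" "p < 2 ^ (m + 1)" using ex_power_ivl1[of 2 p] p0 by auto
    define J where "J = m + 1"
    have J: "p \<le> 2 ^ J" "2 ^ J \<le> 2 * p" using m by (auto simp: J_def)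
    have J_le: "real J \<le> log 2 (2 * real p)"
    proof -
      have "real (2 ^ J) \<le> real (2 * p)" using J(2) by (simp only: of_nat_le_iff)
      hence "2 powr real J \<le> 2 * real p" by (simp add: powr_realpow)
      thus ?thesis using p0 by (simp add: le_log_iff)
    qed
    define W where "W = C * (4 * (real p)\<^sup>2) powr (1 / 1000000)"
    define D where "D = nat \<lfloor>W\<rfloor>"
    have sq: "real ((2 * p)\<^sup>2) = 4 * (real p)\<^sup>2" by (simp add: power_mult_distrib)
    have Dn: "card {k. k dvd n} \<le> D" if n: "n > 0" "n \<le> (2 * p)\<^sup>2" for n
    proof -
      have "real n \<le> real ((2 * p)\<^sup>2)" using n(2) by (simp only: of_nat_le_iff)
      hence "real n powr (1 / 1000000) \<le> (4 * (real p)\<^sup>2) powr (1 / 1000000)"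
        unfolding sq by (intro powr_mono2) auto
      hence "C * real n powr (1 / 1000000) \<le> W" unfolding W_def using C(1) by (intro mult_left_mono) auto
      hence "real (card {k. k dvd n}) \<le> W" using C(2)[OF n(1)] by linarith
      thus ?thesis unfolding D_def by (simp add: le_nat_floor)
    qed
    have "{k::nat. k dvd 1} = {1}" by auto
    hence D1: "D \<ge> 1" using Dn[of 1] p0 by simp
    have "W \<ge> 0" unfolding W_def using C(1) by simp
    hence D_le: "real D \<le> W" unfolding D_def by simp
    have "lam_inv_sum (int p) d \<le> 784 * (real J)\<^sup>2 * (real D)\<^sup>2 * (1 + real d / R)"
      by (rule lam_inv_sum_le[OF p d J D1 Dn R])
    also have "\<dots> \<le> real p powr (1 / 90000) * (1 + real d / R)"
    proof (rule mult_right_mono)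
      have "784 * (real J)\<^sup>2 * (real D)\<^sup>2 \<le> 784 * (log 2 (2 * real p))\<^sup>2 * W\<^sup>2"
        using J_le D_le by (intro mult_mono power_mono) auto
      also have "\<dots> \<le> real p powr (1 / 90000)" using z\<^sub>0[OF pz] unfolding W_def by blast
      finally show "784 * (real J)\<^sup>2 * (real D)\<^sup>2 \<le> real p powr (1 / 90000)" .
    qed (use R in simp)
    finally show "lam_inv_sum (int p) d \<le> real p powr (1 / 90000) * (1 + real d / R)" .
  qed
qed

text \<open>The integers of the real interval lie in the half-open one that starts at the ceiling of
  \<open>L + 1\<close> and has length the floor of \<open>p / d\<close>; \<open>d <= p\<close> makes
  this length positive.\<close>

lemma T_count_coset_in_interval:
  assumes "prime p" "d > 0" "d \<le> p" "coprime l (int p)"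
  obtains A where "coset_in_interval p d l \<lceil>L + 1\<rceil> (int (p div d)) A"
    "T_count p d l L (real p / real d) = card A"
proof -
  define X where "X = {x :: nat. L + 1 \<le> real x \<and> real x \<le> L + real p / real d \<and> [int x ^ d = l] (mod int p)}"
  have "coset_in_interval p d l \<lceil>L + 1\<rceil> (int (p div d)) (int ` X)"
  proof
    show "int ` X \<subseteq> {\<lceil>L + 1\<rceil>..<\<lceil>L + 1\<rceil> + int (p div d)}"
    proof clarify
      fix x assume x: "x \<in> X"
      have "L + 1 \<le> real_of_int (int x)" using x by (simp add: X_def)
      hence lo: "\<lceil>L + 1\<rceil> \<le> int x" by (simp only: ceiling_le_iff)
      have "real x \<le> L + real p / real d" using x by (simp add: X_def)
      moreover have "real_of_int (int x - \<lceil>L + 1\<rceil> + 1) = real x - real_of_int \<lceil>L + 1\<rceil> + 1" by simp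
      ultimately have "real_of_int (int x - \<lceil>L + 1\<rceil> + 1) \<le> real p / real d"
        using le_of_int_ceiling[of "L + 1"] by linarith
      hence "int x - \<lceil>L + 1\<rceil> + 1 \<le> \<lfloor>real p / real d\<rfloor>" by (simp only: le_floor_iff)
      also have "\<lfloor>real p / real d\<rfloor> = int (p div d)" by (rule floor_divide_of_nat_eq)
      finally show "int x \<in> {\<lceil>L + 1\<rceil>..<\<lceil>L + 1\<rceil> + int (p div d)}" using lo by simp
    qed
    show "1 \<le> int (p div d)" using assms by (simp add: div_greater_zero_iff Suc_le_eq)
    show "int (p div d) * int d \<le> int p" by (metis of_nat_mult of_nat_le_iff div_times_less_eq_dividend)
  qed (use assms in \<open>auto simp: X_def\<close>)
  moreover have "T_count p d l L (real p / real d) = card (int ` X)"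
    unfolding T_count_def X_def by (simp add: card_image)
  ultimately show ?thesis using that by blast
qed

theorem theorem2:
  "\<exists>c::real. c > 0 \<and> (\<exists>p\<^sub>0::nat. \<forall>p::nat. prime p \<and> p \<ge> p\<^sub>0 \<longrightarrow>
     (\<forall>(d::nat) (l::int) (L::real). d > 0 \<and> coprime l (int p) \<longrightarrow>
        real (T_count p d l L (real p / real d)) < real p powr (1/3 - c)))"
proof -
  obtain p\<^sub>0 :: nat where p\<^sub>0: "\<And>p. p \<ge> p\<^sub>0 \<Longrightarrow> real p powr (1 / 90000) \<ge> 1000000"
    "\<And>p d R. p \<ge> p\<^sub>0 \<Longrightarrow> prime p \<Longrightarrow> d > 0 \<Longrightarrow> R > 0 \<Longrightarrow> R ^ 4 = real d * real p \<Longrightarrow>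
       lam_inv_sum (int p) d \<le> real p powr (1 / 90000) * (1 + real d / R)"
    by (rule lam_inv_sum_bound_eventually) blast
  have "real (T_count p d l L (real p / real d)) < real p powr (1 / 3 - 1 / 90000)"
    if p: "prime p" "p \<ge> p\<^sub>0" and d: "d > 0" and l: "coprime l (int p)" for p d l L
  proof (rule ccontr)
    assume neg: "\<not> ?thesis"
    \<comment> \<open>Then \<open>y = x ^ 7500\<close>, and the cube root of \<open>p\<close> is
      \<open>y ^ 4 = x ^ 30000\<close>, which leaves room for the required
      \<open>x ^ 21153\<close>.\<close>
    define x y where "x = real p powr (1 / 90000)" and "y = real p powr (1 / 12)"
    have p0: "real p > 0" using p by (simp add: prime_gt_0_nat)
    have x: "x \<ge> 1000000" unfolding x_def by (rule p\<^sub>0(1)[OF p(2)])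
    have pow: "(real p powr a) ^ n = real p powr (a * real n)" for a n
      using p0 by (simp add: powr_powr flip: powr_realpow)
    have y0: "y > 0" unfolding y_def using p0 by simp
    have p_eq: "real p = y ^ 12" unfolding y_def pow using p0 by simp
    have xy: "x ^ 7500 = y" unfolding x_def y_def pow by simp
    have "x ^ 21 \<le> x ^ 7500" using x by (intro power_increasing) auto
    hence x21: "x ^ 21 \<le> y" unfolding xy .
    have "x ^ 21153 \<le> x ^ (7500 * 4)" using x by (intro power_increasing) auto
    hence x21153: "x ^ 21153 \<le> y ^ 4" unfolding power_mult xy .
    have "real p powr (1 / 3 - 1 / 90000) = y ^ 4 / x"
      unfolding x_def y_def pow powr_diff by simp
    hence T: "y ^ 4 / x \<le> real (T_count p d l L (real p / real d))" using neg by simp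
    have T0: "y ^ 4 / x > 0" using y0 x by simp
    \<comment> \<open>For \<open>d > p\<close> the interval from \<open>L + 1\<close> to
      \<open>L + p / d\<close> is empty.\<close>
    have dp: "d \<le> p"
    proof (rule ccontr)
      assume "\<not> d \<le> p"
      hence "real p / real d < 1" using d by simp
      hence "{z :: nat. L + 1 \<le> real z \<and> real z \<le> L + real p / real d \<and> [int z ^ d = l] (mod int p)} = {}"
        by auto
      hence "T_count p d l L (real p / real d) = 0" unfolding T_count_def by (simp only: card.empty)
      thus False using T T0 by simp
    qed
    obtain A where A: "coset_in_interval p d l \<lceil>L + 1\<rceil> (int (p div d)) A"
      "T_count p d l L (real p / real d) = card A"
      by (rule T_count_coset_in_interval[OF p(1) d dp l])
    interpret coset_in_interval p d l "\<lceil>L + 1\<rceil>" "int (p div d)" A by (rule A(1))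
    define R where "R = (real d * real p) powr (1 / 4)"
    define E where "E = real d / R"
    have R: "R > 0" "R ^ 4 = real d * real p"
      unfolding R_def using p0 d by (simp_all add: powr_powr flip: powr_realpow)
    have S: "lam_inv_sum (int p) d \<le> x * (1 + E)"
      unfolding x_def E_def by (rule p\<^sub>0(2)[OF p(2,1) d R])
    have E: "E > 0" "E ^ 4 * y ^ 12 = real d ^ 3"
    proof -
      show "E > 0" unfolding E_def using R d by simp
      have "E ^ 4 * real p = real d ^ 4 / (real d * real p) * real p"
        unfolding E_def by (simp add: power_divide R(2))
      also have "\<dots> = real d ^ 3" using p0 d by (simp add: power4_eq_xxxx power3_eq_cube)
      finally show "E ^ 4 * y ^ 12 = real d ^ 3" unfolding p_eq .
    qed
    have q3: "(y ^ 4) ^ 3 = y ^ 12" and q2: "(y ^ 4)\<^sup>2 = y ^ 8" by (simp_all flip: power_mult)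
    have T': "y ^ 4 / x \<le> real (card A)" using T A(2) by simp
    \<comment> \<open>The ranges are \<open>d\<close> up to slightly above the cube root of
      \<open>p\<close>, \<open>d\<close> from slightly below its square upwards, and everything
      between.\<close>
    consider "real d \<le> y ^ 4 * x ^ 16" | "y ^ 8 \<le> real d * x ^ 3"
      | "y ^ 4 * x ^ 16 \<le> real d" "real d * x ^ 3 \<le> y ^ 8" by linarith
    thus False
    proof cases
      case 1
      show False
        by (rule small_index_contradiction[OF _ x x21153 S E(1) _ T' 1]) (simp_all only: q3 p_eq E(2))
    next
      case 2
      show False by (rule large_index_contradiction[OF p_eq x x21 S E T' 2])
    next
      case 3
      have "real (card A) < y ^ 4 / x"
      proof (rule middle_range_numeric[OF card_A_square_le S E(1) _ _ _ _ _ _ 3(1)])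
        show "E ^ 4 * (y ^ 4) ^ 3 = real d ^ 3" unfolding q3 by (rule E(2))
        show "real_of_int (int (p div d)) * real d \<le> (y ^ 4) ^ 3"
          using N_mult_d_le unfolding q3 p_eq .
        show "real d * x ^ 3 \<le> (y ^ 4)\<^sup>2" unfolding q2 by (rule 3(2))
      qed (use y0 d x in auto)
      thus False using T' by linarith
    qed
  qed
  thus ?thesis by (intro exI[of _ "1 / 90000"] conjI exI[of _ p\<^sub>0]) auto
qed

end
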